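(* Let $\Bbbk$ be a field, $D\in\mathbb{Z}^+$, and let $\mathcal{A}=\{\mathbf{a}_1,\ldots,\mathbf{a}_n\}\subset\mathbb{N}^3$ be a finite set with $|\mathbf{a}_i|=D$ for all $i$ and $\mathbf{a}_{n-2}=D\boldsymbol\epsilon_1$, $\mathbf{a}_{n-1}=D\boldsymbol\epsilon_2$, $\mathbf{a}_n=D\boldsymbol\epsilon_3$. Let $\mathcal{S}$ be the monoid spanned by $\mathcal{A}$ and $\Bbbk[\mathcal{X}_{\mathcal{A}}]=\Bbbk[x_1,\ldots,x_n]/I_{\mathcal{A}}$. The Castelnuovo-Mumford regularity of $\Bbbk[\mathcal{X}_{\mathcal{A}}]$ is $$\mathrm{reg}(\Bbbk[\mathcal{X}_{\mathcal{A}}])=\max\left\{m(\mathrm{AP}_{\mathcal{S}}),\ m(E_{\mathcal{S}}^{3,1})-1,\ m(E_{\mathcal{S}}^{2,0})-1,\ m(E_{\mathcal{S}}^{3,0})-1,\ m(E_{\mathcal{S}}^{3,3})-2\right\}.$$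
   Context: $\{\boldsymbol\epsilon_1,\boldsymbol\epsilon_2,\boldsymbol\epsilon_3\}$ is the canonical basis of $\mathbb{N}^3$; for a vector, $|\cdot|$ is the sum of its entries. $\mathcal{S}=\{\sum_i\lambda_i\mathbf{a}_i\mid\lambda_i\in\mathbb{N}\}$ and $\mathbf{e}_i=D\boldsymbol\epsilon_i$ for $i=1,2,3$. $I_{\mathcal{A}}$ is the toric ideal, the kernel of the $\Bbbk$-algebra homomorphism $\Bbbk[x_1,\ldots,x_n]\to\Bbbk[t_1,t_2,t_3]$, $x_i\mapsto t_1^{a_{i1}}t_2^{a_{i2}}t_3^{a_{i3}}$, where $\mathbf{a}_i=(a_{i1},a_{i2},a_{i3})$; it is homogeneous for the standard grading. When $\Bbbk$ is infinite, it is the defining ideal of the projective monomial surface $\mathcal{X}_{\mathcal{A}}\subset\mathbb{P}^{n-1}_{\Bbbk}$, the Zariski closure of the set of points parametrized by the monomials $t_1^{a_{i1}}t_2^{a_{i2}}t_3^{a_{i3}}$, and $\Bbbk[\mathcal{X}_{\mathcal{A}}]=\Bbbk[x_1,\ldots,x_n]/I_{\mathcal{A}}$ is its coordinate ring. The regularity is with respect to the standard grading on $\Bbbk[x_1,\ldots,x_n]$. For $s\in\mathbb{N}$ let $H_s=\{(x,y,z)\in\mathbb{N}^3\mid x+y+z=sD\}$; for a finite subset $F\subset\mathcal{S}$ let $F_s=F\cap H_s$ and $m(F)=\max\{s\in\mathbb{N}\mid F_s\ne\emptyset\}$; for $F=\emptyset$ we set $m(F)=-\infty$ (i.e. the corresponding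 term is omitted from the maximum). Apery set: $\mathrm{AP}_{\mathcal{S}}=\{\mathbf{s}\in\mathcal{S}\mid\mathbf{s}-\mathbf{e}_i\notin\mathcal{S}\text{ for all }i=1,2,3\}$. Exceptional sets (these and $\mathrm{AP}_{\mathcal{S}}$ are finite): - $E_{\mathcal{S}}^{3,1}$: all $\mathbf{s}\in\mathcal{S}$ with $\mathbf{s}-\mathbf{e}_j\in\mathcal{S}$ for all $j$ and such that, for some permutation $(i_1,i_2,i_3)$ of $(1,2,3)$, $\mathbf{s}-(\mathbf{e}_{i_1}+\mathbf{e}_{i_2})\in\mathcal{S}$, $\mathbf{s}-(\mathbf{e}_{i_1}+\mathbf{e}_{i_3})\notin\mathcal{S}$, $\mathbf{s}-(\mathbf{e}_{i_2}+\mathbf{e}_{i_3})\notin\mathcal{S}$. - $E_{\mathcal{S}}^{2,0}$: all $\mathbf{s}\in\mathcal{S}$ such that, for some permutation $(i_1,i_2,i_3)$ of $(1,2,3)$, $\mathbf{s}-\mathbf{e}_{i_1}\in\mathcal{S}$, $\mathbf{s}-\mathbf{e}_{i_2}\in\mathcal{S}$, $\mathbf{s}-\mathbf{e}_{i_3}\notin\mathcal{S}$ and $\mathbf{s}-(\mathbf{e}_{i_1}+\mathbf{e}_{i_2})\notin\mathcal{S}$. - $E_{\mathcal{S}}^{3,0}$: all $\mathbf{s}\in\mathcal{S}$ with $\mathbf{s}-\mathbf{e}_i\in\mathcal{S}$ for all $i$ and $\mathbf{s}-(\mathbf{e}_i+\mathbf{e}_j)\notin\mathcal{S}$ for all $i\ne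 j$. - $E_{\mathcal{S}}^{3,3}$: all $\mathbf{s}\in\mathcal{S}$ with $\mathbf{s}-\mathbf{e}_i\in\mathcal{S}$ for all $i$, $\mathbf{s}-(\mathbf{e}_i+\mathbf{e}_j)\in\mathcal{S}$ for all $i\ne j$, and $\mathbf{s}-(\mathbf{e}_1+\mathbf{e}_2+\mathbf{e}_3)\notin\mathcal{S}$. *)

theory Defs
  imports "HOL-Analysis.Analysis" "HOL-Library.Poly_Mapping"
begin

(* A monomial x^u is a finitely supported exponent u :: nat \<Rightarrow>\<^sub>0 nat, and k[x_1,...,x_n] is the
   subring of the polynomial ring in x_0, x_1, x_2, ... involving only x_1,...,x_n. *)

definition polys :: "nat \<Rightarrow> ((nat \<Rightarrow>\<^sub>0 nat) \<Rightarrow>\<^sub>0 'k::zero) set" where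
  "polys n = {p. \<forall>u \<in> Poly_Mapping.keys p. Poly_Mapping.keys u \<subseteq> {1..n}}"

definition mon_degree :: "(nat \<Rightarrow>\<^sub>0 nat) \<Rightarrow> nat" where
  "mon_degree u = (\<Sum>i\<in>Poly_Mapping.keys u. Poly_Mapping.lookup u i)"

(* Standard grading, indexed by int because matrix entries of a graded map are homogeneous of
   degree a difference of shifts; in a negative degree only 0 is homogeneous. *)
definition homogeneous :: "int \<Rightarrow> ((nat \<Rightarrow>\<^sub>0 nat) \<Rightarrow>\<^sub>0 'k::zero) \<Rightarrow> bool" where
  "homogeneous d p \<longleftrightarrow> (\<forall>u \<in> Poly_Mapping.keys p. int (mon_degree u) = d)"


(* The free module R^r over R = k[x_1,...,x_n]; a vector is a function padded by 0 from r on. *)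
definition free_module :: "nat \<Rightarrow> nat \<Rightarrow> (nat \<Rightarrow> ((nat \<Rightarrow>\<^sub>0 nat) \<Rightarrow>\<^sub>0 'k::zero)) set" where
  "free_module n r = {v. (\<forall>k<r. v k \<in> polys n) \<and> (\<forall>k\<ge>r. v k = 0)}"

definition mat_apply ::
  "nat \<Rightarrow> nat \<Rightarrow> (nat \<Rightarrow> nat \<Rightarrow> 'r) \<Rightarrow> (nat \<Rightarrow> 'r) \<Rightarrow> nat \<Rightarrow> 'r::semiring_0" where
  "mat_apply r s M v = (\<lambda>k. if k < r then \<Sum>l<s. M k l * v l else 0)"

(* A minimal graded free resolution
     0 \<rightarrow> F_p \<rightarrow> ... \<rightarrow> F_1 \<rightarrow> F_0 \<rightarrow> R/I \<rightarrow> 0,   R = k[x_1,...,x_n],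
   for a homogeneous ideal I of R. Here degs i lists the degrees of a homogeneous basis of F_i,
   i.e. F_i is the direct sum of the R(-d) for d in degs i; aug k represents modulo I the image in
   R/I of the k-th basis element of F_0; phi i is the matrix of F_(i+1) \<rightarrow> F_i.
   The last condition is minimality: phi i maps F_(i+1) into (x_1,...,x_n) F_i. *)
definition minimal_graded_free_resolution ::
  "nat \<Rightarrow> ((nat \<Rightarrow>\<^sub>0 nat) \<Rightarrow>\<^sub>0 'k::field) set \<Rightarrow> (nat \<Rightarrow> int list) \<Rightarrow>
   (nat \<Rightarrow> ((nat \<Rightarrow>\<^sub>0 nat) \<Rightarrow>\<^sub>0 'k)) \<Rightarrow> (nat \<Rightarrow> nat \<Rightarrow> nat \<Rightarrow> ((nat \<Rightarrow>\<^sub>0 nat) \<Rightarrow>\<^sub>0 'k)) \<Rightarrow> bool" where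
  "minimal_graded_free_resolution n I degs aug phi \<longleftrightarrow>
     (let r = (\<lambda>i. length (degs i));
          F = (\<lambda>i. free_module n (r i));
          eps = (\<lambda>v. \<Sum>k<r 0. v k * aug k);
          d = (\<lambda>i. mat_apply (r i) (r (Suc i)) (phi i))
      in
        (\<exists>p. \<forall>i>p. degs i = []) \<and>
        (\<forall>k<r 0. aug k \<in> polys n \<and> homogeneous (degs 0 ! k) (aug k)) \<and>
        (\<forall>i. \<forall>k<r i. \<forall>l<r (Suc i).
           phi i k l \<in> polys n \<and> homogeneous (degs (Suc i) ! l - degs i ! k) (phi i k l)) \<and>
        (\<forall>p\<in>polys n. \<exists>v\<in>F 0. p - eps v \<in> I) \<and>
        {v \<in> F 0. eps v \<in> I} = d 0 ` F 1 \<and>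
        (\<forall>i. {v \<in> F (Suc i). d i v = (\<lambda>_. 0)} = d (Suc i) ` F (Suc (Suc i))) \<and>
        (\<forall>i. \<forall>k<r i. \<forall>l<r (Suc i). Poly_Mapping.lookup (phi i k l) 0 = 0))"

(* The minimal graded free resolution is unique up to isomorphism of graded complexes, so the
   Betti numbers do not depend on the one that is chosen. *)
definition resolution_degrees ::
  "nat \<Rightarrow> ((nat \<Rightarrow>\<^sub>0 nat) \<Rightarrow>\<^sub>0 'k::field) set \<Rightarrow> nat \<Rightarrow> int list" where
  "resolution_degrees n I =
     (SOME degs. \<exists>aug phi. minimal_graded_free_resolution n I degs aug phi)"

definition graded_betti ::
  "nat \<Rightarrow> ((nat \<Rightarrow>\<^sub>0 nat) \<Rightarrow>\<^sub>0 'k::field) set \<Rightarrow> nat \<Rightarrow> int \<Rightarrow> nat" where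
  "graded_betti n I i j = count_list (resolution_degrees n I i) j"

(* reg(R/I) = max {j - i | beta_(i,j)(R/I) \<noteq> 0}. Only finitely many Betti numbers are nonzero, so
   the supremum is a maximum; in ereal it also gives the convention reg(0) = -\<infinity>. *)
definition reg_quotient ::
  "nat \<Rightarrow> ((nat \<Rightarrow>\<^sub>0 nat) \<Rightarrow>\<^sub>0 'k::field) set \<Rightarrow> ereal" where
  "reg_quotient n I =
     (SUP (i, j) \<in> {(i, j). graded_betti n I i j \<noteq> 0}. ereal (real_of_int (j - int i)))"


(* The k-algebra homomorphism k[x_1,...,x_n] \<rightarrow> k[t_1,t_2,t_3], x_i \<mapsto> t^(a i); the target has
   monomials t^v indexed by v :: nat^3. *)
definition toric_hom ::
  "(nat \<Rightarrow> nat^3) \<Rightarrow> ((nat \<Rightarrow>\<^sub>0 nat) \<Rightarrow>\<^sub>0 'k::field) \<Rightarrow> ((nat^3) \<Rightarrow>\<^sub>0 'k)" where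
  "toric_hom a p =
     (\<Sum>u\<in>Poly_Mapping.keys p. Poly_Mapping.single 0 (Poly_Mapping.lookup p u) *
        (\<Prod>i\<in>Poly_Mapping.keys u. Poly_Mapping.single (a i) 1 ^ Poly_Mapping.lookup u i))"

definition toric_ideal :: "nat \<Rightarrow> (nat \<Rightarrow> nat^3) \<Rightarrow> ((nat \<Rightarrow>\<^sub>0 nat) \<Rightarrow>\<^sub>0 'k::field) set" where
  "toric_ideal n a = {p \<in> polys n. toric_hom a p = 0}"


definition vsize :: "nat^3 \<Rightarrow> nat" where
  "vsize v = (\<Sum>i\<in>UNIV. v $ i)"

definition spanned_monoid :: "nat \<Rightarrow> (nat \<Rightarrow> nat^3) \<Rightarrow> (nat^3) set" where
  "spanned_monoid n a = {\<Sum>i=1..n. c i *s a i | c. True}"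

(* s - v \<in> S, with the difference taken in Z^3 (subtraction on nat^3 would truncate). *)
definition diff_mem :: "nat^3 \<Rightarrow> nat^3 \<Rightarrow> (nat^3) set \<Rightarrow> bool" where
  "diff_mem s v S \<longleftrightarrow> (\<exists>u\<in>S. s = u + v)"

(* The index type 3 has exactly the elements 1, 2, 3, with 3 = 0. *)
abbreviation evec :: "nat \<Rightarrow> 3 \<Rightarrow> nat^3" where
  "evec D i \<equiv> axis i D"

definition apery :: "nat \<Rightarrow> (nat^3) set \<Rightarrow> (nat^3) set" where
  "apery D S = {s \<in> S. \<forall>i. \<not> diff_mem s (evec D i) S}"

definition exc31 :: "nat \<Rightarrow> (nat^3) set \<Rightarrow> (nat^3) set" where
  "exc31 D S = {s \<in> S. (\<forall>j. diff_mem s (evec D j) S) \<and>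
     (\<exists>i1 i2 i3. distinct [i1, i2, i3] \<and>
        diff_mem s (evec D i1 + evec D i2) S \<and>
        \<not> diff_mem s (evec D i1 + evec D i3) S \<and>
        \<not> diff_mem s (evec D i2 + evec D i3) S)}"

definition exc20 :: "nat \<Rightarrow> (nat^3) set \<Rightarrow> (nat^3) set" where
  "exc20 D S = {s \<in> S. \<exists>i1 i2 i3. distinct [i1, i2, i3] \<and>
     diff_mem s (evec D i1) S \<and> diff_mem s (evec D i2) S \<and>
     \<not> diff_mem s (evec D i3) S \<and> \<not> diff_mem s (evec D i1 + evec D i2) S}"

definition exc30 :: "nat \<Rightarrow> (nat^3) set \<Rightarrow> (nat^3) set" where
  "exc30 D S = {s \<in> S. (\<forall>i. diff_mem s (evec D i) S) \<and>
     (\<forall>i j. i \<noteq> j \<longrightarrow> \<not> diff_mem s (evec D i + evec D j) S)}"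

definition exc33 :: "nat \<Rightarrow> (nat^3) set \<Rightarrow> (nat^3) set" where
  "exc33 D S = {s \<in> S. (\<forall>i. diff_mem s (evec D i) S) \<and>
     (\<forall>i j. i \<noteq> j \<longrightarrow> diff_mem s (evec D i + evec D j) S) \<and>
     \<not> diff_mem s (evec D 1 + evec D 2 + evec D 3) S}"

definition level :: "nat \<Rightarrow> nat \<Rightarrow> (nat^3) set" where
  "level D s = {v. vsize v = s * D}"

definition max_level :: "nat \<Rightarrow> (nat^3) set \<Rightarrow> ereal" where
  "max_level D F =
     (if F = {} then -\<infinity> else ereal (real (Max {s. F \<inter> level D s \<noteq> {}})))"

end

theory Submission
  imports Defs "HOL-Library.Function_Algebras"
begin

text \<open>The regularity is read off from Koszul homology. For a minimal resolution of the coordinate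
  ring \<open>k[S]\<close>, dimension shifting along the syzygies identifies the degrees of the \<open>i\<close>-th free module
  with the internal degrees in which the \<open>i\<close>-th Koszul homology of \<open>k[S]\<close> over \<open>x\<^sub>1, \<dots>, x\<^sub>n\<close> does not
  vanish. The long exact sequence of a mapping cone shows that the largest value of (internal degree) -
  (homological degree) with nonzero homology does not change when operators are added, so it may be
  computed with the last three variables only, which act on \<open>k[S]\<close> as translations by
  \<open>e\<^sub>1, e\<^sub>2, e\<^sub>3\<close>. That homology splits according to the elements \<open>s\<close> of \<open>S\<close> into the reduced homology of
  the simplicial complexes of all subsets of \<open>{1, 2, 3}\<close> whose sum of \<open>e\<^sub>i\<close> can be subtracted from \<open>s\<close>;
  such a complex has homology exactly when \<open>s\<close> is in the Apery set or in an exceptional set.\<close>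

section \<open>Koszul complexes of commuting operators\<close>

text \<open>The regularity is read from a chosen minimal resolution, so two facts are needed: a
  minimal resolution exists, and every minimal resolution has its degrees determined by k[S]. Both
  rest on one finiteness statement. D copies of any generator are a combination of the
  \<open>axis i D\<close>, so modulo D times vectors of N^3 every element of S has bounded size.
  Hence an s with a large coordinate has a cone (or nothing) as its complex, and finitely many s
  carry homology. This bound starts the descending induction that compares all n operators with the
  last three. It also makes every syzygy module in the construction of the resolution finitely
  generated, as its generator degrees are read off the Koszul homology of k[S]. Chains are indexed
  by t = internal degree - homological degree, so that the regularity is the largest t without
  exactness. The homology of complexes on three vertices does not depend on the field, which is why
  one finite set of values of t serves all k.\<close>

abbreviation (input) lookup :: "('a \<Rightarrow>\<^sub>0 'b) \<Rightarrow> 'a \<Rightarrow> 'b::zero" where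
  "lookup \<equiv> Poly_Mapping.lookup"

abbreviation (input) single :: "'a \<Rightarrow> 'b \<Rightarrow> 'a \<Rightarrow>\<^sub>0 'b::zero" where
  "single \<equiv> Poly_Mapping.single"

abbreviation (input) keys :: "('a \<Rightarrow>\<^sub>0 'b::zero) \<Rightarrow> 'a set" where
  "keys \<equiv> Poly_Mapping.keys"

type_synonym 'k mpoly = "(nat \<Rightarrow>\<^sub>0 nat) \<Rightarrow>\<^sub>0 'k"

definition trues :: "bool list \<Rightarrow> nat" where
  "trues w = length (filter id w)"

lemma trues_simps [simp]:
  "trues [] = 0" "trues (True # w) = Suc (trues w)" "trues (False # w) = trues w"
  by (auto simp: trues_def)

lemma trues_le_length: "trues w \<le> length w"
  by (simp add: trues_def)

text \<open>A chain of the Koszul complex of the operators \<^term>\<open>Xs\<close> is a function on bool lists of the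
  length of \<^term>\<open>Xs\<close>, a list standing for the set of its positions that carry \<^term>\<open>True\<close>. The
  complex is built as an iterated mapping cone.\<close>

fun kdiff :: "('b \<Rightarrow> 'b) list \<Rightarrow> (bool list \<Rightarrow> 'b) \<Rightarrow> bool list \<Rightarrow> 'b::ab_group_add" where
  "kdiff (X # Xs) c (True # w) = - kdiff Xs (\<lambda>u. c (True # u)) w"
| "kdiff (X # Xs) c (False # w) = kdiff Xs (\<lambda>u. c (False # u)) w + X (c (True # w))"
| "kdiff _ c _ = 0"

text \<open>Each operator raises the degree by one, so a value in \<open>N t\<close> on a list with
  \<open>i\<close> occurrences of \<open>True\<close> has internal degree \<open>t + i\<close>.
  Requiring zero everywhere else makes equality of chains the equality of functions.\<close>

definition kspace :: "nat \<Rightarrow> (int \<Rightarrow> 'b::zero set) \<Rightarrow> nat \<Rightarrow> int \<Rightarrow> (bool list \<Rightarrow> 'b) set" where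
  "kspace m N i t = {c. \<forall>w. if length w = m \<and> trues w = i then c w \<in> N t else c w = 0}"

text \<open>Vanishing of the Koszul homology in homological degree \<^term>\<open>i\<close> and internal degree
  \<^term>\<open>t + int i\<close>; the index \<^term>\<open>t\<close> is the one that enters the regularity.\<close>

definition kexact :: "('b \<Rightarrow> 'b) list \<Rightarrow> (int \<Rightarrow> 'b::ab_group_add set) \<Rightarrow> nat \<Rightarrow> int \<Rightarrow> bool" where
  "kexact Xs N i t \<longleftrightarrow> (\<forall>c\<in>kspace (length Xs) N i t. kdiff Xs c = 0 \<longrightarrow>
     (\<exists>b\<in>kspace (length Xs) N (Suc i) (t - 1). kdiff Xs b = c))"

definition commuting_ops :: "('b \<Rightarrow> 'b::ab_group_add) list \<Rightarrow> bool" where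
  "commuting_ops Xs \<longleftrightarrow> (\<forall>X\<in>set Xs. Modules.additive X) \<and> (\<forall>X\<in>set Xs. \<forall>Y\<in>set Xs. \<forall>v. X (Y v) = Y (X v))"

definition graded_submodule :: "('b \<Rightarrow> 'b) list \<Rightarrow> (int \<Rightarrow> 'b::ab_group_add set) \<Rightarrow> bool" where
  "graded_submodule Xs N \<longleftrightarrow> (\<forall>t. 0 \<in> N t \<and> (\<forall>x\<in>N t. \<forall>y\<in>N t. x - y \<in> N t) \<and>
     (\<forall>X\<in>set Xs. \<forall>x\<in>N t. X x \<in> N (t + 1)))"

lemma graded_submoduleD:
  assumes "graded_submodule Xs N"
  shows "0 \<in> N t" "x \<in> N t \<Longrightarrow> y \<in> N t \<Longrightarrow> x - y \<in> N t"
    "x \<in> N t \<Longrightarrow> - x \<in> N t" "x \<in> N t \<Longrightarrow> y \<in> N t \<Longrightarrow> x + y \<in> N t"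
    "X \<in> set Xs \<Longrightarrow> x \<in> N t \<Longrightarrow> X x \<in> N (t + 1)"
proof -
  have z: "0 \<in> N t" and d: "\<And>x y. x \<in> N t \<Longrightarrow> y \<in> N t \<Longrightarrow> x - y \<in> N t"
    using assms by (auto simp: graded_submodule_def)
  show "0 \<in> N t" "x \<in> N t \<Longrightarrow> y \<in> N t \<Longrightarrow> x - y \<in> N t" by (fact z) (fact d)
  show m: "x \<in> N t \<Longrightarrow> - x \<in> N t" for x using d[OF z, of x] by simp
  show "x \<in> N t \<Longrightarrow> y \<in> N t \<Longrightarrow> x + y \<in> N t" using d[of x "- y"] m[of y] by simp
  show "X \<in> set Xs \<Longrightarrow> x \<in> N t \<Longrightarrow> X x \<in> N (t + 1)"
    using assms by (auto simp: graded_submodule_def)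
qed

lemma graded_submodule_sum:
  assumes "graded_submodule Xs N" "\<And>x. x \<in> A \<Longrightarrow> f x \<in> N t"
  shows "sum f A \<in> N t"
  using assms(2)
  by (induction A rule: infinite_finite_induct) (auto intro: graded_submoduleD[OF assms(1)])

lemma graded_submodule_ConsD: "graded_submodule (X # Xs) N \<Longrightarrow> graded_submodule Xs N"
  by (auto simp: graded_submodule_def)

lemma commuting_ops_ConsD:
  assumes "commuting_ops (X # Xs)"
  shows "commuting_ops Xs" "Modules.additive X" "\<And>Y v. Y \<in> set Xs \<Longrightarrow> X (Y v) = Y (X v)"
  using assms by (auto simp: commuting_ops_def)

lemma kdiff_Nil_right [simp]: "kdiff Xs c [] = 0"
  by (cases Xs) auto

lemma kdiff_Nil [simp]: "kdiff [] c = 0"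
  by (auto simp: fun_eq_iff)

declare kdiff.simps(3,4) [simp del]

text \<open>Naturality: the differential is made of sums, signs and the operators. The map
  \<open>f\<close> will be an operator, a cover of modules, a coordinate projection or inclusion, a
  monomial shift, or a coefficient.\<close>

lemma kdiff_hom:
  assumes "Modules.additive f" "list_all2 (\<lambda>X Y. \<forall>v. f (X v) = Y (f v)) Xs Ys"
  shows "kdiff Ys (\<lambda>w. f (c w)) w = f (kdiff Xs c w)"
  using assms(2)
proof (induction Xs Ys arbitrary: c w rule: list_all2_induct)
  case Nil
  then show ?case by (simp add: Modules.additive.zero[OF assms(1)])
next
  case (Cons X Xs Y Ys)
  show ?case
  proof (cases w)
    case Nil
    then show ?thesis by (simp add: Modules.additive.zero[OF assms(1)])
  next
    case (Cons b u)
    then show ?thesis using Cons.IH Cons.hyps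
      by (cases b) (auto simp: Modules.additive.minus[OF assms(1)] Modules.additive.add[OF assms(1)])
  qed
qed

lemma additive_kdiff:
  assumes "\<And>X. X \<in> set Xs \<Longrightarrow> Modules.additive X"
  shows "Modules.additive (kdiff Xs)"
proof
  fix c d :: "bool list \<Rightarrow> 'a"
  have "kdiff Xs (\<lambda>w. c w + d w) w = kdiff Xs c w + kdiff Xs d w" for w
    using assms
  proof (induction Xs arbitrary: c d w)
    case Nil
    then show ?case by simp
  next
    case (Cons X Xs)
    show ?case
    proof (cases w)
      case (Cons b u)
      then show ?thesis using Cons.IH Cons.prems
        by (cases b) (auto simp: Modules.additive.add)
    qed simp
  qed
  then show "kdiff Xs (c + d) = kdiff Xs c + kdiff Xs d"
    by (simp add: fun_eq_iff plus_fun_def)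
qed

lemma kdiff_zero:
  assumes "\<And>X. X \<in> set Xs \<Longrightarrow> Modules.additive X"
  shows "kdiff Xs 0 = 0"
  using Modules.additive.zero[OF additive_kdiff[OF assms]] .

lemma commuting_ops_additive_kdiff: "commuting_ops Xs \<Longrightarrow> Modules.additive (kdiff Xs)"
  by (rule additive_kdiff) (auto simp: commuting_ops_def)

lemma kdiff_op:
  assumes "Modules.additive X" "\<And>Y v. Y \<in> set Xs \<Longrightarrow> X (Y v) = Y (X v)"
  shows "kdiff Xs (X \<circ> c) = X \<circ> kdiff Xs c"
proof
  fix w
  show "kdiff Xs (X \<circ> c) w = (X \<circ> kdiff Xs c) w"
    using kdiff_hom[of X Xs Xs c w] assms by (simp add: list_all2_same o_def)
qed

section \<open>Chains on a mapping cone\<close>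

fun kcons :: "(bool list \<Rightarrow> 'b) \<Rightarrow> (bool list \<Rightarrow> 'b) \<Rightarrow> bool list \<Rightarrow> 'b::zero" where
  "kcons c0 c1 [] = 0"
| "kcons c0 c1 (False # w) = c0 w"
| "kcons c0 c1 (True # w) = c1 w"

lemma kcons_eq_iff [simp]: "kcons a b = kcons a' b' \<longleftrightarrow> a = a' \<and> b = b'"
proof
  assume *: "kcons a b = kcons a' b'"
  show "a = a' \<and> b = b'"
    using fun_cong[OF *, of "False # _"] fun_cong[OF *, of "True # _"] by auto
qed auto

lemma kcons_zero: "kcons 0 0 = 0"
proof
  fix w :: "bool list"
  show "kcons 0 0 w = (0 :: bool list \<Rightarrow> 'a) w"
  proof (cases w)
    case (Cons b u) then show ?thesis by (cases b) auto
  qed simp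
qed

lemma kcons_eq_zero_iff [simp]: "kcons a b = 0 \<longleftrightarrow> a = 0 \<and> b = 0"
  using kcons_eq_iff[of a b 0 0] by (simp only: kcons_zero)

text \<open>In the mapping cone of \<open>X\<close>, the lists that omit \<open>X\<close> form a
  subcomplex carrying \<open>c0\<close>; the others carry \<open>c1\<close>, which is shifted by one
  homological degree and therefore gets the sign.\<close>

lemma kdiff_kcons: "kdiff (X # Xs) (kcons c0 c1) = kcons (kdiff Xs c0 + (X \<circ> c1)) (- kdiff Xs c1)"
proof
  fix w
  show "kdiff (X # Xs) (kcons c0 c1) w = kcons (kdiff Xs c0 + (X \<circ> c1)) (- kdiff Xs c1) w"
  proof (cases w)
    case (Cons b u) then show ?thesis by (cases b) auto
  qed simp
qed

text \<open>The mixed term, \<open>X\<close> applied to \<open>kdiff Xs c1\<close>, arises once by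
  commuting \<open>X\<close> with the differential and once with the sign of the second component,
  and the two cancel.\<close>

lemma kdiff_kdiff:
  assumes "commuting_ops Xs"
  shows "kdiff Xs (kdiff Xs c) = 0"
  using assms
proof (induction Xs arbitrary: c)
  case Nil
  then show ?case by simp
next
  case (Cons X Xs)
  note ops = commuting_ops_ConsD[OF Cons.prems]
  have IH: "kdiff Xs (kdiff Xs e) = 0" for e by (rule Cons.IH[OF ops(1)])
  note add = commuting_ops_additive_kdiff[OF ops(1)]
  define c0 where "c0 = (\<lambda>u. c (False # u))"
  define c1 where "c1 = (\<lambda>u. c (True # u))"
  have "kdiff (X # Xs) c = kdiff (X # Xs) (kcons c0 c1)"
  proof
    fix w
    show "kdiff (X # Xs) c w = kdiff (X # Xs) (kcons c0 c1) w"
    proof (cases w)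
      case (Cons b u) then show ?thesis by (cases b) (auto simp: c0_def c1_def)
    qed simp
  qed
  moreover have "X \<circ> (- kdiff Xs c1) = - (X \<circ> kdiff Xs c1)"
    by (auto simp: fun_eq_iff Modules.additive.minus[OF ops(2)])
  ultimately have "kdiff (X # Xs) (kdiff (X # Xs) c) = kcons 0 0"
    by (simp add: kdiff_kcons Modules.additive.add[OF add] Modules.additive.minus[OF add] IH
        kdiff_op[OF ops(2,3)] del: kcons_eq_zero_iff)
  then show ?case by (simp only: kcons_zero)
qed

lemma kspace_Suc_0: "c \<in> kspace (Suc m) N 0 t \<longleftrightarrow> (\<exists>c0\<in>kspace m N 0 t. c = kcons c0 0)"
proof
  assume c: "c \<in> kspace (Suc m) N 0 t"
  define c0 where "c0 = (\<lambda>u. c (False # u))"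
  have "c0 u \<in> N t" if "length u = m" "trues u = 0" for u
    using c that unfolding kspace_def c0_def by (auto dest!: spec[of _ "False # u"])
  moreover have "c0 u = 0" if "\<not> (length u = m \<and> trues u = 0)" for u
    using c that unfolding kspace_def c0_def by (auto dest!: spec[of _ "False # u"])
  ultimately have "c0 \<in> kspace m N 0 t" by (auto simp: kspace_def)
  moreover have "c w = kcons c0 0 w" for w
  proof (cases w)
    case Nil then show ?thesis using c by (auto simp: kspace_def)
  next
    case (Cons b u) then show ?thesis
      using c unfolding kspace_def by (cases b) (auto dest!: spec[of _ "True # u"] simp: c0_def)
  qed
  ultimately show "\<exists>c0\<in>kspace m N 0 t. c = kcons c0 0" by (auto simp: fun_eq_iff)
next
  assume "\<exists>c0\<in>kspace m N 0 t. c = kcons c0 0"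
  then obtain c0 where c0: "c0\<in>kspace m N 0 t" "c = kcons c0 0" by auto
  have "if length w = Suc m \<and> trues w = 0 then c w \<in> N t else c w = 0" for w
  proof (cases w)
    case Nil then show ?thesis by (simp add: c0)
  next
    case (Cons b u) then show ?thesis
      using c0 unfolding kspace_def by (cases b) auto
  qed
  then show "c \<in> kspace (Suc m) N 0 t" by (simp add: kspace_def)
qed

lemma kspace_Suc_Suc:
  "c \<in> kspace (Suc m) N (Suc i) t \<longleftrightarrow>
     (\<exists>c0\<in>kspace m N (Suc i) t. \<exists>c1\<in>kspace m N i t. c = kcons c0 c1)"
proof
  assume c: "c \<in> kspace (Suc m) N (Suc i) t"
  define c0 where "c0 = (\<lambda>u. c (False # u))"
  define c1 where "c1 = (\<lambda>u. c (True # u))"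
  have "if length u = m \<and> trues u = Suc i then c0 u \<in> N t else c0 u = 0" for u
    using c unfolding kspace_def c0_def by (auto dest!: spec[of _ "False # u"])
  then have "c0 \<in> kspace m N (Suc i) t" by (simp add: kspace_def)
  moreover have "if length u = m \<and> trues u = i then c1 u \<in> N t else c1 u = 0" for u
    using c unfolding kspace_def c1_def by (auto dest!: spec[of _ "True # u"])
  then have "c1 \<in> kspace m N i t" by (simp add: kspace_def)
  moreover have "c w = kcons c0 c1 w" for w
  proof (cases w)
    case Nil then show ?thesis using c by (auto simp: kspace_def)
  next
    case (Cons b u) then show ?thesis by (cases b) (auto simp: c0_def c1_def)
  qed
  ultimately show "\<exists>c0\<in>kspace m N (Suc i) t. \<exists>c1\<in>kspace m N i t. c = kcons c0 c1"
    by (auto simp: fun_eq_iff)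
next
  assume "\<exists>c0\<in>kspace m N (Suc i) t. \<exists>c1\<in>kspace m N i t. c = kcons c0 c1"
  then obtain c0 c1 where c0: "c0\<in>kspace m N (Suc i) t" "c1\<in>kspace m N i t" "c = kcons c0 c1" by auto
  have "if length w = Suc m \<and> trues w = Suc i then c w \<in> N t else c w = 0" for w
  proof (cases w)
    case Nil then show ?thesis by (simp add: c0)
  next
    case (Cons b u) then show ?thesis
      using c0 unfolding kspace_def by (cases b) auto
  qed
  then show "c \<in> kspace (Suc m) N (Suc i) t" by (simp add: kspace_def)
qed

lemma kspace_group:
  assumes "graded_submodule Xs N"
  shows "0 \<in> kspace m N i t" "c \<in> kspace m N i t \<Longrightarrow> d \<in> kspace m N i t \<Longrightarrow> c + d \<in> kspace m N i t"
    "c \<in> kspace m N i t \<Longrightarrow> d \<in> kspace m N i t \<Longrightarrow> c - d \<in> kspace m N i t"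
    "c \<in> kspace m N i t \<Longrightarrow> - c \<in> kspace m N i t"
  using graded_submoduleD[OF assms] by (auto simp: kspace_def)

lemma kspace_op:
  assumes "c \<in> kspace m N i t" "Modules.additive X" "\<And>x. x \<in> N t \<Longrightarrow> X x \<in> N (t + 1)"
  shows "X \<circ> c \<in> kspace m N i (t + 1)"
  using assms Modules.additive.zero[OF assms(2)] by (auto simp: kspace_def)

text \<open>The internal degree \<open>t + i\<close> of a chain is preserved; as the homological
  degree drops by one, \<open>t\<close> grows by one.\<close>

lemma kdiff_kspace:
  assumes "commuting_ops Xs" "graded_submodule Xs N" "c \<in> kspace (length Xs) N (Suc i) t"
  shows "kdiff Xs c \<in> kspace (length Xs) N i (t + 1)"
  using assms
proof (induction Xs arbitrary: i c)
  case Nil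
  show ?case unfolding kdiff_Nil by (rule kspace_group(1)[OF Nil(2)])
next
  case (Cons X Xs)
  note ops = commuting_ops_ConsD[OF Cons.prems(1)]
  note sub = graded_submodule_ConsD[OF Cons.prems(2)]
  note IH = Cons.IH[OF ops(1) sub]
  have X: "\<And>x. x \<in> N t \<Longrightarrow> X x \<in> N (t + 1)"
    using graded_submoduleD(5)[OF Cons.prems(2)] by simp
  obtain c0 c1 where c: "c0 \<in> kspace (length Xs) N (Suc i) t" "c1 \<in> kspace (length Xs) N i t"
    "c = kcons c0 c1"
    using Cons.prems(3) by (auto simp: kspace_Suc_Suc)
  have 0: "kdiff Xs c0 + (X \<circ> c1) \<in> kspace (length Xs) N i (t + 1)"
    by (rule kspace_group(2)[OF sub IH[OF c(1)] kspace_op[OF c(2) ops(2) X]])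
  show ?case
  proof (cases i)
    case 0
    \<comment> \<open>For \<open>i = 0\<close> the chain \<open>c1\<close> has homological degree 0
      and there is no lower degree to map to.\<close>
    have "kdiff Xs c1 = 0"
    proof -
      have "kdiff Xs c = 0" if "c \<in> kspace (length Xs) N 0 t" "\<And>X. X \<in> set Xs \<Longrightarrow> Modules.additive X" for c
        using that
      proof (induction Xs arbitrary: c)
        case (Cons Y Ys)
        then obtain e where e: "e \<in> kspace (length Ys) N 0 t" "c = kcons e 0"
          by (auto simp: kspace_Suc_0)
        have "Y \<circ> (0 :: bool list \<Rightarrow> 'a) = 0" using Modules.additive.zero[of Y] Cons.prems(2) by (auto simp: fun_eq_iff)
        moreover have "kdiff Ys e = 0" using Cons.IH[OF e(1)] Cons.prems(2) by auto
        moreover have "kdiff Ys (0 :: bool list \<Rightarrow> 'a) = 0" using Cons.prems(2) kdiff_zero[of Ys] by auto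
        ultimately show ?case by (simp only: e kdiff_kcons kcons_zero add_0_right minus_zero)
      qed simp
      from this[of c1] show ?thesis using c(2) ops(1) 0 by (auto simp: commuting_ops_def)
    qed
    then show ?thesis using c 0 \<open>kdiff Xs c0 + (X \<circ> c1) \<in> _\<close>
      by (auto simp: kspace_Suc_0 kdiff_kcons)
  next
    case (Suc i')
    have "- kdiff Xs c1 \<in> kspace (length Xs) N i' (t + 1)"
      using kspace_group(4)[OF sub IH[of c1 i']] c(2) Suc by simp
    then show ?thesis using 0 c Suc by (auto simp: kspace_Suc_Suc kdiff_kcons)
  qed
qed

text \<open>In the exact sequence of the cone, the homology of \<open>X # Xs\<close> in degree
  \<open>i\<close> lies between that of \<open>Xs\<close> in degrees \<open>i\<close> and
  \<open>i - 1\<close>, all with the same \<open>t\<close>. Concretely, filling \<open>c1\<close> by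
  \<open>b1\<close> makes \<open>c0 + (X \<circ> b1)\<close> a cycle of \<open>Xs\<close>; a filling
  \<open>b0\<close> of it gives \<open>kcons b0 (- b1)\<close>.\<close>

lemma kexact_Cons:
  assumes "commuting_ops (X # Xs)" "graded_submodule (X # Xs) N"
    and "\<And>i. kexact Xs N i t"
  shows "kexact (X # Xs) N i t"
  unfolding kexact_def
proof (intro ballI impI)
  note ops = commuting_ops_ConsD[OF assms(1)]
  note sub = graded_submodule_ConsD[OF assms(2)]
  note add = commuting_ops_additive_kdiff[OF ops(1)]
  fix c assume c: "c \<in> kspace (length (X # Xs)) N i t" and dc: "kdiff (X # Xs) c = 0"
  show "\<exists>b\<in>kspace (length (X # Xs)) N (Suc i) (t - 1). kdiff (X # Xs) b = c"
  proof (cases i)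
    case 0
    then obtain c0 where c0: "c0 \<in> kspace (length Xs) N 0 t" "c = kcons c0 0"
      using c by (auto simp: kspace_Suc_0)
    have X0: "X \<circ> (0 :: bool list \<Rightarrow> 'a) = 0" using Modules.additive.zero[OF ops(2)] by (auto simp: fun_eq_iff)
    have "kdiff Xs c0 = 0" using dc c0 X0 by (simp add: kdiff_kcons)
    then obtain b where b: "b \<in> kspace (length Xs) N (Suc 0) (t - 1)" "kdiff Xs b = c0"
      using assms(3) c0 by (auto simp: kexact_def)
    have "kdiff (X # Xs) (kcons b 0) = c"
      using b c0 X0 Modules.additive.zero[OF add] by (simp add: kdiff_kcons)
    moreover have "kcons b 0 \<in> kspace (length (X # Xs)) N (Suc i) (t - 1)"
      using b kspace_group(1)[OF sub] 0 by (auto simp: kspace_Suc_Suc)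
    ultimately show ?thesis by blast
  next
    case (Suc i')
    then obtain c0 c1 where c01: "c0 \<in> kspace (length Xs) N i t"
      "c1 \<in> kspace (length Xs) N i' t" "c = kcons c0 c1"
      using c by (auto simp: kspace_Suc_Suc)
    have d: "kdiff Xs c0 + (X \<circ> c1) = 0" "kdiff Xs c1 = 0"
      using dc c01 by (simp_all add: kdiff_kcons)
    then obtain b1 where b1: "b1 \<in> kspace (length Xs) N i (t - 1)" "kdiff Xs b1 = c1"
      using assms(3) c01 Suc by (auto simp: kexact_def)
    have Xb: "X \<circ> b1 \<in> kspace (length Xs) N i t"
      using kspace_op[OF b1(1) ops(2)] graded_submoduleD(5)[OF assms(2), of X _ "t - 1"] by simp
    have "c0 + (X \<circ> b1) \<in> kspace (length Xs) N i t"
      by (rule kspace_group(2)[OF sub c01(1) Xb])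
    moreover have "kdiff Xs (c0 + (X \<circ> b1)) = 0"
      using d(1) by (simp add: Modules.additive.add[OF add] kdiff_op[OF ops(2,3)] b1)
    ultimately obtain b0 where b0: "b0 \<in> kspace (length Xs) N (Suc i) (t - 1)"
      "kdiff Xs b0 = c0 + (X \<circ> b1)"
      using assms(3)[of i] by (auto simp: kexact_def)
    have "X \<circ> (- b1) = - (X \<circ> b1)" by (auto simp: fun_eq_iff Modules.additive.minus[OF ops(2)])
    then have "kdiff (X # Xs) (kcons b0 (- b1)) = c"
      using b0 b1 c01 by (simp add: kdiff_kcons Modules.additive.minus[OF add])
    moreover have "kcons b0 (- b1) \<in> kspace (length (X # Xs)) N (Suc i) (t - 1)"
      using b0 kspace_group(4)[OF sub b1(1)] by (auto simp: kspace_Suc_Suc)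
    ultimately show ?thesis by blast
  qed
qed

text \<open>Multiplication by \<open>X\<close> sends a cycle \<open>z\<close> to the next value of
  \<open>t\<close>, where it is the boundary of some \<open>y\<close>. Then
  \<open>kcons (- y) z\<close> is a cycle of the cone, one homological degree higher but with the
  same \<open>t\<close>, and the second component of a filling fills \<open>z\<close> up to
  sign.\<close>

lemma kexact_ConsD:
  assumes "commuting_ops (X # Xs)" "graded_submodule (X # Xs) N"
    and "\<And>i. kexact Xs N i (t + 1)" "\<And>i. kexact (X # Xs) N i t"
  shows "kexact Xs N i t"
  unfolding kexact_def
proof (intro ballI impI)
  note ops = commuting_ops_ConsD[OF assms(1)]
  note sub = graded_submodule_ConsD[OF assms(2)]
  note add = commuting_ops_additive_kdiff[OF ops(1)]
  fix z assume z: "z \<in> kspace (length Xs) N i t" and dz: "kdiff Xs z = 0"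
  have "X \<circ> z \<in> kspace (length Xs) N i (t + 1)"
    using kspace_op[OF z ops(2)] graded_submoduleD(5)[OF assms(2), of X _ t] by simp
  moreover have "kdiff Xs (X \<circ> z) = 0"
    using dz Modules.additive.zero[OF ops(2)] by (auto simp: kdiff_op[OF ops(2,3)] fun_eq_iff)
  ultimately obtain y where y: "y \<in> kspace (length Xs) N (Suc i) t" "kdiff Xs y = X \<circ> z"
    using assms(3)[of i] by (auto simp: kexact_def)
  have "kcons (- y) z \<in> kspace (length (X # Xs)) N (Suc i) t"
    using z kspace_group(4)[OF sub y(1)] by (auto simp: kspace_Suc_Suc)
  moreover have "kdiff (X # Xs) (kcons (- y) z) = 0"
    using y dz by (simp add: kdiff_kcons Modules.additive.minus[OF add])
  ultimately obtain b where "b \<in> kspace (length (X # Xs)) N (Suc (Suc i)) (t - 1)"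
    "kdiff (X # Xs) b = kcons (- y) z"
    using assms(4)[of "Suc i"] by (auto simp: kexact_def)
  then obtain b0 b1 where b: "b1 \<in> kspace (length Xs) N (Suc i) (t - 1)"
    "kdiff (X # Xs) (kcons b0 b1) = kcons (- y) z"
    by (auto simp: kspace_Suc_Suc)
  then have "- kdiff Xs b1 = z" by (simp add: kdiff_kcons)
  then have "kdiff Xs (- b1) = z" by (simp add: Modules.additive.minus[OF add])
  then show "\<exists>b\<in>kspace (length Xs) N (Suc i) (t - 1). kdiff Xs b = z"
    using kspace_group(4)[OF sub b(1)] by blast
qed

text \<open>Adding operators does not change the regularity once it is bounded above: in the exact
  sequence of the mapping cone, the connecting map raises \<^term>\<open>t\<close> by one.\<close>

lemma kexact_append_iff:
  assumes "commuting_ops (Ys @ Xs)" "graded_submodule (Ys @ Xs) N"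
    and "\<And>t i. t > T0 \<Longrightarrow> kexact Xs N i t"
  shows "(\<forall>t>T. \<forall>i. kexact (Ys @ Xs) N i t) \<longleftrightarrow> (\<forall>t>T. \<forall>i. kexact Xs N i t)"
  using assms(1,2)
proof (induction Ys arbitrary: T)
  case Nil
  then show ?case by simp
next
  case (Cons Y Ys)
  have ops: "commuting_ops (Y # (Ys @ Xs))" and sub: "graded_submodule (Y # (Ys @ Xs)) N"
    using Cons.prems by simp_all
  note IH = Cons.IH[OF commuting_ops_ConsD(1)[OF ops] graded_submodule_ConsD[OF sub]]
  have "kexact (Ys @ Xs) N i t" if "\<forall>t>T. \<forall>i. kexact (Y # (Ys @ Xs)) N i t" "t > T" for i t
  proof -
    \<comment> \<open>Descending induction on \<open>t\<close>, with \<open>k\<close> measuring the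
      depth below \<open>T0\<close>: \<open>kexact_ConsD\<close> asks for exactness at
      \<open>t + 1\<close>, and the bound \<open>T0\<close> provides the start.\<close>
    have "t > T0 - int k \<Longrightarrow> t > T \<Longrightarrow> \<forall>i. kexact (Ys @ Xs) N i t" for k t
    proof (induction k arbitrary: t)
      case 0
      then show ?case using IH[of T0] assms(3) by auto
    next
      case (Suc k)
      then show ?case using kexact_ConsD[OF ops sub, of t] that(1) by simp
    qed
    from this[of "nat (T0 - t) + 1" t] that(2) show ?thesis by auto
  qed
  moreover have "kexact (Y # (Ys @ Xs)) N i t"
    if "\<forall>t>T. \<forall>i. kexact (Ys @ Xs) N i t" "t > T" for i t
    using kexact_Cons[OF ops sub] that by blast
  ultimately show ?case using IH[of T] by auto
qed

text \<open>No list has more entries \<open>True\<close> than its length, so such chains are zero.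
  For the \<open>n\<close> variables this ends the resolution after step \<open>n\<close>.\<close>

lemma kexact_gt_length:
  assumes "i > length Xs" "graded_submodule Xs N" "commuting_ops Xs"
  shows "kexact Xs N i t"
  unfolding kexact_def
proof (intro ballI impI)
  fix c assume "c \<in> kspace (length Xs) N i t"
  moreover have "\<not> (length w = length Xs \<and> trues w = i)" for w
    using trues_le_length[of w] assms(1) by auto
  ultimately have "c = 0" by (auto simp: kspace_def fun_eq_iff)
  then show "\<exists>b\<in>kspace (length Xs) N (Suc i) (t - 1). kdiff Xs b = c"
    using kspace_group(1)[OF assms(2)] Modules.additive.zero[OF commuting_ops_additive_kdiff[OF assms(3)]]
    by blast
qed

section \<open>Dimension shifting\<close>

text \<open>For operators of degree one this is the part in degree \<open>s + 1\<close> of the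
  submodule of multiples of the operators, the product of the maximal ideal with \<open>N\<close>.
  The index is the degree of the arguments, one less than that of the values.\<close>

fun opspan :: "('b \<Rightarrow> 'b) list \<Rightarrow> (int \<Rightarrow> 'b::ab_group_add set) \<Rightarrow> int \<Rightarrow> 'b set" where
  "opspan [] N s = {0}"
| "opspan (X # Xs) N s = {X u + v | u v. u \<in> N s \<and> v \<in> opspan Xs N s}"

lemma opspan_zero:
  assumes "\<And>X. X \<in> set Xs \<Longrightarrow> Modules.additive X" "0 \<in> N s"
  shows "0 \<in> opspan Xs N s"
  using assms(1)
proof (induction Xs)
  case (Cons X Xs)
  have "X 0 + 0 = 0" using Modules.additive.zero[of X] Cons.prems by simp
  moreover have "0 \<in> opspan Xs N s" using Cons by simp
  ultimately show ?case using assms(2) by (auto intro!: exI[of _ 0])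
qed simp

lemma opspan_diff:
  assumes "\<And>X. X \<in> set Xs \<Longrightarrow> Modules.additive X" "\<And>x y. x \<in> N s \<Longrightarrow> y \<in> N s \<Longrightarrow> x - y \<in> N s"
    and "x \<in> opspan Xs N s" "y \<in> opspan Xs N s"
  shows "x - y \<in> opspan Xs N s"
  using assms(1,3,4)
proof (induction Xs arbitrary: x y)
  case (Cons X Xs)
  obtain u v where 1: "x = X u + v" "u \<in> N s" "v \<in> opspan Xs N s" using Cons.prems by auto
  obtain u' v' where 2: "y = X u' + v'" "u' \<in> N s" "v' \<in> opspan Xs N s" using Cons.prems by auto
  have "x - y = X (u - u') + (v - v')"
    using 1 2 Modules.additive.diff[of X u u'] Cons.prems(1) by simp
  moreover have "v - v' \<in> opspan Xs N s" using Cons.IH Cons.prems(1) 1 2 by simp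
  ultimately show ?case using assms(2)[OF 1(2) 2(2)] by auto
qed simp

lemma opspan_hom:
  assumes "Modules.additive f" "list_all2 (\<lambda>X Y. \<forall>v. f (X v) = Y (f v)) Xs Ys" "f ` F s \<subseteq> N s"
    "x \<in> opspan Xs F s"
  shows "f x \<in> opspan Ys N s"
  using assms(2,4)
proof (induction Xs Ys arbitrary: x rule: list_all2_induct)
  case Nil
  then show ?case by (simp add: Modules.additive.zero[OF assms(1)])
next
  case (Cons X Xs Y Ys)
  obtain u v where 1: "x = X u + v" "u \<in> F s" "v \<in> opspan Xs F s" using Cons.prems by auto
  then have "f x = Y (f u) + f v" using Cons.hyps(1) by (simp add: Modules.additive.add[OF assms(1)])
  then show ?case using Cons.IH[OF 1(3)] assms(3) 1(2) by auto
qed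

lemma opspan_hom_surj:
  assumes "Modules.additive f" "list_all2 (\<lambda>X Y. \<forall>v. f (X v) = Y (f v)) Xs Ys" "N s \<subseteq> f ` F s"
    "y \<in> opspan Ys N s"
  shows "\<exists>x\<in>opspan Xs F s. f x = y"
  using assms(2,4)
proof (induction Xs Ys arbitrary: y rule: list_all2_induct)
  case Nil
  then show ?case by (simp add: Modules.additive.zero[OF assms(1)])
next
  case (Cons X Xs Y Ys)
  obtain u v where 1: "y = Y u + v" "u \<in> N s" "v \<in> opspan Ys N s" using Cons.prems by auto
  obtain u' where u': "u' \<in> F s" "f u' = u" using 1(2) assms(3) by auto
  obtain v' where v': "v' \<in> opspan Xs F s" "f v' = v" using Cons.IH[OF 1(3)] by auto
  have "f (X u' + v') = y" using Cons.hyps(1) u' v' 1 by (simp add: Modules.additive.add[OF assms(1)])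
  then show ?case using u' v' by auto
qed

definition kzero :: "nat \<Rightarrow> 'b \<Rightarrow> bool list \<Rightarrow> 'b::zero" where
  "kzero m v = (\<lambda>w. if w = replicate m False then v else 0)"

lemma kzero_Suc: "kzero (Suc m) v = kcons (kzero m v) 0"
proof
  fix w show "kzero (Suc m) v w = kcons (kzero m v) 0 w"
  proof (cases w)
    case (Cons b u) then show ?thesis by (cases b) (auto simp: kzero_def)
  qed (auto simp: kzero_def)
qed

lemma trues_eq_0_iff: "length w = m \<and> trues w = 0 \<longleftrightarrow> w = replicate m False"
proof (induction w arbitrary: m)
  case (Cons b w)
  then show ?case by (cases b; cases m) auto
qed auto

lemma kspace_0: "kspace m N 0 t = kzero m ` N t"
proof (intro equalityI subsetI)
  fix c assume c: "c \<in> kspace m N 0 t"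
  have "c (replicate m False) \<in> N t"
    using c trues_eq_0_iff[of "replicate m False" m] unfolding kspace_def by auto
  moreover have "c = kzero m (c (replicate m False))"
    using c unfolding kspace_def trues_eq_0_iff by (auto simp: kzero_def)
  ultimately show "c \<in> kzero m ` N t" by blast
next
  fix c assume "c \<in> kzero m ` N t"
  then show "c \<in> kspace m N 0 t" unfolding kspace_def trues_eq_0_iff by (auto simp: kzero_def)
qed

lemma kzero_eq_iff [simp]: "kzero m v = kzero m w \<longleftrightarrow> v = w"
  by (auto simp: kzero_def dest!: fun_cong[of _ _ "replicate m False"])

lemma kdiff_kzero:
  assumes "\<And>X. X \<in> set Xs \<Longrightarrow> Modules.additive X"
  shows "kdiff Xs (kzero (length Xs) v) = 0"
  using assms
proof (induction Xs)
  case Nil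
  show ?case by (rule kdiff_Nil)
next
  case (Cons X Xs)
  have "X \<circ> (0 :: bool list \<Rightarrow> 'a) = 0"
    using Modules.additive.zero[of X] Cons.prems by (auto simp: fun_eq_iff)
  moreover have "kdiff Xs (0 :: bool list \<Rightarrow> 'a) = 0" using Cons.prems kdiff_zero[of Xs] by auto
  moreover have "kdiff Xs (kzero (length Xs) v) = 0" using Cons by auto
  ultimately show ?case
    by (simp only: kzero_Suc length_Cons kdiff_kcons kcons_zero add_0_right minus_zero)
qed

lemma bex_kspace_Suc_Suc:
  "(\<exists>b\<in>kspace (Suc m) N (Suc i) t. P b) \<longleftrightarrow>
     (\<exists>c0\<in>kspace m N (Suc i) t. \<exists>c1\<in>kspace m N i t. P (kcons c0 c1))"
  unfolding Bex_def kspace_Suc_Suc by blast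

text \<open>A chain of homological degree 1 assigns an element \<open>u\<close> to each operator,
  and its differential is the sum of the values \<open>X u\<close>.\<close>

lemma opspan_iff_kdiff:
  assumes "commuting_ops Xs"
  shows "v \<in> opspan Xs N s \<longleftrightarrow> (\<exists>b\<in>kspace (length Xs) N 1 s. kdiff Xs b = kzero (length Xs) v)"
  using assms
proof (induction Xs arbitrary: v)
  case Nil
  have 1: "kspace 0 N 1 s = {0}"
    by (auto simp: kspace_def fun_eq_iff)
  have "kzero 0 (0 :: 'a) = 0" by (auto simp: kzero_def fun_eq_iff)
  then have 2: "kzero 0 v = 0 \<longleftrightarrow> v = 0"
    using kzero_eq_iff[of 0 v 0] by (simp only:)
  have "kdiff [] 0 = kzero 0 v \<longleftrightarrow> v = 0"
    unfolding kdiff_Nil 2[symmetric] by (rule eq_commute)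
  then show ?case unfolding One_nat_def[symmetric] opspan.simps list.size 1 by blast
next
  case (Cons X Xs)
  note ops = commuting_ops_ConsD[OF Cons.prems]
  note add = commuting_ops_additive_kdiff[OF ops(1)]
  have Xz: "X \<circ> kzero (length Xs) u = kzero (length Xs) (X u)" for u
    using Modules.additive.zero[OF ops(2)] by (auto simp: kzero_def)
  have kz: "kdiff Xs (kzero (length Xs) u) = 0" for u
    using kdiff_kzero ops(1) by (auto simp: commuting_ops_def)
  have "kdiff (X # Xs) (kcons b0 (kzero (length Xs) u)) = kzero (length (X # Xs)) v \<longleftrightarrow>
      kdiff Xs b0 = kzero (length Xs) (v - X u)" for b0 u
  proof -
    have *: "kzero (length Xs) (v - X u) = kzero (length Xs) v - kzero (length Xs) (X u)"
      by (auto simp: kzero_def)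
    have "kdiff Xs b0 = kzero (length Xs) (v - X u) \<longleftrightarrow>
        kdiff Xs b0 + kzero (length Xs) (X u) = kzero (length Xs) v"
      unfolding * by (rule eq_diff_eq)
    then show ?thesis by (simp add: kdiff_kcons kz Xz kzero_Suc)
  qed
  then have "(\<exists>b\<in>kspace (length (X # Xs)) N 1 s. kdiff (X # Xs) b = kzero (length (X # Xs)) v) \<longleftrightarrow>
    (\<exists>u\<in>N s. \<exists>b\<in>kspace (length Xs) N 1 s. kdiff Xs b = kzero (length Xs) (v - X u))"
    unfolding One_nat_def length_Cons bex_kspace_Suc_Suc kspace_0 bex_simps by blast
  also have "\<dots> \<longleftrightarrow> (\<exists>u\<in>N s. v - X u \<in> opspan Xs N s)"
    using Cons.IH[OF ops(1)] by simp
  also have "\<dots> \<longleftrightarrow> v \<in> opspan (X # Xs) N s"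
  proof
    assume "\<exists>u\<in>N s. v - X u \<in> opspan Xs N s"
    then obtain u where "u \<in> N s" "v - X u \<in> opspan Xs N s" by blast
    moreover have "v = X u + (v - X u)" by simp
    ultimately show "v \<in> opspan (X # Xs) N s" unfolding opspan.simps by blast
  next
    assume "v \<in> opspan (X # Xs) N s"
    then obtain u v' where "v = X u + v'" "u \<in> N s" "v' \<in> opspan Xs N s" by auto
    then show "\<exists>u\<in>N s. v - X u \<in> opspan Xs N s" by (intro bexI[of _ u]) auto
  qed
  finally show ?case by simp
qed

text \<open>Every chain of homological degree 0 is a cycle, so the homology there is
  \<open>N\<close> modulo the multiples of the operators. Exactness fails in the degrees where
  minimal generators are required.\<close>

lemma kexact_0_iff:
  assumes "commuting_ops Xs"
  shows "kexact Xs N 0 t \<longleftrightarrow> N t \<subseteq> opspan Xs N (t - 1)"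
proof -
  have "kdiff Xs (kzero (length Xs) v) = 0" for v
    using kdiff_kzero assms by (auto simp: commuting_ops_def)
  then show ?thesis
    unfolding kexact_def kspace_0 using opspan_iff_kdiff[OF assms, of _ N "t - 1"] by auto
qed

text \<open>Degree by degree this is an exact sequence from \<open>syz\<close> through
  \<open>F\<close> onto \<open>N\<close>. In the uses \<open>F\<close> is free and
  \<open>syz\<close> lies in the multiples of the variables, so that Koszul homology of
  \<open>N\<close> in degree \<open>i + 1\<close> becomes that of \<open>syz\<close> in degree
  \<open>i\<close>.\<close>

locale graded_cover =
  fixes f :: "'b::ab_group_add \<Rightarrow> 'c::ab_group_add"
    and Xs :: "('b \<Rightarrow> 'b) list" and Ys :: "('c \<Rightarrow> 'c) list" and F N
  assumes additive: "Modules.additive f"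
    and compat: "list_all2 (\<lambda>X Y. \<forall>v. f (X v) = Y (f v)) Xs Ys"
    and opsX: "commuting_ops Xs" and opsY: "commuting_ops Ys"
    and subF: "graded_submodule Xs F" and subN: "graded_submodule Ys N"
    and surj: "\<And>t. f ` F t = N t"
begin

definition syz :: "int \<Rightarrow> 'b set" where
  "syz t = {v \<in> F t. f v = 0}"

lemma length_eq: "length Ys = length Xs"
  using compat by (simp add: list_all2_lengthD)

lemma kdiff_f: "kdiff Ys (f \<circ> c) = f \<circ> kdiff Xs c"
  using kdiff_hom[OF additive compat] by (auto simp: fun_eq_iff o_def)

lemma subZ: "graded_submodule Xs syz"
proof -
  have "f (X x) = 0" if "X \<in> set Xs" "f x = 0" for X x
  proof -
    obtain i where i: "i < length Xs" "X = Xs ! i" using \<open>X \<in> set Xs\<close> by (auto simp: in_set_conv_nth)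
    then have "f (X x) = (Ys ! i) (f x)" using compat by (auto simp: list_all2_conv_all_nth)
    moreover have "Modules.additive (Ys ! i)"
      using opsY i length_eq by (auto simp: commuting_ops_def)
    ultimately show ?thesis using that Modules.additive.zero by metis
  qed
  then show ?thesis
    using subF by (auto simp: graded_submodule_def syz_def Modules.additive.zero[OF additive]
        Modules.additive.diff[OF additive])
qed

lemma kspace_lift:
  assumes "c \<in> kspace m N i t"
  shows "\<exists>e\<in>kspace m F i t. f \<circ> e = c"
proof -
  have "\<forall>w. \<exists>v. (if length w = m \<and> trues w = i then v \<in> F t else v = 0) \<and> f v = c w"
  proof
    fix w
    show "\<exists>v. (if length w = m \<and> trues w = i then v \<in> F t else v = 0) \<and> f v = c w"
    proof (cases "length w = m \<and> trues w = i")
      case True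
      then have "c w \<in> f ` F t" using assms surj by (auto simp: kspace_def)
      then show ?thesis using True by auto
    next
      case False
      then have "c w = 0" using assms by (auto simp: kspace_def)
      then show ?thesis using False Modules.additive.zero[OF additive] by auto
    qed
  qed
  then obtain e where e: "\<And>w. (if length w = m \<and> trues w = i then e w \<in> F t else e w = 0) \<and> f (e w) = c w"
    by metis
  then have "e \<in> kspace m F i t" by (auto simp: kspace_def)
  then show ?thesis using e by (intro bexI[of _ e]) auto
qed

lemma kspace_image: "e \<in> kspace m F i t \<Longrightarrow> f \<circ> e \<in> kspace m N i t"
  using surj[of t, symmetric] Modules.additive.zero[OF additive] by (auto simp: kspace_def)

lemma kspace_syz: "e \<in> kspace m syz i t \<longleftrightarrow> e \<in> kspace m F i t \<and> f \<circ> e = 0"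
proof -
  have "(\<forall>w. if length w = m \<and> trues w = i then e w \<in> syz t else e w = 0) \<longleftrightarrow>
    (\<forall>w. (if length w = m \<and> trues w = i then e w \<in> F t else e w = 0) \<and> f (e w) = 0)"
    using Modules.additive.zero[OF additive] by (intro all_cong1) (auto simp: syz_def)
  then show ?thesis by (auto simp: kspace_def fun_eq_iff)
qed

lemma f_comp_diff: "f \<circ> (c - d) = (f \<circ> c) - (f \<circ> d)"
  by (auto simp: fun_eq_iff Modules.additive.diff[OF additive])

text \<open>Half of the connecting isomorphism. A lift \<open>e\<close> of the cycle has its
  differential in \<open>syz\<close>; subtracting a filling \<open>z\<close> of this differential
  inside \<open>syz\<close> leaves a cycle of \<open>F\<close>, whose filling maps to one of
  \<open>c\<close>. The shift of \<open>t\<close> reflects that \<open>t + Suc i\<close> and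
  \<open>(t + 1) + i\<close> are the same internal degree.\<close>

lemma kexact_cover_if_syz:
  assumes "kexact Xs syz i (t + 1)" "kexact Xs F (Suc i) t"
  shows "kexact Ys N (Suc i) t"
  unfolding kexact_def length_eq
proof (intro ballI impI)
  note dX = commuting_ops_additive_kdiff[OF opsX]
  fix c assume c: "c \<in> kspace (length Xs) N (Suc i) t" and dc: "kdiff Ys c = 0"
  obtain e where e: "e \<in> kspace (length Xs) F (Suc i) t" "f \<circ> e = c" using kspace_lift[OF c] by auto
  have "kdiff Xs e \<in> kspace (length Xs) syz i (t + 1)"
    using kdiff_kspace[OF opsX subF e(1)] dc e(2) kdiff_f by (auto simp: kspace_syz)
  then obtain z where z: "z \<in> kspace (length Xs) syz (Suc i) t" "kdiff Xs z = kdiff Xs e"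
    using assms(1) kdiff_kdiff[OF opsX] by (auto simp: kexact_def)
  have "e - z \<in> kspace (length Xs) F (Suc i) t"
    using z(1) e(1) kspace_group(3)[OF subF] by (auto simp: kspace_syz)
  moreover have "kdiff Xs (e - z) = 0" using z by (simp add: Modules.additive.diff[OF dX])
  ultimately obtain b where b: "b \<in> kspace (length Xs) F (Suc (Suc i)) (t - 1)" "kdiff Xs b = e - z"
    using assms(2) by (auto simp: kexact_def)
  have "kdiff Ys (f \<circ> b) = c"
    unfolding kdiff_f b f_comp_diff e using z(1) by (simp add: kspace_syz)
  then show "\<exists>b\<in>kspace (length Xs) N (Suc (Suc i)) (t - 1). kdiff Ys b = c"
    using kspace_image[OF b(1)] by blast
qed

text \<open>The second hypothesis says that cycles of \<open>syz\<close> bound in \<open>F\<close>.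
  It is kept separate because for \<open>i = 0\<close> it comes from minimality and for larger
  \<open>i\<close> from the exactness of \<open>F\<close>.\<close>

lemma kexact_syz_if_cover:
  assumes "kexact Ys N (Suc i) t"
    and "\<And>z. z \<in> kspace (length Xs) syz i (t + 1) \<Longrightarrow> kdiff Xs z = 0 \<Longrightarrow>
      \<exists>y\<in>kspace (length Xs) F (Suc i) t. kdiff Xs y = z"
  shows "kexact Xs syz i (t + 1)"
  unfolding kexact_def
proof (intro ballI impI)
  note dX = commuting_ops_additive_kdiff[OF opsX]
  fix z assume z: "z \<in> kspace (length Xs) syz i (t + 1)" and dz: "kdiff Xs z = 0"
  obtain y where y: "y \<in> kspace (length Xs) F (Suc i) t" "kdiff Xs y = z" using assms(2)[OF z dz] by auto
  have "kdiff Ys (f \<circ> y) = 0" using kdiff_f y z by (auto simp: kspace_syz)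
  then obtain c where c: "c \<in> kspace (length Xs) N (Suc (Suc i)) (t - 1)" "kdiff Ys c = f \<circ> y"
    using assms(1) kspace_image[OF y(1)] by (auto simp: kexact_def length_eq)
  obtain e where e: "e \<in> kspace (length Xs) F (Suc (Suc i)) (t - 1)" "f \<circ> e = c"
    using kspace_lift[OF c(1)] by auto
  have "y - kdiff Xs e \<in> kspace (length Xs) F (Suc i) t"
    using kspace_group(3)[OF subF y(1)] kdiff_kspace[OF opsX subF e(1)] by simp
  moreover have "f \<circ> (y - kdiff Xs e) = 0"
    unfolding f_comp_diff kdiff_f[symmetric] e c by simp
  moreover have "kdiff Xs (y - kdiff Xs e) = z"
    using y kdiff_kdiff[OF opsX] by (simp add: Modules.additive.diff[OF dX])
  ultimately show "\<exists>b\<in>kspace (length Xs) syz (Suc i) (t + 1 - 1). kdiff Xs b = z"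
    by (auto simp: kspace_syz)
qed

lemma kexact_cover_iff:
  assumes "\<And>i t. kexact Xs F (Suc i) t" "\<And>t. syz t \<subseteq> opspan Xs F (t - 1)"
  shows "kexact Ys N (Suc i) t \<longleftrightarrow> kexact Xs syz i (t + 1)"
proof
  assume *: "kexact Ys N (Suc i) t"
  show "kexact Xs syz i (t + 1)"
  proof (rule kexact_syz_if_cover[OF *])
    fix z assume z: "z \<in> kspace (length Xs) syz i (t + 1)" and dz: "kdiff Xs z = 0"
    show "\<exists>y\<in>kspace (length Xs) F (Suc i) t. kdiff Xs y = z"
    \<comment> \<open>A free \<open>F\<close> may have homology in degree 0; there the inclusion of
      \<open>syz\<close> in the multiples of the operators supplies the bounding chain.\<close>
    proof (cases i)
      case 0
      then obtain v where v: "v \<in> syz (t + 1)" "z = kzero (length Xs) v"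
        using z by (auto simp: kspace_0)
      then have "v \<in> opspan Xs F t" using assms(2)[of "t + 1"] by auto
      then show ?thesis using opspan_iff_kdiff[OF opsX] v 0 by simp
    next
      case (Suc i')
      then show ?thesis using assms(1)[of i' "t + 1"] z dz by (auto simp: kexact_def kspace_syz)
    qed
  qed
next
  assume "kexact Xs syz i (t + 1)"
  then show "kexact Ys N (Suc i) t" by (rule kexact_cover_if_syz[OF _ assms(1)])
qed

text \<open>A kernel inside the multiples of the operators does not change the quotient by these
  multiples, so \<open>F\<close> and \<open>N\<close> need generators in the same degrees.\<close>

lemma kexact_cover_0_iff:
  assumes "\<And>t. syz t \<subseteq> opspan Xs F (t - 1)"
  shows "kexact Ys N 0 t \<longleftrightarrow> kexact Xs F 0 t"
  unfolding kexact_0_iff[OF opsX] kexact_0_iff[OF opsY]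
proof
  assume "F t \<subseteq> opspan Xs F (t - 1)"
  then have "f v \<in> opspan Ys N (t - 1)" if "v \<in> F t" for v
    using that opspan_hom[OF additive compat, of F "t - 1" N v] surj[of "t - 1"] by auto
  then show "N t \<subseteq> opspan Ys N (t - 1)"
    unfolding surj[of t, symmetric] by blast
next
  assume *: "N t \<subseteq> opspan Ys N (t - 1)"
  show "F t \<subseteq> opspan Xs F (t - 1)"
  proof
    fix v assume v: "v \<in> F t"
    then have "f v \<in> opspan Ys N (t - 1)" using * surj by auto
    then obtain x where x: "x \<in> opspan Xs F (t - 1)" "f x = f v"
      using opspan_hom_surj[OF additive compat, of N "t - 1" F "f v"] surj[of "t - 1"] by auto
    have "x \<in> F t" if "x \<in> opspan Xs F (t - 1)" "\<And>X u. X \<in> set Xs \<Longrightarrow> u \<in> F (t - 1) \<Longrightarrow> X u \<in> F t" for x Xs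
      using that
      by (induction Xs arbitrary: x) (auto intro: graded_submoduleD[OF subF])
    from this[OF x(1)] have "x \<in> F t" using graded_submoduleD(5)[OF subF, of _ _ "t - 1"] by simp
    then have "x - v \<in> syz t"
      using v x by (auto simp: syz_def Modules.additive.diff[OF additive] intro: graded_submoduleD[OF subF])
    then have "x - v \<in> opspan Xs F (t - 1)" using assms by auto
    then have "x - (x - v) \<in> opspan Xs F (t - 1)"
      using opsX by (rule_tac opspan_diff[OF _ graded_submoduleD(2)[OF subF] x(1)])
        (auto simp: commuting_ops_def)
    then show "v \<in> opspan Xs F (t - 1)" by simp
  qed
qed

end

section \<open>Monomial modules\<close>

lemma lookup_single_mult:
  fixes g :: "'g::cancel_comm_monoid_add" and p :: "'g \<Rightarrow>\<^sub>0 'k::semiring_0"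
  shows "lookup (single g c * p) (g + r) = c * lookup p r"
    "(\<nexists>r. s = g + r) \<Longrightarrow> lookup (single g c * p) s = 0"
proof -
  have *: "lookup (single g c * p) s =
      c * Sum_any (\<lambda>q. lookup p q when s = g + q)" for s
    by (simp add: lookup_mult lookup_single when_mult)
  show "lookup (single g c * p) (g + r) = c * lookup p r"
    unfolding * by simp
  show "(\<nexists>r. s = g + r) \<Longrightarrow> lookup (single g c * p) s = 0"
    unfolding * by (auto simp: when_def)
qed

text \<open>The following describes the homology of one multigraded strand: chains with coefficients
  in a field on a simplicial complex \<^term>\<open>\<Delta>\<close>, including the empty face.\<close>

definition chain_on :: "nat \<Rightarrow> (bool list \<Rightarrow> bool) \<Rightarrow> nat \<Rightarrow> (bool list \<Rightarrow> 'k::zero) \<Rightarrow> bool" where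
  "chain_on m \<Delta> i c \<longleftrightarrow> (\<forall>w. c w \<noteq> 0 \<longrightarrow> length w = m \<and> trues w = i \<and> \<Delta> w)"

text \<open>A face with \<open>i\<close> vertices sits in degree \<open>i\<close>, so this is the
  vanishing of reduced simplicial homology in dimension \<open>i - 1\<close>: with the identity for
  each operator, the Koszul differential is, up to signs, the augmented boundary map. The first
  argument fixes the coefficient field.\<close>

definition cexact :: "'k::field itself \<Rightarrow> nat \<Rightarrow> (bool list \<Rightarrow> bool) \<Rightarrow> nat \<Rightarrow> bool" where
  "cexact _ m \<Delta> i \<longleftrightarrow> (\<forall>c :: bool list \<Rightarrow> 'k. chain_on m \<Delta> i c \<longrightarrow> kdiff (replicate m id) c = 0 \<longrightarrow>
     (\<exists>b. chain_on m \<Delta> (Suc i) b \<and> kdiff (replicate m id) b = c))"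

lemma cexact_cong:
  assumes "\<And>w. length w = m \<Longrightarrow> \<Delta> w \<longleftrightarrow> \<Delta>' w"
  shows "cexact T m \<Delta> i \<longleftrightarrow> cexact T m \<Delta>' i"
proof -
  have "chain_on m \<Delta> i = (chain_on m \<Delta>' i :: (bool list \<Rightarrow> 'a) \<Rightarrow> bool)" for i
    using assms by (auto simp: chain_on_def fun_eq_iff)
  then show ?thesis by (simp add: cexact_def)
qed

section \<open>Splitting the Koszul complex of a monomial module into strands\<close>

fun sel :: "'g list \<Rightarrow> bool list \<Rightarrow> 'g::comm_monoid_add" where
  "sel (g # gs) (b # w) = (if b then g else 0) + sel gs w"
| "sel _ _ = 0"

definition mops :: "'g list \<Rightarrow> (('g::comm_monoid_add \<Rightarrow>\<^sub>0 'k::comm_ring_1) \<Rightarrow> ('g \<Rightarrow>\<^sub>0 'k)) list" where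
  "mops gs = map (\<lambda>g. (*) (single g 1)) gs"

lemma length_mops [simp]: "length (mops gs) = length gs"
  by (simp add: mops_def)

lemma commuting_mops: "commuting_ops (mops gs)"
  by (auto simp: commuting_ops_def mops_def Modules.additive_def algebra_simps)

definition mmod :: "('g \<Rightarrow> int) \<Rightarrow> 'g set \<Rightarrow> int \<Rightarrow> ('g \<Rightarrow>\<^sub>0 'k::zero) set" where
  "mmod deg S t = {p. \<forall>u\<in>keys p. u \<in> S \<and> deg u = t}"

text \<open>The shift by \<^term>\<open>sel gs w\<close> turns the Koszul differential into the simplicial one.\<close>

definition strand :: "'g::comm_monoid_add list \<Rightarrow> (bool list \<Rightarrow> ('g \<Rightarrow>\<^sub>0 'k::comm_ring_1)) \<Rightarrow> 'g \<Rightarrow> bool list \<Rightarrow> 'k" where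
  "strand gs c s w = lookup (single (sel gs w) 1 * c w) s"

lemma additive_id: "Modules.additive id"
  by (simp add: Modules.additive_def)

text \<open>Removing a position from a list removes its monomial from the shift, and the operator at
  that position multiplies by this same monomial. After the shift every operator therefore acts as
  the identity.\<close>

lemma kdiff_shifted:
  "kdiff (replicate (length gs) id) (\<lambda>w. single (sel gs w) 1 * c w) w =
   single (sel gs w) (1::'k::comm_ring_1) * kdiff (mops gs) c w"
proof (induction gs arbitrary: c w)
  case Nil
  then show ?case by (simp add: mops_def)
next
  case (Cons g gs)
  show ?case
  proof (cases w)
    case Nil
    then show ?thesis by simp
  next
    case (Cons b u)
    have s: "single (g + x) (1::'k) = single g 1 * single x 1" for x
      by (simp add: mult_single)
    have "kdiff (replicate (length gs) id)
        (\<lambda>u. single g 1 * (single (sel gs u) 1 * c (True # u))) u =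
      single g 1 * kdiff (replicate (length gs) id)
        (\<lambda>u. single (sel gs u) 1 * c (True # u)) u"
      by (rule kdiff_hom) (auto simp: Modules.additive_def algebra_simps list_all2_same)
    note T = this[unfolded Cons.IH[of "\<lambda>u. c (True # u)" u]]
    show ?thesis
    proof (cases b)
      case True
      then show ?thesis
        unfolding Cons mops_def list.map length_Cons replicate_Suc sel.simps
        by (simp only: kdiff.simps sel.simps if_True s mult.assoc T[unfolded mops_def] mult_minus_right)
    next
      case False
      then show ?thesis using Cons.IH[of "\<lambda>u. c (False # u)" u]
        by (simp add: Cons mops_def s algebra_simps)
    qed
  qed
qed

lemma strand_kdiff: "strand gs (kdiff (mops gs) c) s = kdiff (replicate (length gs) id) (strand gs c s)"
proof
  fix w
  have "kdiff (replicate (length gs) id)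
      (\<lambda>w. lookup (single (sel gs w) 1 * c w) s) w =
    lookup (kdiff (replicate (length gs) id) (\<lambda>w. single (sel gs w) 1 * c w) w) s"
    by (rule kdiff_hom) (auto simp: Modules.additive_def lookup_add list_all2_conv_all_nth)
  then show "strand gs (kdiff (mops gs) c) s w = kdiff (replicate (length gs) id) (strand gs c s) w"
    by (simp add: strand_def[abs_def] kdiff_shifted)
qed

text \<open>Translation in a cancellative monoid is injective, so the coefficient of
  \<open>c w\<close> at \<open>k\<close> is recovered from the strand at
  \<open>sel gs w + k\<close>.\<close>

lemma strand_inject:
  fixes c d :: "bool list \<Rightarrow> ('g::cancel_comm_monoid_add \<Rightarrow>\<^sub>0 'k::comm_ring_1)"
  assumes "\<And>s. strand gs c s = strand gs d s"
  shows "c = d"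
proof
  fix w
  show "c w = d w"
  proof (rule poly_mapping_eqI)
    fix k
    show "lookup (c w) k = lookup (d w) k"
      using fun_cong[OF assms[of "sel gs w + k"], of w] by (simp add: strand_def lookup_single_mult)
  qed
qed

lemma strand_zero [simp]: "strand gs 0 s = 0"
  by (auto simp: strand_def fun_eq_iff)

locale monomial_module =
  fixes gs :: "'g::cancel_comm_monoid_add list" and S :: "'g set" and deg :: "'g \<Rightarrow> int"
  assumes S_closed: "g \<in> set gs \<Longrightarrow> x \<in> S \<Longrightarrow> g + x \<in> S"
    and deg_add: "g \<in> set gs \<Longrightarrow> deg (g + x) = 1 + deg x"
begin

lemma graded_mmod: "graded_submodule (mops gs) (mmod deg S :: int \<Rightarrow> ('g \<Rightarrow>\<^sub>0 'k::comm_ring_1) set)"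
  unfolding graded_submodule_def
proof (intro allI conjI ballI)
  fix t
  show "(0 :: 'g \<Rightarrow>\<^sub>0 'k) \<in> mmod deg S t" by (simp add: mmod_def)
  fix x :: "'g \<Rightarrow>\<^sub>0 'k" assume x: "x \<in> mmod deg S t"
  show "x - y \<in> mmod deg S t" if y: "y \<in> mmod deg S t" for y
    using x y unfolding mmod_def by (auto simp: in_keys_iff lookup_minus)
  show "X x \<in> mmod deg S (t + 1)" if X: "X \<in> set (mops gs)" for X
  proof -
    obtain g where g: "g \<in> set gs" "X = (*) (single g 1)" using X by (auto simp: mops_def)
    have "u \<in> S \<and> deg u = t + 1" if u: "u \<in> keys (X x)" for u
    proof -
      obtain r where "u = g + r" "r \<in> keys x"
        using u keys_mult[of "single g 1" x] g by (auto split: if_splits)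
      then show ?thesis using x S_closed[OF g(1)] deg_add[OF g(1)] by (auto simp: mmod_def)
    qed
    then show ?thesis by (simp add: mmod_def)
  qed
qed

text \<open>This is the squarefree divisor complex of \<open>s\<close>; it carries the homology of
  the strand at \<open>s\<close>.\<close>

definition faces :: "'g \<Rightarrow> bool list \<Rightarrow> bool" where
  "faces s w \<longleftrightarrow> (\<exists>r\<in>S. s = sel gs w + r)"

lemma deg_sel: "length w = length gs \<Longrightarrow> deg (sel gs w + x) = int (trues w) + deg x"
proof -
  have "length w = length hs \<Longrightarrow> set hs \<subseteq> set gs \<Longrightarrow> deg (sel hs w + x) = int (trues w) + deg x" for hs
  proof (induction w arbitrary: hs)
    case (Cons b w)
    then obtain h hs' where "hs = h # hs'" by (cases hs) auto
    then show ?case using Cons by (cases b) (auto simp: deg_add add.assoc)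
  qed simp
  then show "length w = length gs \<Longrightarrow> deg (sel gs w + x) = int (trues w) + deg x" by auto
qed

lemma chain_on_strand:
  assumes "c \<in> kspace (length gs) (mmod deg S) i t"
  shows "chain_on (length gs) (faces s) i (strand gs c s)"
    "strand gs c s \<noteq> 0 \<Longrightarrow> deg s = t + int i"
proof -
  have *: "length w = length gs \<and> trues w = i \<and> faces s w \<and> deg s = t + int i" if "strand gs c s w \<noteq> 0" for w
  proof -
    have "c w \<noteq> 0" using that by (auto simp: strand_def)
    then have w: "length w = length gs" "trues w = i" "c w \<in> mmod deg S t"
      using assms by (auto simp: kspace_def split: if_splits)
    have "\<exists>r. s = sel gs w + r"
    proof (rule ccontr)
      assume "\<nexists>r. s = sel gs w + r"
      from lookup_single_mult(2)[OF this, of 1 "c w"] that show False by (simp add: strand_def)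
    qed
    then obtain r where r: "s = sel gs w + r" by blast
    then have "lookup (c w) r \<noteq> 0" using that by (simp add: strand_def lookup_single_mult)
    then have "r \<in> S" "deg r = t" using w by (auto simp: mmod_def in_keys_iff)
    then show ?thesis using w r deg_sel[OF w(1), of r] by (auto simp: faces_def)
  qed
  then show "chain_on (length gs) (faces s) i (strand gs c s)" by (auto simp: chain_on_def)
  show "strand gs c s \<noteq> 0 \<Longrightarrow> deg s = t + int i" using * by (auto simp: fun_eq_iff)
qed

text \<open>The entry of \<open>b\<close> at \<open>w\<close> is obtained by undoing the shift
  \<open>sel gs w\<close>. Finiteness of the family makes these entries polynomials, and the face
  condition puts their exponents into \<open>S\<close>.\<close>

lemma strand_surj:
  fixes \<beta> :: "'g \<Rightarrow> bool list \<Rightarrow> 'k::comm_ring_1"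
  assumes "finite {s. \<beta> s \<noteq> 0}" "\<And>s. chain_on (length gs) (faces s) i (\<beta> s)"
    "\<And>s. \<beta> s \<noteq> 0 \<Longrightarrow> deg s = t + int i"
  shows "\<exists>b\<in>kspace (length gs) (mmod deg S) i t. \<forall>s. strand gs b s = \<beta> s"
proof -
  have fin: "finite {r. \<beta> (sel gs w + r) w \<noteq> 0}" for w
  proof (rule finite_imageD)
    have "(+) (sel gs w) ` {r. \<beta> (sel gs w + r) w \<noteq> 0} \<subseteq> {s. \<beta> s \<noteq> 0}" by auto
    then show "finite ((+) (sel gs w) ` {r. \<beta> (sel gs w + r) w \<noteq> 0})"
      using assms(1) by (rule finite_subset)
  qed simp
  define b where "b = (\<lambda>w. Abs_poly_mapping (\<lambda>r. \<beta> (sel gs w + r) w))"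
  have look: "lookup (b w) r = \<beta> (sel gs w + r) w" for w r
    unfolding b_def using fin[of w] by simp
  have "strand gs b s w = \<beta> s w" for s w
  proof (cases "\<exists>r. s = sel gs w + r")
    case True
    then show ?thesis by (auto simp: strand_def lookup_single_mult look)
  next
    case False
    then have "\<not> faces s w" by (auto simp: faces_def)
    then have "\<beta> s w = 0" using assms(2)[of s] by (auto simp: chain_on_def)
    then show ?thesis using False lookup_single_mult(2)[of s "sel gs w" 1 "b w"] by (simp add: strand_def)
  qed
  moreover have "if length w = length gs \<and> trues w = i then b w \<in> mmod deg S t else b w = 0" for w
  proof -
    have *: "length w = length gs \<and> trues w = i \<and> r \<in> S \<and> deg r = t" if "lookup (b w) r \<noteq> 0" for r
    proof -
      have nz: "\<beta> (sel gs w + r) w \<noteq> 0" using that look by simp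
      then have w: "length w = length gs" "trues w = i" "faces (sel gs w + r) w"
        using assms(2)[of "sel gs w + r"] by (auto simp: chain_on_def)
      moreover have "r \<in> S" using w(3) by (auto simp: faces_def)
      moreover have "deg (sel gs w + r) = t + int i" using nz by (intro assms(3)) (auto simp: fun_eq_iff)
      ultimately show ?thesis using deg_sel[OF w(1), of r] by simp
    qed
    then have "b w = 0" if "\<not> (length w = length gs \<and> trues w = i)"
      using that by (intro poly_mapping_eqI) auto
    with * show ?thesis
      by (simp add: mmod_def in_keys_iff)
  qed
  then have "b \<in> kspace (length gs) (mmod deg S) i t" by (simp add: kspace_def)
  ultimately show ?thesis by (intro bexI[of _ b]) (auto simp: fun_eq_iff)
qed

theorem kexact_mmod_iff:
  "kexact (mops gs) (mmod deg S :: int \<Rightarrow> ('g \<Rightarrow>\<^sub>0 'k::field) set) i t \<longleftrightarrow>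
     (\<forall>s. deg s = t + int i \<longrightarrow> cexact TYPE('k) (length gs) (faces s) i)"
proof
  assume ex: "kexact (mops gs) (mmod deg S :: int \<Rightarrow> ('g \<Rightarrow>\<^sub>0 'k::field) set) i t"
  show "\<forall>s. deg s = t + int i \<longrightarrow> cexact TYPE('k) (length gs) (faces s) i"
    unfolding cexact_def
  proof (intro allI impI)
    fix s and c :: "bool list \<Rightarrow> 'k"
    assume s: "deg s = t + int i" and c: "chain_on (length gs) (faces s) i c"
      and dc: "kdiff (replicate (length gs) id) c = 0"
    \<comment> \<open>The single chain \<open>c\<close> is placed in the strand at \<open>s\<close>,
      all other strands being zero.\<close>
    define \<beta> where "\<beta> = (\<lambda>s'. if s' = s then c else 0)"
    have "\<exists>b\<in>kspace (length gs) (mmod deg S) i t. \<forall>s. strand gs b s = \<beta> s"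
    proof (rule strand_surj)
      show "finite {s. \<beta> s \<noteq> 0}" by (rule finite_subset[of _ "{s}"]) (auto simp: \<beta>_def)
      show "chain_on (length gs) (faces s') i (\<beta> s')" for s'
        using c by (auto simp: \<beta>_def chain_on_def)
      show "\<beta> s' \<noteq> 0 \<Longrightarrow> deg s' = t + int i" for s' using s by (auto simp: \<beta>_def split: if_splits)
    qed
    then obtain C where C: "C \<in> kspace (length gs) (mmod deg S) i t" "\<And>s. strand gs C s = \<beta> s" by auto
    have z: "kdiff (replicate (length gs) id) (0 :: bool list \<Rightarrow> 'k) = 0"
      by (rule kdiff_zero) (auto simp: additive_id)
    have "kdiff (mops gs) C = 0"
    proof (rule strand_inject[of gs])
      fix s'
      have "kdiff (replicate (length gs) id) (\<beta> s') = 0"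
        unfolding \<beta>_def using dc z by (cases "s' = s") (simp_all only: simp_thms if_True if_False)
      then show "strand gs (kdiff (mops gs) C) s' = strand gs 0 s'"
        by (simp only: strand_kdiff C(2) strand_zero)
    qed
    then obtain b where b: "b \<in> kspace (length gs) (mmod deg S) (Suc i) (t - 1)" "kdiff (mops gs) b = C"
      using ex C(1) by (auto simp: kexact_def)
    have "kdiff (replicate (length gs) id) (strand gs b s) = c"
      unfolding strand_kdiff[symmetric] b C by (simp add: \<beta>_def)
    then show "\<exists>b. chain_on (length gs) (faces s) (Suc i) b \<and> kdiff (replicate (length gs) id) b = c"
      using chain_on_strand(1)[OF b(1)] by blast
  qed
next
  assume ex: "\<forall>s. deg s = t + int i \<longrightarrow> cexact TYPE('k) (length gs) (faces s) i"
  show "kexact (mops gs) (mmod deg S :: int \<Rightarrow> ('g \<Rightarrow>\<^sub>0 'k::field) set) i t"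
    unfolding kexact_def length_mops
  proof (intro ballI impI)
    fix c :: "bool list \<Rightarrow> 'g \<Rightarrow>\<^sub>0 'k"
    assume c: "c \<in> kspace (length gs) (mmod deg S) i t" and dc: "kdiff (mops gs) c = 0"
    have z: "kdiff (replicate (length gs) id) (0 :: bool list \<Rightarrow> 'k) = 0"
      by (rule kdiff_zero) (auto simp: additive_id)
    \<comment> \<open>Zero is chosen as filling wherever the strand of \<open>c\<close> vanishes;
      this keeps the family of fillings finite, as \<open>strand_surj\<close> demands.\<close>
    have "\<exists>b. chain_on (length gs) (faces s) (Suc i) b \<and> kdiff (replicate (length gs) id) b = strand gs c s \<and>
        (b \<noteq> 0 \<longrightarrow> strand gs c s \<noteq> 0)" for s
    proof (cases "strand gs c s = 0")
      case True
      then show ?thesis using z by (intro exI[of _ 0]) (auto simp: chain_on_def)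
    next
      case False
      then have "cexact TYPE('k) (length gs) (faces s) i" using ex chain_on_strand(2)[OF c] by auto
      moreover have "kdiff (replicate (length gs) id) (strand gs c s) = 0"
        unfolding strand_kdiff[symmetric] dc by simp
      ultimately show ?thesis using chain_on_strand(1)[OF c] False unfolding cexact_def by blast
    qed
    then obtain \<beta> where \<beta>: "\<And>s. chain_on (length gs) (faces s) (Suc i) (\<beta> s)"
      "\<And>s. kdiff (replicate (length gs) id) (\<beta> s) = strand gs c s" "\<And>s. \<beta> s \<noteq> 0 \<Longrightarrow> strand gs c s \<noteq> 0"
      by metis
    have fin: "finite {s. strand gs c s \<noteq> 0}"
    proof (rule finite_subset)
      show "{s. strand gs c s \<noteq> 0} \<subseteq>
        (\<Union>w\<in>{w. set w \<subseteq> UNIV \<and> length w = length gs}. keys (single (sel gs w) 1 * c w))"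
      proof
        fix s assume "s \<in> {s. strand gs c s \<noteq> 0}"
        then obtain w where w: "strand gs c s w \<noteq> 0" by (auto simp: fun_eq_iff)
        then have "length w = length gs" using chain_on_strand(1)[OF c, of s] by (auto simp: chain_on_def)
        then show "s \<in> (\<Union>w\<in>{w. set w \<subseteq> UNIV \<and> length w = length gs}. keys (single (sel gs w) 1 * c w))"
          using w by (auto simp: strand_def in_keys_iff)
      qed
    qed (intro finite_UN_I finite_lists_length_eq; simp)
    have "\<exists>b\<in>kspace (length gs) (mmod deg S) (Suc i) (t - 1). \<forall>s. strand gs b s = \<beta> s"
    proof (rule strand_surj[OF _ \<beta>(1)])
      show "finite {s. \<beta> s \<noteq> 0}" using \<beta>(3) by (intro finite_subset[OF _ fin]) auto
      show "\<beta> s \<noteq> 0 \<Longrightarrow> deg s = t - 1 + int (Suc i)" for s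
        using chain_on_strand(2)[OF c, of s] \<beta>(3)[of s] by simp
    qed
    then obtain b where b: "b \<in> kspace (length gs) (mmod deg S) (Suc i) (t - 1)" "\<And>s. strand gs b s = \<beta> s" by auto
    have "kdiff (mops gs) b = c"
      by (rule strand_inject[of gs]) (simp add: strand_kdiff b \<beta>)
    then show "\<exists>b\<in>kspace (length gs) (mmod deg S) (Suc i) (t - 1). kdiff (mops gs) b = c" using b(1) by blast
  qed
qed

end

section \<open>Acyclicity of a simplex\<close>

lemma chain_on_kcons:
  assumes "chain_on (Suc m) \<Delta> i c"
  shows "\<exists>c0 c1. c = kcons c0 c1 \<and> chain_on m (\<lambda>w. \<Delta> (False # w)) i c0 \<and>
    (\<forall>w. c1 w \<noteq> 0 \<longrightarrow> length w = m \<and> Suc (trues w) = i \<and> \<Delta> (True # w))"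
proof (intro exI conjI)
  show "c = kcons (\<lambda>w. c (False # w)) (\<lambda>w. c (True # w))"
  proof
    fix w show "c w = kcons (\<lambda>w. c (False # w)) (\<lambda>w. c (True # w)) w"
    proof (cases w)
      case Nil then show ?thesis using assms by (auto simp: chain_on_def)
    next
      case (Cons b u) then show ?thesis by (cases b) auto
    qed
  qed
  have *: "c (b # w) \<noteq> 0 \<Longrightarrow> length (b # w) = Suc m \<and> trues (b # w) = i \<and> \<Delta> (b # w)" for b w
    using assms unfolding chain_on_def by blast
  show "chain_on m (\<lambda>w. \<Delta> (False # w)) i (\<lambda>w. c (False # w))"
    using *[of False] by (simp add: chain_on_def)
  show "\<forall>w. c (True # w) \<noteq> 0 \<longrightarrow> length w = m \<and> Suc (trues w) = i \<and> \<Delta> (True # w)"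
    using *[of True] by simp
qed

lemma chain_on_kconsI:
  assumes "chain_on m (\<lambda>w. \<Delta> (False # w)) i c0"
    "\<And>w. c1 w \<noteq> 0 \<Longrightarrow> length w = m \<and> Suc (trues w) = i \<and> \<Delta> (True # w)"
  shows "chain_on (Suc m) \<Delta> i (kcons c0 c1)"
  unfolding chain_on_def
proof (intro allI impI)
  fix w assume nz: "kcons c0 c1 w \<noteq> 0"
  then obtain b u where w: "w = b # u" by (cases w) auto
  show "length w = Suc m \<and> trues w = i \<and> \<Delta> w"
    using nz assms unfolding w chain_on_def by (cases b) auto
qed

lemma kdiff_id_zero: "kdiff (replicate m id) (0 :: bool list \<Rightarrow> 'k::ab_group_add) = 0"
  by (rule kdiff_zero) (auto simp: additive_id)

text \<open>The list \<open>\<sigma>\<close> marks the vertices of a full simplex. With at least one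
  vertex the simplex is a cone, hence acyclic; without vertices the empty face remains alone and
  gives homology in degree 0.\<close>

lemma cexact_simplex:
  "cexact TYPE('k::field) (length \<sigma>) (\<lambda>w. list_all2 (\<longrightarrow>) w \<sigma>) i \<longleftrightarrow> i \<noteq> 0 \<or> True \<in> set \<sigma>"
proof
  assume ex: "cexact TYPE('k::field) (length \<sigma>) (\<lambda>w. list_all2 (\<longrightarrow>) w \<sigma>) i"
  show "i \<noteq> 0 \<or> True \<in> set \<sigma>"
  proof (rule ccontr)
    assume n: "\<not> (i \<noteq> 0 \<or> True \<in> set \<sigma>)"
    have *: "w = replicate (length \<sigma>) False" if "list_all2 (\<longrightarrow>) w \<sigma>" for w
    proof (rule nth_equalityI)
      show "length w = length (replicate (length \<sigma>) False)" using that by (simp add: list_all2_lengthD)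
      fix j assume "j < length w"
      then show "w ! j = replicate (length \<sigma>) False ! j"
        using that n by (auto simp: list_all2_conv_all_nth) (metis nth_mem)
    qed
    have "chain_on (length \<sigma>) (\<lambda>w. list_all2 (\<longrightarrow>) w \<sigma>) i (kzero (length \<sigma>) (1::'k))"
      using n trues_eq_0_iff[of _ "length \<sigma>"]
      by (auto simp: chain_on_def kzero_def list_all2_conv_all_nth)
    moreover have "kdiff (replicate (length \<sigma>) id) (kzero (length \<sigma>) (1::'k)) = 0"
      using kdiff_kzero[of "replicate (length \<sigma>) id" "1::'k"] by (simp add: additive_id)
    ultimately obtain b :: "bool list \<Rightarrow> 'k" where
      b: "chain_on (length \<sigma>) (\<lambda>w. list_all2 (\<longrightarrow>) w \<sigma>) (Suc i) b"
      "kdiff (replicate (length \<sigma>) id) b = kzero (length \<sigma>) 1"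
      using ex unfolding cexact_def by blast
    have "b = 0"
    proof
      fix w
      have "b w \<noteq> 0 \<Longrightarrow> w = replicate (length \<sigma>) False \<and> trues w = Suc i"
        using * b(1) by (auto simp: chain_on_def)
      moreover have "trues (replicate (length \<sigma>) False) = 0" using trues_eq_0_iff by blast
      ultimately show "b w = 0 w" by fastforce
    qed
    then have "kzero (length \<sigma>) (1::'k) = 0" using b(2) kdiff_id_zero by metis
    then show False by (metis kzero_def zero_fun_apply zero_neq_one)
  qed
next
  assume "i \<noteq> 0 \<or> True \<in> set \<sigma>"
  then show "cexact TYPE('k::field) (length \<sigma>) (\<lambda>w. list_all2 (\<longrightarrow>) w \<sigma>) i"
  proof (induction \<sigma>)
    case Nil
    have "b = 0" if "chain_on 0 \<Delta> i b" for \<Delta> and b :: "bool list \<Rightarrow> 'k"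
      using that Nil by (auto simp: chain_on_def fun_eq_iff)
    then show ?case
      unfolding cexact_def list.size
      using kdiff_id_zero[of 0, where ?'k = 'k] by (auto intro!: exI[of _ 0] simp: chain_on_def)
  next
    case (Cons s \<sigma>)
    note add = additive_kdiff[of "replicate (length \<sigma>) id"]
    show ?case
      unfolding cexact_def length_Cons
    proof (intro allI impI)
      fix c :: "bool list \<Rightarrow> 'k"
      assume c: "chain_on (Suc (length \<sigma>)) (\<lambda>w. list_all2 (\<longrightarrow>) w (s # \<sigma>)) i c"
        and dc: "kdiff (replicate (Suc (length \<sigma>)) id) c = 0"
      obtain c0 c1 where c01: "c = kcons c0 c1" "chain_on (length \<sigma>) (\<lambda>w. list_all2 (\<longrightarrow>) w \<sigma>) i c0"
        "\<And>w. c1 w \<noteq> 0 \<Longrightarrow> length w = length \<sigma> \<and> Suc (trues w) = i \<and> s \<and> list_all2 (\<longrightarrow>) w \<sigma>"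
        using chain_on_kcons[OF c] by auto
      have d: "kdiff (replicate (length \<sigma>) id) c0 + c1 = 0"
        using dc by (simp add: c01 kdiff_kcons)
      show "\<exists>b. chain_on (Suc (length \<sigma>)) (\<lambda>w. list_all2 (\<longrightarrow>) w (s # \<sigma>)) (Suc i) b \<and>
          kdiff (replicate (Suc (length \<sigma>)) id) b = c"
      proof (cases s)
        case True
        \<comment> \<open>The first position is a cone point: the filling moves the coefficients of
          \<open>c0\<close> to the joins of its faces with this vertex.\<close>
        have "- kdiff (replicate (length \<sigma>) id) c0 = c1" using d by (rule minus_unique)
        then have "kdiff (replicate (Suc (length \<sigma>)) id) (kcons 0 c0) = c"
          unfolding replicate_Suc kdiff_kcons kdiff_id_zero c01(1) by simp
        moreover have "chain_on (Suc (length \<sigma>)) (\<lambda>w. list_all2 (\<longrightarrow>) w (s # \<sigma>)) (Suc i) (kcons 0 c0)"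
          using c01(2) True by (intro chain_on_kconsI) (auto simp: chain_on_def)
        ultimately show ?thesis by blast
      next
        case False
        then have "c1 = 0" using c01(3) by (auto simp: fun_eq_iff)
        then have "kdiff (replicate (length \<sigma>) id) c0 = 0" using d by simp
        then obtain b where b: "chain_on (length \<sigma>) (\<lambda>w. list_all2 (\<longrightarrow>) w \<sigma>) (Suc i) b"
          "kdiff (replicate (length \<sigma>) id) b = c0"
          using Cons c01(2) False unfolding cexact_def by auto
        have "kdiff (replicate (Suc (length \<sigma>)) id) (kcons b 0) = c"
          unfolding replicate_Suc kdiff_kcons kdiff_id_zero c01(1) b(2) \<open>c1 = 0\<close> by simp
        moreover have "chain_on (Suc (length \<sigma>)) (\<lambda>w. list_all2 (\<longrightarrow>) w (s # \<sigma>)) (Suc i) (kcons b 0)"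
          using b(1) by (intro chain_on_kconsI) (auto simp: chain_on_def)
        ultimately show ?thesis by blast
      qed
    qed
  qed
qed

section \<open>Graded free modules over the polynomial ring\<close>

lemma mon_degree_eq_sum:
  assumes "finite A" "keys u \<subseteq> A"
  shows "mon_degree u = (\<Sum>i\<in>A. lookup u i)"
  unfolding mon_degree_def using assms
  by (intro sum.mono_neutral_left) (auto simp: in_keys_iff)

lemma mon_degree_add: "mon_degree (u + v) = mon_degree u + mon_degree v"
proof -
  let ?A = "keys u \<union> keys v"
  have "mon_degree (u + v) = (\<Sum>i\<in>?A. lookup (u + v) i)"
    by (rule mon_degree_eq_sum) (use Poly_Mapping.keys_add[of u v] in auto)
  also have "\<dots> = mon_degree u + mon_degree v"
    by (simp add: lookup_add sum.distrib mon_degree_eq_sum[of ?A u] mon_degree_eq_sum[of ?A v])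
  finally show ?thesis .
qed

lemma mon_degree_single [simp]: "mon_degree (single l c) = c"
  by (simp add: mon_degree_def)

lemma mon_degree_eq_0_iff: "mon_degree u = 0 \<longleftrightarrow> u = 0"
  by (auto simp: mon_degree_def in_keys_iff intro!: poly_mapping_eqI)

lemma mon_degree_zero [simp]: "mon_degree 0 = 0"
  by (simp add: mon_degree_eq_0_iff)

definition mons :: "nat \<Rightarrow> (nat \<Rightarrow>\<^sub>0 nat) set" where
  "mons n = {u. keys u \<subseteq> {1..n}}"

definition idx :: "nat \<Rightarrow> nat list" where
  "idx n = [1..<Suc n]"

lemma set_idx [simp]: "set (idx n) = {1..n}" and length_idx [simp]: "length (idx n) = n"
  and distinct_idx [simp]: "distinct (idx n)"
  by (auto simp: idx_def)

definition xmon :: "nat \<Rightarrow> (nat \<Rightarrow>\<^sub>0 nat)" where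
  "xmon l = single l 1"

lemma lookup_xmon [simp]: "lookup (xmon l) k = (if k = l then 1 else 0)"
  by (simp add: xmon_def lookup_single when_def)

definition hpolys :: "nat \<Rightarrow> int \<Rightarrow> ('k::zero mpoly) set" where
  "hpolys n = mmod (\<lambda>u. int (mon_degree u)) (mons n)"

lemma hpolys_iff: "p \<in> hpolys n t \<longleftrightarrow> p \<in> polys n \<and> homogeneous t p"
  by (auto simp: hpolys_def mmod_def polys_def homogeneous_def mons_def)

definition pops :: "nat \<Rightarrow> (('k::comm_ring_1 mpoly) \<Rightarrow> ('k mpoly)) list" where
  "pops n = mops (map xmon (idx n))"

lemma mons_add: "u \<in> mons n \<Longrightarrow> v \<in> mons n \<Longrightarrow> u + v \<in> mons n"
  using Poly_Mapping.keys_add[of u v] by (auto simp: mons_def)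

interpretation pring: monomial_module "map xmon (idx n)" "mons n" "\<lambda>u. int (mon_degree u)" for n
proof
  fix g x assume "g \<in> set (map xmon (idx n))"
  then obtain l where l: "l \<in> {1..n}" "g = xmon l" by auto
  then have "g \<in> mons n" by (auto simp: mons_def xmon_def)
  then show "x \<in> mons n \<Longrightarrow> g + x \<in> mons n" by (rule mons_add)
  show "int (mon_degree (g + x)) = 1 + int (mon_degree x)" by (simp add: l mon_degree_add xmon_def)
qed

lemma sel_le:
  assumes "distinct ls" "list_all2 (\<longrightarrow>) w (map (\<lambda>l. lookup s l \<noteq> 0) ls)"
  shows "lookup (sel (map xmon ls) w) k \<le> (if k \<in> set ls then lookup s k else 0)"
  using assms
proof (induction ls arbitrary: w)
  case Nil
  then show ?case by simp
next
  case (Cons l ls)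
  then obtain b u where w: "w = b # u" by (cases w) auto
  then have "lookup (sel (map xmon ls) u) k \<le> (if k \<in> set ls then lookup s k else 0)"
    using Cons by simp
  then show ?case using Cons.prems w
    by (auto simp: lookup_add split: if_splits)
qed

text \<open>A squarefree monomial divides the monomial with exponent \<open>s\<close> exactly if its
  variables occur there: the divisor complex is the full simplex on the support of
  \<open>s\<close>.\<close>

lemma faces_mons:
  assumes "length w = n"
  shows "pring.faces n s w \<longleftrightarrow>
    s \<in> mons n \<and> list_all2 (\<longrightarrow>) w (map (\<lambda>l. lookup s l \<noteq> 0) (idx n))"
proof
  assume "pring.faces n s w"
  then obtain r where r: "r \<in> mons n" "s = sel (map xmon (idx n)) w + r"
    by (auto simp: pring.faces_def)
  have "sel (map xmon ls) w \<in> mons n" if "set ls \<subseteq> {1..n}" for ls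
    using that
  proof (induction ls arbitrary: w)
    case Nil
    then show ?case by (simp add: mons_def)
  next
    case (Cons l ls)
    have "xmon l \<in> mons n" using Cons by (auto simp: mons_def xmon_def)
    moreover have "0 \<in> mons n" by (simp add: mons_def)
    ultimately show ?case using Cons by (cases w) (auto intro: mons_add)
  qed
  then have "s \<in> mons n" using r by (auto intro: mons_add)
  moreover have "length w = length ls \<Longrightarrow> s = sel (map xmon ls) w + r \<Longrightarrow>
      list_all2 (\<longrightarrow>) w (map (\<lambda>l. lookup s l \<noteq> 0) ls)" for ls r
  proof (induction ls arbitrary: w r)
    case (Cons l ls)
    then obtain b u where w: "w = b # u" by (cases w) auto
    have "s = sel (map xmon ls) u + ((if b then xmon l else 0) + r)"
      using Cons.prems w by (simp add: algebra_simps)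
    from Cons.IH[OF _ this] Cons.prems(1) w
    have "list_all2 (\<longrightarrow>) u (map (\<lambda>l. lookup s l \<noteq> 0) ls)" by simp
    moreover have "b \<Longrightarrow> lookup s l \<noteq> 0"
      using Cons.prems w by (simp add: lookup_add)
    ultimately show ?case using w by simp
  qed simp
  ultimately show "s \<in> mons n \<and> list_all2 (\<longrightarrow>) w (map (\<lambda>l. lookup s l \<noteq> 0) (idx n))"
    using r assms by simp
next
  assume *: "s \<in> mons n \<and> list_all2 (\<longrightarrow>) w (map (\<lambda>l. lookup s l \<noteq> 0) (idx n))"
  let ?g = "sel (map xmon (idx n)) w"
  have le: "lookup ?g k \<le> lookup s k" for k
    using sel_le[of "idx n" w s k] * by (auto split: if_splits)
  have "s = ?g + (s - ?g)"
    by (rule poly_mapping_eqI) (use le in \<open>simp add: lookup_add lookup_minus\<close>)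
  moreover have "s - ?g \<in> mons n"
    using * by (auto simp: mons_def in_keys_iff lookup_minus)
  ultimately show "pring.faces n s w" by (auto simp: pring.faces_def)
qed

text \<open>The Koszul complex of the variables resolves the field: the strand at an exponent
  \<open>s\<close> is a simplex with at least one vertex unless \<open>s = 0\<close>, and that
  exception sits at \<open>i = 0\<close> and \<open>t = 0\<close>.\<close>

lemma kexact_hpolys: "kexact (pops n) (hpolys n :: int \<Rightarrow> ('k::field mpoly) set) i t \<longleftrightarrow> i \<noteq> 0 \<or> t \<noteq> 0"
proof -
  have *: "cexact TYPE('k) n (pring.faces n s) i \<longleftrightarrow> s \<notin> mons n \<or> i \<noteq> 0 \<or> s \<noteq> 0" for s
  proof (cases "s \<in> mons n")
    case True
    have "cexact TYPE('k) n (pring.faces n s) i \<longleftrightarrow>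
      cexact TYPE('k) (length (map (\<lambda>l. lookup s l \<noteq> 0) (idx n)))
        (\<lambda>w. list_all2 (\<longrightarrow>) w (map (\<lambda>l. lookup s l \<noteq> 0) (idx n))) i"
      unfolding length_map length_idx using faces_mons[of _ n s] True by (intro cexact_cong) simp
    also have "\<dots> \<longleftrightarrow> i \<noteq> 0 \<or> (\<exists>l\<in>{1..n}. lookup s l \<noteq> 0)"
      unfolding cexact_simplex by auto
    also have "(\<exists>l\<in>{1..n}. lookup s l \<noteq> 0) \<longleftrightarrow> s \<noteq> 0"
    proof
      assume "s \<noteq> 0"
      then obtain l where "l \<in> keys s" by (metis all_not_in_conv keys_eq_empty)
      moreover from this have "l \<in> {1..n}" using True unfolding mons_def by blast
      ultimately show "\<exists>l\<in>{1..n}. lookup s l \<noteq> 0" unfolding in_keys_iff by blast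
    qed auto
    finally show ?thesis using True by simp
  next
    case False
    have "cexact TYPE('k) n (pring.faces n s) i \<longleftrightarrow> cexact TYPE('k) n (\<lambda>w. False) i"
      using faces_mons[of _ n s] False by (intro cexact_cong) simp
    moreover have "cexact TYPE('k) n (\<lambda>w. False) i"
    proof -
      have "c = 0" if "chain_on n (\<lambda>w. False) i c" for c :: "bool list \<Rightarrow> 'k"
        using that by (auto simp: chain_on_def fun_eq_iff)
      moreover have "chain_on n (\<lambda>w. False) (Suc i) (0 :: bool list \<Rightarrow> 'k)" by (simp add: chain_on_def)
      ultimately show ?thesis unfolding cexact_def using kdiff_id_zero by blast
    qed
    ultimately show ?thesis using False by simp
  qed
  have "kexact (pops n) (hpolys n :: int \<Rightarrow> ('k::field mpoly) set) i t \<longleftrightarrow>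
      (\<forall>s. int (mon_degree s) = t + int i \<longrightarrow> s \<notin> mons n \<or> i \<noteq> 0 \<or> s \<noteq> 0)"
    unfolding pops_def hpolys_def pring.kexact_mmod_iff by (simp add: *)
  also have "\<dots> \<longleftrightarrow> i \<noteq> 0 \<or> t \<noteq> 0"
    by (auto dest: spec[of _ 0] simp: mons_def)
  finally show ?thesis .
qed

section \<open>Direct sums of shifted polynomial rings\<close>

definition fops :: "nat \<Rightarrow> ((nat \<Rightarrow> 'k::comm_ring_1 mpoly) \<Rightarrow> nat \<Rightarrow> 'k mpoly) list" where
  "fops n = map (\<lambda>l v k. single (xmon l) 1 * v k) (idx n)"

text \<open>Degree \<open>t\<close> of the direct sum of the R(-d), with d running through
  \<open>ds\<close>; the padding by zero matches \<open>free_module\<close>.\<close>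

definition FM :: "nat \<Rightarrow> int list \<Rightarrow> int \<Rightarrow> (nat \<Rightarrow> 'k::zero mpoly) set" where
  "FM n ds t = {v. \<forall>k. if k < length ds then v k \<in> hpolys n (t - ds ! k) else v k = 0}"

lemma FM_component: "v \<in> FM n ds t \<Longrightarrow> k < length ds \<Longrightarrow> v k \<in> hpolys n (t - ds ! k)"
  by (auto simp: FM_def dest: spec[of _ k])

lemma length_fops [simp]: "length (fops n) = n" and length_pops [simp]: "length (pops n) = n"
  by (simp_all add: fops_def pops_def)

lemma pops_eq: "pops n = map (\<lambda>l. (*) (single (xmon l) 1)) (idx n)"
  by (simp add: pops_def mops_def o_def)

lemma commuting_pops: "commuting_ops (pops n)"
  unfolding pops_def by (rule commuting_mops)

lemma graded_hpolys: "graded_submodule (pops n) (hpolys n)"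
  unfolding pops_def hpolys_def by (rule pring.graded_mmod)

lemma commuting_fops: "commuting_ops (fops n)"
  by (auto simp: commuting_ops_def fops_def Modules.additive_def algebra_simps fun_eq_iff)

lemma graded_FM:
  "graded_submodule (fops n) (FM n ds :: int \<Rightarrow> (nat \<Rightarrow> 'k::comm_ring_1 mpoly) set)"
  unfolding graded_submodule_def
proof (intro allI conjI ballI)
  note g = graded_submoduleD[OF graded_hpolys]
  fix t
  show "(0 :: nat \<Rightarrow> 'k mpoly) \<in> FM n ds t" by (auto simp: FM_def g(1))
  fix x :: "nat \<Rightarrow> 'k mpoly" assume x: "x \<in> FM n ds t"
  show "x - y \<in> FM n ds t" if "y \<in> FM n ds t" for y
    using x that by (auto simp: FM_def intro: g(2))
  show "X x \<in> FM n ds (t + 1)" if X: "X \<in> set (fops n)" for X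
  proof -
    obtain l where l: "l \<in> {1..n}" "X = (\<lambda>v k. single (xmon l) 1 * v k)"
      using X by (auto simp: fops_def)
    have "single (xmon l) 1 * p \<in> hpolys n (s + 1)" if "p \<in> hpolys n s"
      for p :: "'k mpoly" and s
      using g(5)[of "(*) (single (xmon l) 1)" n p s] that l by (simp add: pops_eq)
    from this[of _ "t - ds ! _"] show ?thesis
      using x by (auto simp: FM_def l algebra_simps)
  qed
qed

lemma kdiff_component: "kdiff (pops n) (\<lambda>w. c w k) w = kdiff (fops n) c w k"
  using kdiff_hom[of "\<lambda>v. v k" "fops n" "pops n" c w]
  by (simp add: Modules.additive_def fops_def pops_eq list_all2_conv_all_nth)

lemma kexact_FM_iff_components:
  "kexact (fops n) (FM n ds :: int \<Rightarrow> (nat \<Rightarrow> 'a::comm_ring_1 mpoly) set) i t \<longleftrightarrow>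
    (\<forall>k<length ds. kexact (pops n) (hpolys n :: int \<Rightarrow> ('a mpoly) set) i (t - ds ! k))"
proof (intro iffI allI impI)
  fix k assume ex: "kexact (fops n) (FM n ds :: int \<Rightarrow> (nat \<Rightarrow> 'a mpoly) set) i t" and k: "k < length ds"
  note g = graded_submoduleD[OF graded_hpolys]
  show "kexact (pops n) (hpolys n :: int \<Rightarrow> ('a mpoly) set) i (t - ds ! k)"
    unfolding kexact_def length_pops
  proof (intro ballI impI)
    fix c :: "bool list \<Rightarrow> 'a mpoly"
    assume c: "c \<in> kspace n (hpolys n) i (t - ds ! k)" and dc: "kdiff (pops n) c = 0"
    define e where "e = (\<lambda>(p :: 'a mpoly) k'. if k' = k then p else 0)"
    have "(\<lambda>w. e (c w)) \<in> kspace n (FM n ds) i t"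
      using c k unfolding kspace_def by (auto simp: FM_def e_def fun_eq_iff g(1))
    moreover have "kdiff (fops n) (\<lambda>w. e (c w)) w = e (kdiff (pops n) c w)" for w
      by (rule kdiff_hom)
        (auto simp: Modules.additive_def fops_def pops_eq list_all2_conv_all_nth e_def fun_eq_iff)
    then have "kdiff (fops n) (\<lambda>w. e (c w)) = 0" using dc by (auto simp: e_def fun_eq_iff)
    ultimately obtain b where b: "b \<in> kspace n (FM n ds) (Suc i) (t - 1)"
      "kdiff (fops n) b = (\<lambda>w. e (c w))"
      using ex unfolding kexact_def length_fops by blast
    have "(\<lambda>w. b w k) \<in> kspace n (hpolys n) (Suc i) (t - ds ! k - 1)"
    proof -
      have "v k \<in> hpolys n (t - ds ! k - 1)" if "v \<in> FM n ds (t - 1)" for v :: "nat \<Rightarrow> 'a mpoly"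
        using FM_component[OF that k] by (simp add: algebra_simps)
      then show ?thesis using b(1) unfolding kspace_def by auto
    qed
    moreover have "kdiff (pops n) (\<lambda>w. b w k) = c"
    proof
      fix w
      show "kdiff (pops n) (\<lambda>w. b w k) w = c w" unfolding kdiff_component b by (simp add: e_def)
    qed
    ultimately show "\<exists>b\<in>kspace n (hpolys n) (Suc i) (t - ds ! k - 1). kdiff (pops n) b = c" by blast
  qed
next
  assume ex: "\<forall>k<length ds. kexact (pops n) (hpolys n :: int \<Rightarrow> ('a mpoly) set) i (t - ds ! k)"
  show "kexact (fops n) (FM n ds :: int \<Rightarrow> (nat \<Rightarrow> 'a mpoly) set) i t"
    unfolding kexact_def length_fops
  proof (intro ballI impI)
    fix c :: "bool list \<Rightarrow> nat \<Rightarrow> 'a mpoly"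
    assume c: "c \<in> kspace n (FM n ds) i t" and dc: "kdiff (fops n) c = 0"
    have "\<exists>b. k < length ds \<longrightarrow> b \<in> kspace n (hpolys n) (Suc i) (t - ds ! k - 1) \<and>
        kdiff (pops n) b = (\<lambda>w. c w k)" for k
    proof (cases "k < length ds")
      case True
      have "(\<lambda>w. c w k) \<in> kspace n (hpolys n) i (t - ds ! k)"
        using c unfolding kspace_def by (auto intro: FM_component[OF _ True])
      moreover have "kdiff (pops n) (\<lambda>w. c w k) = 0"
      proof
        fix w
        show "kdiff (pops n) (\<lambda>w. c w k) w = 0 w" unfolding kdiff_component dc by simp
      qed
      ultimately show ?thesis using ex True unfolding kexact_def length_pops by blast
    qed simp
    then obtain B where B: "\<And>k. k < length ds \<Longrightarrow> B k \<in> kspace n (hpolys n) (Suc i) (t - ds ! k - 1)"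
      "\<And>k. k < length ds \<Longrightarrow> kdiff (pops n) (B k) = (\<lambda>w. c w k)"
      by metis
    define b where "b = (\<lambda>w k. if k < length ds then B k w else 0)"
    have "b \<in> kspace n (FM n ds) (Suc i) (t - 1)"
    proof -
      have "B k w \<in> hpolys n (t - 1 - ds ! k)" if "k < length ds" "length w = n" "trues w = Suc i" for k w
      proof -
        have "B k w \<in> hpolys n (t - ds ! k - 1)"
          using B(1)[OF that(1)] that(2,3) unfolding kspace_def by auto
        moreover have "t - ds ! k - 1 = t - 1 - ds ! k" by simp
        ultimately show ?thesis by (simp only:)
      qed
      moreover have "B k w = 0" if "k < length ds" "\<not> (length w = n \<and> trues w = Suc i)" for k w
        using B(1)[OF that(1)] that(2) unfolding kspace_def by auto
      ultimately show ?thesis unfolding kspace_def by (auto simp: FM_def b_def fun_eq_iff)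
    qed
    moreover have "kdiff (fops n) b w k = c w k" for w k
    proof (cases "k < length ds")
      case True
      then show ?thesis
        unfolding kdiff_component[symmetric] using B(2)[OF True] by (simp add: b_def fun_eq_iff)
    next
      case False
      have "kdiff (pops n) (0 :: bool list \<Rightarrow> 'a mpoly) w = 0"
        by (simp only: Modules.additive.zero[OF commuting_ops_additive_kdiff[OF commuting_pops]]
            zero_fun_apply)
      moreover have "c w k = 0"
        using c False unfolding kspace_def by (auto simp: FM_def dest!: spec[of _ w] split: if_splits)
      moreover have "(\<lambda>w. b w k) = 0" using False by (auto simp: b_def)
      ultimately show ?thesis unfolding kdiff_component[symmetric] by (simp only:)
    qed
    ultimately show "\<exists>b\<in>kspace n (FM n ds) (Suc i) (t - 1). kdiff (fops n) b = c"
      by (intro bexI[of _ b]) (auto simp: fun_eq_iff)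
  qed
qed

text \<open>Each basis element contributes one copy of the class of the field, moved to its own
  degree.\<close>

lemma kexact_FM:
  "kexact (fops n) (FM n ds :: int \<Rightarrow> (nat \<Rightarrow> 'k::field mpoly) set) i t \<longleftrightarrow> i \<noteq> 0 \<or> t \<notin> set ds"
  unfolding kexact_FM_iff_components by (auto simp: kexact_hpolys in_set_conv_nth)

lemma lookup_opspan_fops:
  assumes "v \<in> opspan (fops n) N s"
  shows "lookup (v k) 0 = 0"
proof -
  have "lookup (single (xmon l) (1::'a) * p) 0 = 0" for l p
  proof (rule lookup_single_mult(2))
    show "\<nexists>r. 0 = xmon l + r"
    proof
      assume "\<exists>r. 0 = xmon l + r"
      then obtain r where "0 = xmon l + r" by blast
      then have "mon_degree 0 = mon_degree (xmon l) + mon_degree r" by (metis mon_degree_add)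
      then show False by (simp add: xmon_def)
    qed
  qed
  then have "v \<in> opspan (map (\<lambda>l v k. single (xmon l) 1 * v k) ls) N s \<Longrightarrow>
      lookup (v k) 0 = 0" for ls
    by (induction ls arbitrary: v) (auto simp: lookup_add)
  then show ?thesis using assms by (simp add: fops_def)
qed

text \<open>In degree \<open>s\<close> the set \<open>N\<close> is the product of the
  \<open>P k\<close>, so witnesses found in each coordinate separately can be collected into one
  vector per variable.\<close>

lemma opspan_components:
  fixes N :: "int \<Rightarrow> (nat \<Rightarrow> 'k::comm_ring_1 mpoly) set"
  assumes "\<And>v. v \<in> N s \<longleftrightarrow> (\<forall>k. v k \<in> P k s)"
    and "\<And>k. v k \<in> opspan (pops n) (P k) s"
  shows "v \<in> opspan (fops n) N s"
proof -
  have "(\<And>k. v k \<in> opspan (map (\<lambda>l. (*) (single (xmon l) 1)) ls) (P k) s) \<Longrightarrow>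
    v \<in> opspan (map (\<lambda>l v k. single (xmon l) 1 * v k) ls) N s" for ls
  proof (induction ls arbitrary: v)
    case Nil
    then show ?case by (auto simp: fun_eq_iff)
  next
    case (Cons l ls)
    have "\<forall>k. \<exists>u x. v k = single (xmon l) 1 * u + x \<and> u \<in> P k s \<and>
        x \<in> opspan (map (\<lambda>l. (*) (single (xmon l) 1)) ls) (P k) s"
      using Cons.prems by fastforce
    then obtain u x where ux: "\<And>k. v k = single (xmon l) 1 * u k + x k" "\<And>k. u k \<in> P k s"
        "\<And>k. x k \<in> opspan (map (\<lambda>l. (*) (single (xmon l) 1)) ls) (P k) s"
      by metis
    have "x \<in> opspan (map (\<lambda>l v k. single (xmon l) 1 * v k) ls) N s"
      by (rule Cons.IH[OF ux(3)])
    moreover have "u \<in> N s" using ux(2) assms(1) by blast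
    moreover have "v = (\<lambda>k. single (xmon l) 1 * u k) + x" using ux(1) by auto
    ultimately show ?case unfolding list.map opspan.simps by blast
  qed
  then show ?thesis using assms(2) by (simp add: fops_def pops_eq)
qed

lemma hpolys_zero_degree:
  assumes "p \<in> hpolys n 0"
  shows "p = single 0 (lookup p 0)"
proof (rule poly_mapping_eqI)
  fix u
  show "lookup p u = lookup (single 0 (lookup p 0)) u"
  proof (cases "u = 0")
    case False
    then have "u \<notin> keys p"
      using assms mon_degree_eq_0_iff by (auto simp: hpolys_def mmod_def)
    then show ?thesis using False by (simp add: in_keys_iff lookup_single)
  qed simp
qed

text \<open>Coordinates of nonzero degree are multiples of the variables by exactness in homological
  degree 0; a coordinate of degree 0 equals its constant term. Together with
  \<open>lookup_opspan_fops\<close> this expresses minimality through constant terms.\<close>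

lemma in_opspan_fops:
  fixes v :: "nat \<Rightarrow> 'k::field mpoly"
  assumes "v \<in> FM n ds t" "\<And>k. lookup (v k) 0 = 0"
  shows "v \<in> opspan (fops n) (FM n ds) (t - 1)"
proof (rule opspan_components)
  let ?P = "\<lambda>k s. if k < length ds then hpolys n (s - ds ! k) else {0 :: 'k mpoly}"
  show "v \<in> FM n ds (t - 1) \<longleftrightarrow> (\<forall>k. v k \<in> ?P k (t - 1))" for v
    by (auto simp: FM_def)
  fix k
  note g = graded_submoduleD[OF graded_hpolys]
  have add: "\<And>X. X \<in> set (pops n) \<Longrightarrow> Modules.additive X"
    using commuting_pops unfolding commuting_ops_def by auto
  have z: "0 \<in> opspan (pops n) (?P k) (t - 1)"
    by (rule opspan_zero[OF add]) (auto simp: g(1))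
  show "v k \<in> opspan (pops n) (?P k) (t - 1)"
  proof (cases "k < length ds \<and> t \<noteq> ds ! k")
    case True
    then have "v k \<in> hpolys n (t - ds ! k)" using assms(1) by (auto simp: FM_def)
    moreover have "kexact (pops n) (hpolys n :: int \<Rightarrow> ('k mpoly) set) 0 (t - ds ! k)"
      using True by (simp add: kexact_hpolys)
    ultimately have "v k \<in> opspan (pops n) (hpolys n) (t - ds ! k - 1)"
      unfolding kexact_0_iff[OF commuting_pops] by auto
    moreover have "opspan Xs (?P k) (t - 1) = opspan Xs (hpolys n) (t - ds ! k - 1)" for Xs
      using True by (induction Xs) (auto simp: algebra_simps)
    ultimately show ?thesis by simp
  next
    case False
    have "v k = 0"
    proof (cases "k < length ds")
      case True
      then have "v k \<in> hpolys n 0" using assms(1) False by (auto simp: FM_def dest: spec[of _ k])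
      then show ?thesis using hpolys_zero_degree assms(2) by (metis single_zero)
    qed (use assms(1) in \<open>auto simp: FM_def\<close>)
    then show ?thesis using z by simp
  qed
qed

section \<open>Minimal generators\<close>

text \<open>A basis of the quotient of \<open>Z\<close> by \<open>W\<close>, given through
  representatives: a basis of \<open>W\<close> is extended to one of \<open>Z\<close> and the added
  vectors are kept.\<close>

lemma (in vector_space) complement_basis_exists:
  assumes "subspace W" "subspace Z" "W \<subseteq> Z" "Z \<subseteq> span E" "finite E"
  shows "\<exists>B. finite B \<and> B \<subseteq> Z \<and> (\<forall>z\<in>Z. \<exists>c. z - (\<Sum>b\<in>B. scale (c b) b) \<in> W) \<and>
    (\<forall>c. (\<Sum>b\<in>B. scale (c b) b) \<in> W \<longrightarrow> (\<forall>b\<in>B. c b = 0))"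
proof -
  obtain B0 where B0: "B0 \<subseteq> W" "independent B0" "W \<subseteq> span B0"
    by (rule maximal_independent_subset[of W])
  obtain B1 where B1: "B0 \<subseteq> B1" "B1 \<subseteq> Z" "independent B1" "Z \<subseteq> span B1"
    using maximal_independent_subset_extend[of B0 Z] B0 assms(3) by blast
  have fin: "finite B1"
    using independent_span_bound[OF assms(5) B1(3)] B1(2) assms(4) by auto
  have fin0: "finite B0" and finB: "finite (B1 - B0)" using fin B1(1) finite_subset by auto
  show ?thesis
  proof (intro exI[of _ "B1 - B0"] conjI ballI allI impI)
    fix z assume "z \<in> Z"
    then obtain c where c: "z = (\<Sum>b\<in>B1. scale (c b) b)"
      using B1(4) span_finite[OF fin] by auto
    have "(\<Sum>b\<in>B1. scale (c b) b) = (\<Sum>b\<in>B1 - B0. scale (c b) b) + (\<Sum>b\<in>B0. scale (c b) b)"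
      by (rule sum.subset_diff[OF B1(1) fin])
    moreover have "(\<Sum>b\<in>B0. scale (c b) b) \<in> W"
      by (intro subspace_sum[OF assms(1)] subspace_scale[OF assms(1)]) (use B0 in auto)
    ultimately show "\<exists>c. z - (\<Sum>b\<in>B1 - B0. scale (c b) b) \<in> W" using c by (intro exI[of _ c]) simp
  next
    fix c b assume W: "(\<Sum>b\<in>B1 - B0. scale (c b) b) \<in> W" and b: "b \<in> B1 - B0"
    then obtain d where d: "(\<Sum>b\<in>B1 - B0. scale (c b) b) = (\<Sum>b\<in>B0. scale (d b) b)"
      using B0(3) span_finite[OF fin0] by auto
    \<comment> \<open>The relation modulo \<open>W\<close> becomes a genuine relation in the basis
      \<open>B1\<close>, the combination from \<open>W\<close> being moved over with a minus
      sign.\<close>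
    define e where "e = (\<lambda>b. if b \<in> B0 then - d b else c b)"
    have "(\<Sum>b\<in>B1. scale (e b) b) = (\<Sum>b\<in>B1 - B0. scale (e b) b) + (\<Sum>b\<in>B0. scale (e b) b)"
      by (rule sum.subset_diff[OF B1(1) fin])
    also have "(\<Sum>b\<in>B1 - B0. scale (e b) b) = (\<Sum>b\<in>B1 - B0. scale (c b) b)"
      by (intro sum.cong) (auto simp: e_def)
    also have "(\<Sum>b\<in>B0. scale (e b) b) = - (\<Sum>b\<in>B0. scale (d b) b)"
      by (simp add: e_def sum_negf)
    finally have "(\<Sum>b\<in>B1. scale (e b) b) = 0" using d by simp
    then have "e b = 0" using independentD[OF B1(3) fin order_refl] b by blast
    then show "c b = 0" using b by (simp add: e_def)
  qed (use B1 finB in auto)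
qed

lemma sum_fun_app: "sum f A j = (\<Sum>a\<in>A. f a j :: 'z::comm_monoid_add)"
  by (induction A rule: infinite_finite_induct) auto

definition pscale :: "'k::comm_ring_1 \<Rightarrow> (nat \<Rightarrow> 'k mpoly) \<Rightarrow> nat \<Rightarrow> 'k mpoly" where
  "pscale c v = (\<lambda>k. single 0 c * v k)"

interpretation pvec: vector_space "pscale :: 'k::field \<Rightarrow> _"
  by unfold_locales
    (auto simp: pscale_def fun_eq_iff algebra_simps single_add mult_single simp flip: mult.assoc)

lemma finite_mons_degree: "finite {u \<in> mons n. mon_degree u = d}"
proof (rule finite_imageD)
  let ?f = "\<lambda>u. map (lookup u) (idx n)"
  have "lookup u l \<le> mon_degree u" for u l
  proof -
    have "mon_degree u = (\<Sum>i\<in>insert l (keys u). lookup u i)"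
      by (rule mon_degree_eq_sum) auto
    also have "\<dots> \<ge> lookup u l"
      by (subst sum.insert_remove) auto
    finally show ?thesis .
  qed
  then have "?f ` {u \<in> mons n. mon_degree u = d} \<subseteq> {xs. set xs \<subseteq> {..d} \<and> length xs = n}" by auto
  then show "finite (?f ` {u \<in> mons n. mon_degree u = d})"
    by (rule finite_subset) (simp add: finite_lists_length_eq)
  show "inj_on ?f {u \<in> mons n. mon_degree u = d}"
  proof (rule inj_onI)
    fix u v assume u: "u \<in> {u \<in> mons n. mon_degree u = d}" and v: "v \<in> {u \<in> mons n. mon_degree u = d}"
      and eq: "?f u = ?f v"
    show "u = v"
    proof (rule poly_mapping_eqI)
      fix k
      show "lookup u k = lookup v k"
      proof (cases "k \<in> {1..n}")
        case True then show ?thesis using eq by auto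
      next
        case False
        then have "k \<notin> keys u" "k \<notin> keys v"
          using u v unfolding mons_def by blast+
        then show ?thesis by (simp add: in_keys_iff)
      qed
    qed
  qed
qed

text \<open>Finitely many monomials have a given degree; placed on the basis elements they form the
  spanning set, which makes the number of generators needed in one degree finite.\<close>

lemma FM_finite_dim:
  "\<exists>E. finite E \<and> FM n ds t \<subseteq> pvec.span (E :: (nat \<Rightarrow> 'k::field mpoly) set)"
proof -
  define e where "e = (\<lambda>(k::nat) u (k'::nat). if k' = k then single u (1::'k) else 0 :: 'k mpoly)"
  define E where "E = (\<Union>k<length ds. e k ` {u \<in> mons n. mon_degree u = nat (t - ds ! k)})"
  have "finite E" unfolding E_def using finite_mons_degree by auto
  moreover have "v \<in> pvec.span E" if v: "v \<in> FM n ds t" for v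
  proof -
    have "v = (\<Sum>k<length ds. \<Sum>u\<in>keys (v k). pscale (lookup (v k) u) (e k u))"
      (is "v = ?r")
    proof
      fix j
      have "?r j = (\<Sum>k<length ds. \<Sum>u\<in>keys (v k).
          if k = j then single u (lookup (v k) u) else 0)"
        unfolding sum_fun_app by (intro sum.cong refl)
          (auto simp: e_def pscale_def mult_single intro!: sum.cong)
      also have "\<dots> = (\<Sum>k<length ds. if k = j then v k else 0)"
      proof (intro sum.cong refl)
        fix k
        have "(\<Sum>u\<in>keys (v k). single u (lookup (v k) u)) = v k"
          by (rule poly_mapping_eqI)
            (simp add: lookup_sum lookup_single when_def in_keys_iff)
        then show "(\<Sum>u\<in>keys (v k).
          if k = j then single u (lookup (v k) u) else 0) = (if k = j then v k else 0)"
          by auto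
      qed
      also have "\<dots> = v j" using v by (auto simp: FM_def dest: spec[of _ j])
      finally show "v j = ?r j" ..
    qed
    also have "\<dots> \<in> pvec.span E"
    proof (intro pvec.span_sum pvec.span_scale pvec.span_base)
      fix k u assume k: "k \<in> {..<length ds}" and u: "u \<in> keys (v k)"
      then have "v k \<in> hpolys n (t - ds ! k)" using FM_component[OF v] by simp
      then have "u \<in> mons n" "int (mon_degree u) = t - ds ! k"
        using u by (auto simp: hpolys_def mmod_def)
      then show "e k u \<in> E" using k unfolding E_def by force
    qed
    finally show ?thesis .
  qed
  ultimately show ?thesis by blast
qed

lemma hpolys_neg: "s < 0 \<Longrightarrow> p \<in> hpolys n s \<Longrightarrow> p = 0"
proof -
  assume "s < 0" "p \<in> hpolys n s"
  then have "u \<notin> keys p" for u by (auto simp: hpolys_def mmod_def)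
  then show "p = 0" by (intro poly_mapping_eqI) (simp add: in_keys_iff)
qed

lemma FM_low: "\<forall>d\<in>set ds. t < d \<Longrightarrow> v \<in> FM n ds t \<Longrightarrow> v = 0"
proof
  fix k assume *: "\<forall>d\<in>set ds. t < d" "v \<in> FM n ds t"
  show "v k = 0 k"
  proof (cases "k < length ds")
    case True
    then show ?thesis using hpolys_neg[of "t - ds ! k" "v k" n] FM_component[OF *(2) True] * by simp
  next
    case False
    then show ?thesis using *(2) by (auto simp: FM_def)
  qed
qed

lemma additive_mat_apply: "Modules.additive (mat_apply r s (M :: nat \<Rightarrow> nat \<Rightarrow> 'r::ring))"
  by (auto simp: Modules.additive_def mat_apply_def fun_eq_iff algebra_simps sum.distrib)

lemma mat_apply_smult:
  "mat_apply r s (M :: nat \<Rightarrow> nat \<Rightarrow> 'r::comm_ring) (\<lambda>k. x * v k) = (\<lambda>k. x * mat_apply r s M v k)"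
  by (auto simp: mat_apply_def fun_eq_iff algebra_simps sum_distrib_left)

lemma mat_apply_fops:
  "list_all2 (\<lambda>X Y. \<forall>v. mat_apply r s M (X v) = Y (mat_apply r s M v)) (fops n) (fops n)"
  by (auto simp: fops_def list_all2_conv_all_nth mat_apply_smult)

definition scalar_closed :: "(int \<Rightarrow> (nat \<Rightarrow> 'k::comm_ring_1 mpoly) set) \<Rightarrow> bool" where
  "scalar_closed Z \<longleftrightarrow> (\<forall>t c. \<forall>v\<in>Z t. pscale c v \<in> Z t)"

lemma subspace_graded:
  assumes "graded_submodule (fops n) Z" "scalar_closed Z"
  shows "pvec.subspace (Z t)"
  using graded_submoduleD[OF assms(1)] assms(2)
  by (auto simp: pvec.subspace_def scalar_closed_def)

lemma subspace_opspan:
  fixes Z :: "int \<Rightarrow> (nat \<Rightarrow> 'k::field mpoly) set"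
  assumes "graded_submodule (fops n) Z" "scalar_closed Z"
  shows "pvec.subspace (opspan (fops n) Z s)"
  unfolding pvec.subspace_def
proof (intro conjI ballI allI)
  note add = commuting_fops[of n, unfolded commuting_ops_def, THEN conjunct1, rule_format]
  show z: "0 \<in> opspan (fops n) Z s"
    by (rule opspan_zero[OF add]) (use graded_submoduleD(1)[OF assms(1)] in auto)
  fix x assume x: "x \<in> opspan (fops n) Z s"
  show "x + y \<in> opspan (fops n) Z s" if y: "y \<in> opspan (fops n) Z s" for y
  proof -
    have *: "0 - y \<in> opspan (fops n) Z s"
      by (rule opspan_diff[OF add graded_submoduleD(2)[OF assms(1)] z y])
    have "x - (0 - y) \<in> opspan (fops n) Z s"
      by (rule opspan_diff[OF add graded_submoduleD(2)[OF assms(1)] x *])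
    then show ?thesis by simp
  qed
  fix c
  show "pscale c x \<in> opspan (fops n) Z s"
  proof (rule opspan_hom[OF _ _ _ x])
    show "Modules.additive (pscale c)" by (simp add: Modules.additive_def pvec.scale_right_distrib)
    show "list_all2 (\<lambda>X Y. \<forall>v. pscale c (X v) = Y (pscale c v)) (fops n) (fops n)"
      by (auto simp: fops_def list_all2_conv_all_nth pscale_def algebra_simps)
    show "pscale c ` Z s \<subseteq> Z s" using assms(2) by (auto simp: scalar_closed_def)
  qed
qed

lemma opspan_subset:
  assumes "graded_submodule Xs Z"
  shows "opspan Xs Z (t - 1) \<subseteq> Z t"
proof
  fix x assume "x \<in> opspan Xs Z (t - 1)"
  moreover have "x \<in> opspan Ys Z (t - 1) \<Longrightarrow> set Ys \<subseteq> set Xs \<Longrightarrow> x \<in> Z t" for Ys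
  proof (induction Ys arbitrary: x)
    case Nil
    then show ?case using graded_submoduleD(1)[OF assms] by auto
  next
    case (Cons Y Ys)
    then obtain u v where "x = Y u + v" "u \<in> Z (t - 1)" "v \<in> Z t" by auto
    then show ?case
      using graded_submoduleD(4)[OF assms] graded_submoduleD(5)[OF assms, of Y u "t - 1"] Cons.prems by auto
  qed
  ultimately show "x \<in> Z t" by blast
qed

text \<open>Graded Nakayama: in each degree, representatives of a basis of \<open>Z\<close> modulo
  the multiples of the variables serve as generators. Generation follows by induction on the degree,
  and independence forces the kernel into the multiples of the variables. The hypothesis
  \<open>finT\<close> leaves finitely many degrees with generators.\<close>

lemma minimal_cover_exists:
  fixes Z :: "int \<Rightarrow> (nat \<Rightarrow> 'k::field mpoly) set"
  assumes sub: "graded_submodule (fops n) Z" and sc: "scalar_closed Z" and ZF: "\<And>t. Z t \<subseteq> FM n ds t"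
    and finT: "finite {t. \<not> kexact (fops n) Z 0 t}"
  obtains ds' M where "set ds' \<subseteq> {t. \<not> kexact (fops n) Z 0 t}"
    "\<And>l. l < length ds' \<Longrightarrow> (\<lambda>k. M k l) \<in> Z (ds' ! l)"
    "\<And>t. mat_apply (length ds) (length ds') M ` FM n ds' t = Z t"
    "\<And>t v. v \<in> FM n ds' t \<Longrightarrow> mat_apply (length ds) (length ds') M v = 0 \<Longrightarrow>
      v \<in> opspan (fops n) (FM n ds') (t - 1)"
proof -
  define W where "W = (\<lambda>t. opspan (fops n) Z (t - 1))"
  define T where "T = {t. \<not> kexact (fops n) Z 0 t}"
  have WZ: "W t \<subseteq> Z t" for t unfolding W_def by (rule opspan_subset[OF sub])
  define P where "P = (\<lambda>t B. finite B \<and> B \<subseteq> Z t \<and> (\<forall>z\<in>Z t. \<exists>c. z - (\<Sum>b\<in>B. pscale (c b) b) \<in> W t) \<and>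
    (\<forall>c. (\<Sum>b\<in>B. pscale (c b) b) \<in> W t \<longrightarrow> (\<forall>b\<in>B. c b = 0)))"
  have "\<exists>B. P t B" for t
  proof -
    obtain E where "finite E" "FM n ds t \<subseteq> pvec.span (E :: (nat \<Rightarrow> 'k::field mpoly) set)"
      using FM_finite_dim[of n ds t] by auto
    then show ?thesis using ZF[of t] unfolding P_def
      by (intro pvec.complement_basis_exists[OF _ subspace_graded[OF sub sc] WZ])
        (auto simp: W_def subspace_opspan[OF sub sc])
  qed
  then obtain B where PB: "\<And>t. P t (B t)" by metis
  note PB' = PB[unfolded P_def]
  have B: "finite (B t)" "B t \<subseteq> Z t"
    "z \<in> Z t \<Longrightarrow> \<exists>c. z - (\<Sum>b\<in>B t. pscale (c b) b) \<in> W t"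
    "(\<Sum>b\<in>B t. pscale (c b) b) \<in> W t \<Longrightarrow> b \<in> B t \<Longrightarrow> c b = 0" for t z c b
  proof -
    show "finite (B t)" by (rule PB'[of t, THEN conjunct1])
    show "B t \<subseteq> Z t" by (rule PB'[of t, THEN conjunct2, THEN conjunct1])
    show "z \<in> Z t \<Longrightarrow> \<exists>c. z - (\<Sum>b\<in>B t. pscale (c b) b) \<in> W t"
      by (rule PB'[of t, THEN conjunct2, THEN conjunct2, THEN conjunct1, THEN bspec])
    show "(\<Sum>b\<in>B t. pscale (c b) b) \<in> W t \<Longrightarrow> b \<in> B t \<Longrightarrow> c b = 0"
      by (rule PB'[of t, THEN conjunct2, THEN conjunct2, THEN conjunct2, THEN spec, THEN mp, THEN bspec])
  qed
  \<comment> \<open>Exactness at \<open>t\<close> puts all of \<open>Z t\<close> into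
    \<open>W t\<close>, where a nonempty set cannot be independent modulo
    \<open>W t\<close>.\<close>
  have B_empty: "B t = {}" if "t \<notin> T" for t
  proof (rule ccontr)
    assume "B t \<noteq> {}"
    then obtain b where b: "b \<in> B t" by auto
    have "Z t \<subseteq> W t" using that unfolding T_def W_def kexact_0_iff[OF commuting_fops] by auto
    moreover have "(\<Sum>x\<in>B t. pscale (if x = b then 1 else 0) x) = b"
    proof -
      have "(\<Sum>x\<in>B t. pscale (if x = b then 1 else 0) x) = (\<Sum>x\<in>B t. if x = b then b else 0)"
        by (intro sum.cong) auto
      also have "\<dots> = b" using b B(1)[of t] by simp
      finally show ?thesis .
    qed
    ultimately have "(\<Sum>x\<in>B t. pscale (if x = b then 1 else 0) x) \<in> W t" using b B(2) by auto
    from B(4)[OF this b] show False by simp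
  qed
  \<comment> \<open>Each generator is paired with its degree, so that one list yields both the
    degrees \<open>ds'\<close> and the columns of \<open>M\<close>.\<close>
  obtain xs where xs: "distinct xs" "set xs = (SIGMA t:T. B t)"
    using finite_distinct_list[of "SIGMA t:T. B t"] finT B(1) unfolding T_def by auto
  define ds' where "ds' = map fst xs"
  define M where "M = (\<lambda>k l. snd (xs ! l) k)"
  define d where "d = mat_apply (length ds) (length ds') M"
  have len: "length ds' = length xs" by (simp add: ds'_def)
  have xsl: "fst (xs ! l) \<in> T" "snd (xs ! l) \<in> B (fst (xs ! l))" if "l < length xs" for l
    using nth_mem[OF that] xs(2) by auto
  have M_Z: "(\<lambda>k. M k l) \<in> Z (ds' ! l)" if "l < length ds'" for l
    using xsl[of l] B(2) that by (auto simp: M_def ds'_def)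
  have M0: "M k l = 0" if "l < length ds'" "\<not> k < length ds" for k l
  proof -
    have "(\<lambda>k. M k l) \<in> FM n ds (ds' ! l)" using M_Z[OF that(1)] ZF by blast
    then show ?thesis using that(2) by (auto simp: FM_def dest: spec[of _ k])
  qed
  have d_eq: "d v k = (\<Sum>l<length xs. M k l * v l)" for v k
    unfolding d_def mat_apply_def len using M0 len by (auto intro!: sum.neutral)
  note d_add = additive_mat_apply[of "length ds" "length ds'" M, folded d_def]
  note d_fops = mat_apply_fops[of "length ds" "length ds'" M n, folded d_def]
  \<comment> \<open>Constant coefficients \<open>c\<close> on the generators of degree
    \<open>t\<close>; \<open>d\<close> sends this vector to the corresponding combination of
    \<open>B t\<close>.\<close>
  define v0 where "v0 = (\<lambda>t c l. if l < length xs \<and> fst (xs ! l) = t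
      then single 0 (c (snd (xs ! l))) else (0 :: 'k mpoly))"
  have v0_FM: "v0 t c \<in> FM n ds' t" for t c
    by (auto simp: FM_def v0_def ds'_def hpolys_def mmod_def mons_def)
  have d_v0: "d (v0 t c) = (\<Sum>b\<in>B t. pscale (c b) b)" for t c
  proof
    fix k
    let ?g = "\<lambda>x. if fst x = t then single 0 (c (snd x)) * snd x k else 0"
    have "d (v0 t c) k = (\<Sum>l<length xs. ?g (xs ! l))"
      unfolding d_eq by (intro sum.cong) (auto simp: v0_def M_def mult.commute)
    also have "\<dots> = sum ?g (set xs)"
      by (rule sum.reindex_bij_betw) (rule bij_betw_nth[OF xs(1) refl refl])
    also have "\<dots> = sum ?g (Pair t ` B t)"
    proof (rule sum.mono_neutral_right)
      show "Pair t ` B t \<subseteq> set xs" using xs(2) B_empty[of t] by auto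
    next
      show "finite (set xs)" by simp
    next
      show "\<forall>i\<in>set xs - Pair t ` B t. ?g i = 0" using xs(2) by auto
    qed
    also have "\<dots> = (\<Sum>b\<in>B t. single 0 (c b) * b k)"
      by (simp add: sum.reindex inj_on_def)
    also have "\<dots> = (\<Sum>b\<in>B t. pscale (c b) b) k"
      by (simp only: sum_fun_app pscale_def)
    finally show "d (v0 t c) k = (\<Sum>b\<in>B t. pscale (c b) b) k" .
  qed
  \<comment> \<open>A vector of degree \<open>t\<close> agrees with its constant terms modulo the
    multiples of the variables, and constants can occur only at generators of degree
    \<open>t\<close>.\<close>
  have split: "\<exists>c. (\<forall>l<length xs. fst (xs ! l) = t \<longrightarrow> c (snd (xs ! l)) = lookup (v l) 0) \<and>
      v - v0 t c \<in> opspan (fops n) (FM n ds') (t - 1)" if v: "v \<in> FM n ds' t" for v t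
  proof -
    define g where "g = inv_into {..<length xs} ((!) xs)"
    have g: "g (xs ! l) = l" if "l < length xs" for l
      unfolding g_def using that xs(1) by (intro inv_into_f_f) (auto simp: inj_on_nth)
    define c where "c = (\<lambda>b. lookup (v (g (t, b))) 0)"
    have c: "c (snd (xs ! l)) = lookup (v l) 0" if "l < length xs" "fst (xs ! l) = t" for l
      using g[OF that(1)] that(2) unfolding c_def by (metis prod.collapse)
    have "lookup ((v - v0 t c) l) 0 = 0" for l
    proof (cases "l < length xs")
      case True
      then have vl: "v l \<in> hpolys n (t - fst (xs ! l))" using FM_component[OF v, of l] by (simp add: ds'_def)
      show ?thesis
      proof (cases "fst (xs ! l) = t")
        case True
        then show ?thesis using c \<open>l < length xs\<close> by (simp add: v0_def lookup_minus)
      next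
        case False
        then have "0 \<notin> keys (v l)" using vl by (auto simp: hpolys_def mmod_def)
        then show ?thesis using False by (simp add: v0_def lookup_minus in_keys_iff)
      qed
    next
      case False
      then show ?thesis using v by (auto simp: v0_def FM_def ds'_def)
    qed
    then have "v - v0 t c \<in> opspan (fops n) (FM n ds') (t - 1)"
      by (intro in_opspan_fops graded_submoduleD(2)[OF graded_FM v v0_FM])
    then show ?thesis using c by blast
  qed
  have B_Z: "(\<Sum>b\<in>B t. pscale (c b) b) \<in> Z t" for t c
    using B(2)[of t] sc by (intro graded_submodule_sum[OF sub]) (auto simp: scalar_closed_def)
  have image: "d ` FM n ds' t = Z t" for t
  proof -
    \<comment> \<open>Below \<open>t0\<close> both sides are zero, which starts the induction on the
      degree.\<close>
    define t0 where "t0 = Min (insert 0 (set ds \<union> set ds'))"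
    have low: "d ` FM n ds' t = Z t" if "t < t0" for t
    proof -
      have lt: "\<forall>x\<in>set ds. t < x" "\<forall>x\<in>set ds'. t < x"
        using that unfolding t0_def by auto
      have "v = 0" if "v \<in> Z t" for v using FM_low[OF lt(1), of v n] that ZF[of t] by auto
      then have "Z t = {0}" using graded_submoduleD(1)[OF sub, of t] by auto
      moreover have "FM n ds' t = {0 :: nat \<Rightarrow> 'k mpoly}"
        using FM_low[OF lt(2)] graded_submoduleD(1)[OF graded_FM, of n ds' t] by (intro equalityI subsetI) auto
      ultimately show ?thesis using Modules.additive.zero[OF d_add] by simp
    qed
    have "d ` FM n ds' t = Z t" if prev: "d ` FM n ds' (t - 1) = Z (t - 1)" for t
    proof (intro equalityI subsetI)
      fix z assume "z \<in> d ` FM n ds' t"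
      then obtain v where v: "v \<in> FM n ds' t" "z = d v" by auto
      obtain c where c: "v - v0 t c \<in> opspan (fops n) (FM n ds') (t - 1)" using split[OF v(1)] by auto
      have "d (v - v0 t c) \<in> opspan (fops n) Z (t - 1)"
        by (rule opspan_hom[OF d_add d_fops _ c]) (use prev in auto)
      then have "d (v - v0 t c) \<in> Z t" using WZ[of t] by (auto simp: W_def)
      then have "d (v - v0 t c) + (\<Sum>b\<in>B t. pscale (c b) b) \<in> Z t"
        by (rule graded_submoduleD(4)[OF sub _ B_Z])
      then show "z \<in> Z t" using v(2) by (simp add: Modules.additive.diff[OF d_add] d_v0)
    next
      fix z assume "z \<in> Z t"
      then obtain c where c: "z - (\<Sum>b\<in>B t. pscale (c b) b) \<in> W t" using B(3) by blast
      then obtain x where x: "x \<in> opspan (fops n) (FM n ds') (t - 1)" "d x = z - (\<Sum>b\<in>B t. pscale (c b) b)"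
        using opspan_hom_surj[OF d_add d_fops, of Z "t - 1" "FM n ds'"] prev unfolding W_def by blast
      have "d (x + v0 t c) = z" by (simp add: Modules.additive.add[OF d_add] d_v0 x)
      moreover have "x + v0 t c \<in> FM n ds' t"
        using x(1) opspan_subset[OF graded_FM] by (intro graded_submoduleD(4)[OF graded_FM _ v0_FM]) blast
      ultimately show "z \<in> d ` FM n ds' t" by blast
    qed
    then have step: "d ` FM n ds' (t + 1) = Z (t + 1)" if "d ` FM n ds' t = Z t" for t
      using that by (metis add_diff_cancel_right')
    have "d ` FM n ds' (t0 - 1 + int k) = Z (t0 - 1 + int k)" for k
    proof (induction k)
      case 0 then show ?case using low by simp
    next
      case (Suc k) then show ?case using step[of "t0 - 1 + int k"] by (simp add: algebra_simps)
    qed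
    from this[of "nat (t - (t0 - 1))"] show ?thesis
      by (cases "t < t0") (auto simp: low)
  qed
  have ker: "v \<in> opspan (fops n) (FM n ds') (t - 1)" if v: "v \<in> FM n ds' t" "d v = 0" for v t
  proof -
    obtain c where c0: "\<forall>l<length xs. fst (xs ! l) = t \<longrightarrow> c (snd (xs ! l)) = lookup (v l) 0"
      and c: "v - v0 t c \<in> opspan (fops n) (FM n ds') (t - 1)"
      using split[OF v(1)] by auto
    \<comment> \<open>With \<open>d v = 0\<close> this puts the combination of \<open>B t\<close>
      into \<open>W t\<close>; independence then removes the constant terms of
      \<open>v\<close>.\<close>
    have "d (v - v0 t c) \<in> opspan (fops n) Z (t - 1)"
      by (rule opspan_hom[OF d_add d_fops _ c]) (use image in auto)
    moreover have "d (v - v0 t c) = - (\<Sum>b\<in>B t. pscale (c b) b)"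
      using v(2) by (simp add: Modules.additive.diff[OF d_add] d_v0)
    ultimately have "(\<Sum>b\<in>B t. pscale (c b) b) \<in> W t"
      using pvec.subspace_neg[OF subspace_opspan[OF sub sc, of "t - 1"], of "- (\<Sum>b\<in>B t. pscale (c b) b)"]
      unfolding W_def by simp
    then have "c b = 0" if "b \<in> B t" for b using B(4) that by blast
    then have "v0 t c = 0" using xsl(2) by (auto simp: v0_def fun_eq_iff)
    then show ?thesis using c by simp
  qed
  have "set ds' \<subseteq> {t. \<not> kexact (fops n) Z 0 t}"
    using xs(2) unfolding ds'_def T_def by auto
  then show ?thesis using that[OF _ M_Z] image ker unfolding d_def by blast
qed

section \<open>Homogeneous components and the toric homomorphism\<close>

definition hpart :: "int \<Rightarrow> ('k::zero mpoly) \<Rightarrow> ('k mpoly)" where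
  "hpart t p = Poly_Mapping.mapp (\<lambda>u c. if int (mon_degree u) = t then c else 0) p"

lemma lookup_hpart:
  "lookup (hpart t p) u = (if int (mon_degree u) = t then lookup p u else 0)"
  by (simp add: hpart_def lookup_mapp when_def in_keys_iff)

lemma hpart_add: "hpart t (p + q) = hpart t p + hpart t (q :: 'k::comm_ring_1 mpoly)"
  by (rule poly_mapping_eqI) (simp add: lookup_hpart lookup_add)

lemma hpart_zero [simp]: "hpart t 0 = 0"
  by (rule poly_mapping_eqI) (simp add: lookup_hpart)

lemma hpart_sum: "hpart t (sum f A) = (\<Sum>x\<in>A. hpart t (f x :: 'k::comm_ring_1 mpoly))"
  by (induction A rule: infinite_finite_induct) (auto simp: hpart_add)

lemma hpart_in_hpolys: "p \<in> polys n \<Longrightarrow> hpart t p \<in> hpolys n t"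
  by (auto simp: hpolys_def mmod_def polys_def mons_def in_keys_iff lookup_hpart split: if_splits)

lemma hpart_homogeneous: "homogeneous s p \<Longrightarrow> hpart t p = (if s = t then p else 0)"
  by (rule poly_mapping_eqI) (auto simp: lookup_hpart homogeneous_def in_keys_iff)

lemma homogeneous_mult:
  fixes p q :: "'k::comm_ring_1 mpoly"
  assumes "homogeneous s p" "homogeneous t q"
  shows "homogeneous (s + t) (p * q)"
  unfolding homogeneous_def
proof
  fix u assume "u \<in> keys (p * q)"
  then obtain a b where "u = a + b" "a \<in> keys p" "b \<in> keys q"
    using keys_mult[of p q] by blast
  then show "int (mon_degree u) = s + t" using assms by (simp add: homogeneous_def mon_degree_add)
qed

lemma homogeneous_hpart: "homogeneous t (hpart t p)"
  by (auto simp: homogeneous_def in_keys_iff lookup_hpart split: if_splits)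

text \<open>A homogeneous factor shifts all degrees by \<open>d\<close>, so the other components of
  \<open>p\<close> contribute nothing in degree \<open>t\<close>.\<close>

lemma hpart_mult:
  fixes p q :: "'k::comm_ring_1 mpoly"
  assumes "homogeneous d q"
  shows "hpart t (q * p) = q * hpart (t - d) p"
proof -
  let ?p = "hpart (t - d) p"
  have "hpart t (q * (p - ?p)) = 0"
  proof (rule poly_mapping_eqI)
    fix u
    have "u \<notin> keys (q * (p - ?p))" if u: "int (mon_degree u) = t"
    proof
      assume "u \<in> keys (q * (p - ?p))"
      then obtain a b where ab: "u = a + b" "a \<in> keys q" "b \<in> keys (p - ?p)"
        using keys_mult[of q "p - ?p"] by blast
      then have "int (mon_degree a) = d" using assms by (auto simp: homogeneous_def)
      moreover have "int (mon_degree b) \<noteq> t - d"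
        using ab(3) by (auto simp: in_keys_iff lookup_minus lookup_hpart)
      ultimately show False using u ab(1) by (simp add: mon_degree_add)
    qed
    then show "lookup (hpart t (q * (p - ?p))) u = lookup 0 u"
      by (simp add: lookup_hpart in_keys_iff)
  qed
  moreover have "homogeneous t (q * ?p)"
    using homogeneous_mult[OF assms homogeneous_hpart[of "t - d" p]] by simp
  then have "hpart t (q * ?p) = q * ?p" using hpart_homogeneous by fastforce
  ultimately show ?thesis
    using hpart_add[of t "q * ?p" "q * (p - ?p)"] by (simp add: algebra_simps)
qed

definition degrees :: "('k::zero mpoly) \<Rightarrow> int set" where
  "degrees p = (\<lambda>u. int (mon_degree u)) ` keys p"

lemma sum_hpart:
  fixes p :: "'k::comm_ring_1 mpoly"
  assumes "finite T" "degrees p \<subseteq> T"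
  shows "(\<Sum>t\<in>T. hpart t p) = p"
proof (rule poly_mapping_eqI)
  fix u
  show "lookup (\<Sum>t\<in>T. hpart t p) u = lookup p u"
  proof (cases "u \<in> keys p")
    case True
    then have "int (mon_degree u) \<in> T" using assms(2) by (auto simp: degrees_def)
    then show ?thesis using assms(1) by (simp add: lookup_sum lookup_hpart)
  next
    case False
    then show ?thesis by (auto simp: lookup_sum lookup_hpart in_keys_iff intro!: sum.neutral)
  qed
qed

lemma polys_zero: "0 \<in> polys n"
  by (simp add: polys_def)

lemma polys_add: "p \<in> polys n \<Longrightarrow> q \<in> polys n \<Longrightarrow> p + q \<in> polys n"
  using Poly_Mapping.keys_add[of p q] by (auto simp: polys_def)

lemma polys_sum: "(\<And>x. x \<in> A \<Longrightarrow> f x \<in> polys n) \<Longrightarrow> sum f A \<in> polys n"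
  by (induction A rule: infinite_finite_induct) (auto intro: polys_zero polys_add)

lemma polys_minus:
  fixes p q :: "'k::comm_ring_1 mpoly"
  shows "p \<in> polys n \<Longrightarrow> q \<in> polys n \<Longrightarrow> p - q \<in> polys n"
  using keys_diff[of p q] by (auto simp: polys_def)

lemma polys_mult:
  fixes p q :: "'k::comm_ring_1 mpoly"
  assumes "p \<in> polys n" "q \<in> polys n"
  shows "p * q \<in> polys n"
proof -
  have "keys u \<subseteq> {1..n}" if u: "u \<in> keys (p * q)" for u
  proof -
    obtain a b where "u = a + b" "a \<in> keys p" "b \<in> keys q"
      using keys_mult[of p q] u by blast
    then show ?thesis using assms mons_add[of a n b] by (auto simp: polys_def mons_def)
  qed
  then show ?thesis by (simp add: polys_def)
qed

lemma lookup_mult_0: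
  fixes p q :: "'k::comm_ring_1 mpoly"
  assumes "lookup p 0 = 0"
  shows "lookup (p * q) 0 = 0"
proof (rule ccontr)
  assume "lookup (p * q) 0 \<noteq> 0"
  then have "0 \<in> keys (p * q)" by (simp add: in_keys_iff)
  then obtain a b where ab: "0 = a + b" "a \<in> keys p"
    using keys_mult[of p q] by blast
  then have "mon_degree a + mon_degree b = 0" using mon_degree_add[of a b] by simp
  then have "a = 0" by (simp add: mon_degree_eq_0_iff)
  then show False using ab(2) assms by (simp add: in_keys_iff)
qed

section \<open>Homogeneous components of vectors\<close>

definition vpart :: "int list \<Rightarrow> int \<Rightarrow> (nat \<Rightarrow> 'k::zero mpoly) \<Rightarrow> nat \<Rightarrow> 'k mpoly" where
  "vpart ds t v = (\<lambda>k. if k < length ds then hpart (t - ds ! k) (v k) else 0)"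

lemma vpart_in_FM: "v \<in> free_module n (length ds) \<Longrightarrow> vpart ds t v \<in> FM n ds t"
  by (auto simp: vpart_def FM_def free_module_def hpart_in_hpolys)

lemma FM_free_module: "v \<in> FM n ds t \<Longrightarrow> v \<in> free_module n (length ds)"
  by (auto simp: FM_def free_module_def hpolys_iff split: if_splits)

lemma vpart_FM: "v \<in> FM n ds t \<Longrightarrow> vpart ds t v = v"
proof
  fix k assume v: "v \<in> FM n ds t"
  show "vpart ds t v k = v k"
  proof (cases "k < length ds")
    case True
    then show ?thesis using FM_component[OF v True] hpart_homogeneous
      by (fastforce simp: vpart_def hpolys_iff)
  next
    case False
    then show ?thesis using v by (auto simp: FM_def vpart_def)
  qed
qed

lemma vpart_zero: "vpart ds t (\<lambda>_. 0) = (\<lambda>_. 0)"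
  by (auto simp: vpart_def)

text \<open>The set \<open>T\<close> collects the degrees occurring in some coordinate, each shifted
  by the degree of the basis element.\<close>

lemma sum_vpart:
  fixes v :: "nat \<Rightarrow> 'k::comm_ring_1 mpoly"
  assumes "v \<in> free_module n (length ds)"
  shows "\<exists>T. finite T \<and> (\<Sum>t\<in>T. vpart ds t v) = v"
proof -
  define T where "T = (\<Union>k<length ds. (\<lambda>s. s + ds ! k) ` degrees (v k))"
  have fin: "finite T" by (auto simp: T_def degrees_def)
  have "(\<Sum>t\<in>T. vpart ds t v) k = v k" for k
  proof (cases "k < length ds")
    case True
    have "(\<Sum>t\<in>T. vpart ds t v) k = (\<Sum>t\<in>T. hpart (t - ds ! k) (v k))"
      using True by (simp only: sum_fun_app) (simp add: vpart_def)
    also have "\<dots> = (\<Sum>s\<in>(\<lambda>t. t - ds ! k) ` T. hpart s (v k))"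
      by (subst sum.reindex) (auto simp: inj_on_def)
    also have "\<dots> = v k"
      using fin True by (intro sum_hpart) (force simp: T_def)+
    finally show ?thesis .
  next
    case False
    then have "v k = 0" using assms by (auto simp: free_module_def)
    moreover have "(\<Sum>t\<in>T. vpart ds t v) k = 0"
      using False by (simp only: sum_fun_app) (simp add: vpart_def)
    ultimately show ?thesis by simp
  qed
  then show ?thesis using fin by (intro exI[of _ T]) auto
qed

text \<open>The degree of an entry is the difference of the shifts of its column and row, so the two
  shifts in the projections match. This is what lets exactness be tested degree by degree.\<close>

lemma mat_apply_vpart:
  fixes \<phi> :: "nat \<Rightarrow> nat \<Rightarrow> 'k::comm_ring_1 mpoly"
  assumes "\<And>k l. k < length ds \<Longrightarrow> l < length ds' \<Longrightarrow> homogeneous (ds' ! l - ds ! k) (\<phi> k l)"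
  shows "mat_apply (length ds) (length ds') \<phi> (vpart ds' t v) =
    vpart ds t (mat_apply (length ds) (length ds') \<phi> v)"
proof
  fix k
  show "mat_apply (length ds) (length ds') \<phi> (vpart ds' t v) k =
    vpart ds t (mat_apply (length ds) (length ds') \<phi> v) k"
  proof (cases "k < length ds")
    case True
    have "\<phi> k l * hpart (t - ds' ! l) (v l) = hpart (t - ds ! k) (\<phi> k l * v l)" if "l < length ds'" for l
      using hpart_mult[OF assms[OF True that], of "t - ds ! k" "v l"] by simp
    then show ?thesis using True by (simp add: mat_apply_def vpart_def hpart_sum)
  qed (simp add: mat_apply_def vpart_def)
qed

lemma mat_apply_free_module:
  fixes \<phi> :: "nat \<Rightarrow> nat \<Rightarrow> 'k::comm_ring_1 mpoly"
  assumes "\<And>k l. k < r \<Longrightarrow> l < s \<Longrightarrow> \<phi> k l \<in> polys n" "v \<in> free_module n s"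
  shows "mat_apply r s \<phi> v \<in> free_module n r"
  using assms by (auto simp: free_module_def mat_apply_def intro!: polys_sum polys_mult)

lemma free_module_sum:
  assumes "\<And>x. x \<in> A \<Longrightarrow> f x \<in> free_module n r"
  shows "sum f A \<in> free_module n r"
  using assms by (auto simp: free_module_def sum_fun_app intro!: polys_sum sum.neutral)

section \<open>The toric homomorphism on monomials\<close>

lemma keys_sum_singles: "(\<Sum>u\<in>keys p. single u (lookup p u)) = p"
  by (rule poly_mapping_eqI) (simp add: lookup_sum lookup_single when_def in_keys_iff)

text \<open>The exponent in the t-variables of the image of the monomial with exponent
  \<open>u\<close>.\<close>

definition evec_sum :: "(nat \<Rightarrow> nat^3) \<Rightarrow> (nat \<Rightarrow>\<^sub>0 nat) \<Rightarrow> nat^3" where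
  "evec_sum a u = (\<Sum>i\<in>keys u. lookup u i *s a i)"

lemma evec_sum_superset:
  "finite A \<Longrightarrow> keys u \<subseteq> A \<Longrightarrow> evec_sum a u = (\<Sum>i\<in>A. lookup u i *s a i)"
  unfolding evec_sum_def by (intro sum.mono_neutral_left) (auto simp: in_keys_iff vec_eq_iff)

lemma evec_sum_add: "evec_sum a (u + v) = evec_sum a u + evec_sum a v"
proof -
  let ?A = "keys u \<union> keys v"
  have "evec_sum a (u + v) = (\<Sum>i\<in>?A. lookup (u + v) i *s a i)"
    by (rule evec_sum_superset) (use Poly_Mapping.keys_add[of u v] in auto)
  also have "\<dots> = (\<Sum>i\<in>?A. lookup u i *s a i + lookup v i *s a i)"
    by (intro sum.cong) (auto simp: lookup_add vec_eq_iff algebra_simps)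
  also have "\<dots> = evec_sum a u + evec_sum a v"
    by (simp add: sum.distrib evec_sum_superset[of ?A u] evec_sum_superset[of ?A v])
  finally show ?thesis .
qed

lemma evec_sum_xmon: "evec_sum a (xmon l) = a l"
  by (simp add: evec_sum_def xmon_def vec_eq_iff)

lemma vsize_add: "vsize (x + y) = vsize x + vsize y"
  by (simp add: vsize_def sum.distrib)

lemma vsize_smult: "vsize (c *s x) = c * vsize x"
  by (simp add: vsize_def sum_distrib_left)

lemma vsize_sum: "vsize (sum f A) = (\<Sum>x\<in>A. vsize (f x))"
  by (induction A rule: infinite_finite_induct) (auto simp: vsize_add, auto simp: vsize_def)

lemma toric_hom_eq:
  "toric_hom a p = (\<Sum>u\<in>keys p. single (evec_sum a u) (lookup p u))"
  unfolding toric_hom_def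
proof (intro sum.cong refl)
  fix u
  have pow: "single x (1 :: 'a) ^ m = single (m *s x) 1" for x :: "nat^3" and m
  proof (induction m)
    case 0
    have "0 *s x = 0" by (simp add: vec_eq_iff)
    then show ?case by simp
  next
    case (Suc m)
    have "x + m *s x = Suc m *s x" by (simp add: vec_eq_iff)
    then show ?case using Suc by (simp add: mult_single)
  qed
  have "(\<Prod>i\<in>A. single (f i) (1 :: 'a)) = single (sum f A) 1"
    for f :: "nat \<Rightarrow> nat^3" and A
    by (induction A rule: infinite_finite_induct) (auto simp: mult_single)
  then show "single 0 (lookup p u) *
      (\<Prod>i\<in>keys u. single (a i) 1 ^ lookup u i) =
    single (evec_sum a u) (lookup p u)"
    by (simp add: pow mult_single evec_sum_def)
qed

lemma toric_hom_superset:
  "finite A \<Longrightarrow> keys p \<subseteq> A \<Longrightarrow>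
    toric_hom a p = (\<Sum>u\<in>A. single (evec_sum a u) (lookup p u))"
  unfolding toric_hom_eq by (intro sum.mono_neutral_left) (auto simp: in_keys_iff)

lemma additive_toric_hom: "Modules.additive (toric_hom a)"
proof
  fix p q :: "'a mpoly"
  let ?A = "keys p \<union> keys q"
  have "toric_hom a (p + q) =
      (\<Sum>u\<in>?A. single (evec_sum a u) (lookup (p + q) u))"
    by (rule toric_hom_superset) (use Poly_Mapping.keys_add[of p q] in auto)
  then show "toric_hom a (p + q) = toric_hom a p + toric_hom a q"
    by (simp add: lookup_add single_add sum.distrib toric_hom_superset[of ?A p] toric_hom_superset[of ?A q])
qed

lemmas toric_hom_add = Modules.additive.add[OF additive_toric_hom]
  and toric_hom_diff = Modules.additive.diff[OF additive_toric_hom]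
  and toric_hom_sum = Modules.additive.sum[OF additive_toric_hom]

lemma toric_hom_single: "toric_hom a (single u c) = single (evec_sum a u) c"
  by (simp add: toric_hom_eq)

lemma toric_hom_xmon:
  "toric_hom a (single (xmon l) 1 * p) = single (a l) 1 * toric_hom a p"
proof -
  have "single (xmon l) 1 * p =
      (\<Sum>u\<in>keys p. single (xmon l + u) (lookup p u))"
    by (subst keys_sum_singles[of p, symmetric]) (simp add: sum_distrib_left mult_single)
  then show ?thesis
    by (simp add: toric_hom_sum toric_hom_single evec_sum_add evec_sum_xmon)
      (simp add: toric_hom_eq sum_distrib_left mult_single)
qed

lemma keys_toric_hom: "keys (toric_hom a p) \<subseteq> evec_sum a ` keys p"
proof
  fix s assume "s \<in> keys (toric_hom a p)"
  then have "(\<Sum>u\<in>keys p.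
      lookup (single (evec_sum a u) (lookup p u)) s) \<noteq> 0"
    unfolding in_keys_iff toric_hom_eq lookup_sum .
  then obtain u where "u \<in> keys p"
      "lookup (single (evec_sum a u) (lookup p u)) s \<noteq> 0"
    using sum.not_neutral_contains_not_neutral by blast
  then show "s \<in> evec_sum a ` keys p"
    by (auto simp: lookup_single when_def split: if_splits)
qed

text \<open>The monoid algebra k[S] with its standard grading: when all generators have size
  \<open>D\<close>, members of the monoid have sizes divisible by \<open>D\<close> and the division
  is exact.\<close>

definition tmod :: "nat \<Rightarrow> nat \<Rightarrow> (nat \<Rightarrow> nat^3) \<Rightarrow> int \<Rightarrow> (nat^3 \<Rightarrow>\<^sub>0 'k::zero) set" where
  "tmod n D a = mmod (\<lambda>v. int (vsize v div D)) (spanned_monoid n a)"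

definition tops :: "nat \<Rightarrow> (nat \<Rightarrow> nat^3) \<Rightarrow> ((nat^3 \<Rightarrow>\<^sub>0 'k::comm_ring_1) \<Rightarrow> (nat^3 \<Rightarrow>\<^sub>0 'k)) list" where
  "tops n a = mops (map a (idx n))"

lemma length_tops [simp]: "length (tops n a) = n"
  by (simp add: tops_def)

lemma commuting_tops: "commuting_ops (tops n a)"
  unfolding tops_def by (rule commuting_mops)

lemma spanned_monoid_eq: "spanned_monoid n a = evec_sum a ` mons n"
proof (intro equalityI subsetI)
  fix s assume "s \<in> spanned_monoid n a"
  then obtain c where c: "s = (\<Sum>i=1..n. c i *s a i)" by (auto simp: spanned_monoid_def)
  define u where "u = (\<Sum>i=1..n. single i (c i))"
  have look: "lookup u i = (if i \<in> {1..n} then c i else 0)" for i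
    by (simp add: u_def lookup_sum lookup_single when_def)
  then have "keys u \<subseteq> {1..n}" by (auto simp: in_keys_iff split: if_splits)
  then have "u \<in> mons n" "evec_sum a u = s"
    using evec_sum_superset[of "{1..n}" u a] by (auto simp: mons_def c look)
  then show "s \<in> evec_sum a ` mons n" by auto
next
  fix s assume "s \<in> evec_sum a ` mons n"
  then obtain u where u: "u \<in> mons n" "s = evec_sum a u" by auto
  then have "s = (\<Sum>i=1..n. lookup u i *s a i)"
    using evec_sum_superset[of "{1..n}" u a] by (simp add: mons_def)
  then show "s \<in> spanned_monoid n a" by (auto simp: spanned_monoid_def)
qed

locale toric =
  fixes n D :: nat and a :: "nat \<Rightarrow> nat^3"
  assumes D_pos: "D > 0" and a_size: "\<forall>i\<in>{1..n}. vsize (a i) = D"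
begin

lemma vsize_evec_sum: "u \<in> mons n \<Longrightarrow> vsize (evec_sum a u) = mon_degree u * D"
  using a_size
  by (auto simp: evec_sum_def vsize_sum vsize_smult mon_degree_def mons_def sum_distrib_right
      intro!: sum.cong)

lemma deg_evec_sum: "u \<in> mons n \<Longrightarrow> vsize (evec_sum a u) div D = mon_degree u"
  using D_pos by (simp add: vsize_evec_sum)

lemma a_mem: "i \<in> {1..n} \<Longrightarrow> a i \<in> spanned_monoid n a"
  unfolding spanned_monoid_eq by (rule image_eqI[of _ _ "xmon i"]) (simp add: evec_sum_xmon, simp add: mons_def xmon_def)

lemma S_add: "x \<in> spanned_monoid n a \<Longrightarrow> y \<in> spanned_monoid n a \<Longrightarrow> x + y \<in> spanned_monoid n a"
  unfolding spanned_monoid_eq by (force simp: evec_sum_add[symmetric] intro: mons_add)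

sublocale S: monomial_module "map a (idx n)" "spanned_monoid n a" "\<lambda>v. int (vsize v div D)"
proof
  fix g x assume "g \<in> set (map a (idx n))"
  then obtain i where i: "i \<in> {1..n}" "g = a i" by auto
  show "x \<in> spanned_monoid n a \<Longrightarrow> g + x \<in> spanned_monoid n a" using S_add a_mem i by auto
  show "int (vsize (g + x) div D) = 1 + int (vsize x div D)"
    using i a_size D_pos by (simp add: vsize_add)
qed

lemma graded_tmod: "graded_submodule (tops n a) (tmod n D a)"
  unfolding tops_def tmod_def by (rule S.graded_mmod)

lemma toric_hom_tmod: "p \<in> hpolys n t \<Longrightarrow> toric_hom a p \<in> tmod n D a t"
  using keys_toric_hom[of a p] deg_evec_sum
  by (fastforce simp: hpolys_def tmod_def mmod_def spanned_monoid_eq)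

lemma toric_hom_surj:
  assumes "q \<in> tmod n D a t"
  shows "\<exists>p\<in>hpolys n t. toric_hom a p = (q :: nat^3 \<Rightarrow>\<^sub>0 'k::field)"
proof -
  have "\<forall>s\<in>keys q. \<exists>u\<in>mons n. evec_sum a u = s \<and> int (mon_degree u) = t"
    using assms deg_evec_sum by (fastforce simp: tmod_def mmod_def spanned_monoid_eq)
  then obtain u where u: "\<And>s. s \<in> keys q \<Longrightarrow> u s \<in> mons n \<and> evec_sum a (u s) = s \<and> int (mon_degree (u s)) = t"
    by metis
  define p where "p = (\<Sum>s\<in>keys q. single (u s) (lookup q s))"
  have "toric_hom a p = (\<Sum>s\<in>keys q. single s (lookup q s))"
    unfolding p_def toric_hom_sum by (intro sum.cong) (auto simp: toric_hom_single u)
  then have "toric_hom a p = q" by (simp add: keys_sum_singles)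
  moreover have "p \<in> hpolys n t"
    unfolding p_def
    by (rule graded_submodule_sum[OF graded_hpolys]) (use u in \<open>auto simp: hpolys_def mmod_def\<close>)
  ultimately show ?thesis by blast
qed

text \<open>Monomials of different degrees have images of different size, so cancellation in the
  image takes place within each degree: the toric ideal is homogeneous.\<close>

lemma toric_hom_hpart:
  fixes p :: "'k::field mpoly"
  assumes "p \<in> polys n" "toric_hom a p = 0"
  shows "toric_hom a (hpart t p) = 0"
proof (rule poly_mapping_eqI)
  fix s
  show "lookup (toric_hom a (hpart t p)) s = lookup 0 s"
  proof (cases "int (vsize s div D) = t")
    case True
    have "s \<notin> keys (toric_hom a (p - hpart t p))"
    proof
      assume "s \<in> keys (toric_hom a (p - hpart t p))"
      then obtain u where u: "u \<in> keys (p - hpart t p)" "s = evec_sum a u"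
        using keys_toric_hom by blast
      then have "u \<in> keys p" "int (mon_degree u) \<noteq> t"
        by (auto simp: in_keys_iff lookup_minus lookup_hpart split: if_splits)
      then show False using u(2) True assms(1) deg_evec_sum[of u] by (auto simp: polys_def mons_def)
    qed
    then have "lookup (toric_hom a p - toric_hom a (hpart t p)) s = 0"
      by (simp add: toric_hom_diff in_keys_iff)
    then show ?thesis using assms(2) by (simp add: lookup_minus)
  next
    case False
    then have "s \<notin> keys (toric_hom a (hpart t p))"
      using toric_hom_tmod[OF hpart_in_hpolys[OF assms(1)], of t] by (auto simp: tmod_def mmod_def)
    then show ?thesis by (simp add: in_keys_iff)
  qed
qed

end

section \<open>Minimal graded free resolutions\<close>

text \<open>The augmentation with values in k[S]: composing with \<open>toric_hom\<close> replaces
  congruence modulo the toric ideal by equality.\<close>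

definition faug :: "nat \<Rightarrow> (nat \<Rightarrow> nat^3) \<Rightarrow> (nat \<Rightarrow> 'k::field mpoly) \<Rightarrow>
    (nat \<Rightarrow> 'k mpoly) \<Rightarrow> (nat^3 \<Rightarrow>\<^sub>0 'k)" where
  "faug r a aug v = toric_hom a (\<Sum>k<r. v k * aug k)"

text \<open>The degreewise form of a minimal resolution, with \<open>k[S]\<close> in place of the quotient by
  the toric ideal.\<close>

definition graded_resolution :: "nat \<Rightarrow> nat \<Rightarrow> (nat \<Rightarrow> nat^3) \<Rightarrow> (nat \<Rightarrow> int list) \<Rightarrow>
   (nat \<Rightarrow> 'k::field mpoly) \<Rightarrow> (nat \<Rightarrow> nat \<Rightarrow> nat \<Rightarrow> 'k mpoly) \<Rightarrow> bool" where
  "graded_resolution n D a degs aug phi \<longleftrightarrow>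
     (\<forall>t. faug (length (degs 0)) a aug ` FM n (degs 0) t = tmod n D a t) \<and>
     (\<forall>t. {v \<in> FM n (degs 0) t. faug (length (degs 0)) a aug v = 0} =
        mat_apply (length (degs 0)) (length (degs 1)) (phi 0) ` FM n (degs 1) t) \<and>
     (\<forall>i t. {v \<in> FM n (degs (Suc i)) t. mat_apply (length (degs i)) (length (degs (Suc i))) (phi i) v = 0} =
        mat_apply (length (degs (Suc i))) (length (degs (Suc (Suc i)))) (phi (Suc i)) ` FM n (degs (Suc (Suc i))) t) \<and>
     (\<forall>i. \<forall>k<length (degs i). \<forall>l<length (degs (Suc i)). lookup (phi i k l) 0 = 0)"

lemma additive_faug: "Modules.additive (faug r a aug)"
  by (auto simp: Modules.additive_def faug_def algebra_simps sum.distrib toric_hom_add)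

lemma faug_ops: "list_all2 (\<lambda>X Y. \<forall>v. faug r a aug (X v) = Y (faug r a aug v)) (fops n) (tops n a)"
proof -
  have "faug r a aug (\<lambda>k. single (xmon l) 1 * v k) =
      single (a l) 1 * faug r a aug v" for l v
    unfolding faug_def toric_hom_xmon[symmetric] by (simp add: sum_distrib_left mult.assoc)
  then show ?thesis by (simp add: fops_def tops_def mops_def list_all2_conv_all_nth)
qed

lemma hpart_eps:
  fixes v :: "nat \<Rightarrow> 'k::comm_ring_1 mpoly"
  assumes "\<And>k. k < length ds \<Longrightarrow> homogeneous (ds ! k) (aug k)"
  shows "hpart t (\<Sum>k<length ds. v k * aug k) = (\<Sum>k<length ds. vpart ds t v k * aug k)"
  unfolding hpart_sum
proof (intro sum.cong refl)
  fix k assume "k \<in> {..<length ds}"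
  then show "hpart t (v k * aug k) = vpart ds t v k * aug k"
    using hpart_mult[OF assms, of k t "v k"] by (simp add: vpart_def mult.commute)
qed

lemma eps_polys:
  fixes v :: "nat \<Rightarrow> 'k::comm_ring_1 mpoly"
  assumes "v \<in> free_module n r" "\<And>k. k < r \<Longrightarrow> aug k \<in> polys n"
  shows "(\<Sum>k<r. v k * aug k) \<in> polys n"
  using assms by (auto simp: free_module_def intro!: polys_sum polys_mult)

context toric
begin

lemma eps_hpolys:
  fixes v :: "nat \<Rightarrow> 'k::comm_ring_1 mpoly"
  assumes "v \<in> FM n ds t" "\<And>k. k < length ds \<Longrightarrow> aug k \<in> polys n \<and> homogeneous (ds ! k) (aug k)"
  shows "(\<Sum>k<length ds. v k * aug k) \<in> hpolys n t"
proof (rule graded_submodule_sum[OF graded_hpolys])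
  fix k assume k: "k \<in> {..<length ds}"
  have "v k \<in> hpolys n (t - ds ! k)" using FM_component[OF assms(1)] k by simp
  then show "v k * aug k \<in> hpolys n t"
    using assms(2)[of k] k homogeneous_mult[of "t - ds ! k" "v k" "ds ! k" "aug k"]
    by (auto simp: hpolys_iff polys_mult)
qed

text \<open>All maps of the resolution commute with the projections to a degree, so a preimage of a
  homogeneous element may be replaced by its component of that degree.\<close>

lemma graded_resolution_if_minimal:
  fixes aug :: "nat \<Rightarrow> 'k::field mpoly"
  assumes "minimal_graded_free_resolution n (toric_ideal n a) degs aug phi"
  shows "graded_resolution n D a degs aug phi"
proof -
  let ?r = "\<lambda>i. length (degs i)"
  let ?eps = "\<lambda>v. \<Sum>k<?r 0. v k * aug k"
  let ?d = "\<lambda>i. mat_apply (?r i) (?r (Suc i)) (phi i)"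
  have A1: "aug k \<in> polys n" "homogeneous (degs 0 ! k) (aug k)" if "k < ?r 0" for k
    using assms that by (auto simp: minimal_graded_free_resolution_def Let_def)
  have A2: "homogeneous (degs (Suc i) ! l - degs i ! k) (phi i k l)" if "k < ?r i" "l < ?r (Suc i)" for i k l
    using assms that by (auto simp: minimal_graded_free_resolution_def Let_def)
  have A3: "\<And>p. p \<in> polys n \<Longrightarrow> \<exists>v\<in>free_module n (?r 0). p - ?eps v \<in> toric_ideal n a"
    and A4: "{v \<in> free_module n (?r 0). ?eps v \<in> toric_ideal n a} = ?d 0 ` free_module n (?r 1)"
    and A5: "\<And>i. {v \<in> free_module n (?r (Suc i)). ?d i v = (\<lambda>_. 0)} = ?d (Suc i) ` free_module n (?r (Suc (Suc i)))"
    and A6: "\<forall>i. \<forall>k<?r i. \<forall>l<?r (Suc i). lookup (phi i k l) 0 = 0"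
    using assms by (simp_all add: minimal_graded_free_resolution_def Let_def)
  have dv: "?d i (vpart (degs (Suc i)) t v) = vpart (degs i) t (?d i v)" for i t v
    by (rule mat_apply_vpart) (rule A2)
  have ker: "faug (?r 0) a aug v = 0 \<longleftrightarrow> ?eps v \<in> toric_ideal n a" if "v \<in> free_module n (?r 0)" for v
    using eps_polys[OF that, of aug] A1(1) by (simp add: faug_def toric_ideal_def)
  have 1: "faug (?r 0) a aug ` FM n (degs 0) t = tmod n D a t" for t
  proof (intro equalityI subsetI)
    fix q assume "q \<in> faug (?r 0) a aug ` FM n (degs 0) t"
    then show "q \<in> tmod n D a t"
      unfolding faug_def using A1 by (auto intro!: toric_hom_tmod eps_hpolys)
  next
    fix q :: "nat^3 \<Rightarrow>\<^sub>0 'k" assume "q \<in> tmod n D a t"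
    then obtain p where p: "p \<in> hpolys n t" "toric_hom a p = q" using toric_hom_surj by blast
    then obtain v where v: "v \<in> free_module n (?r 0)" "p - ?eps v \<in> toric_ideal n a"
      using A3 by (auto simp: hpolys_iff)
    then have "toric_hom a (hpart t (p - ?eps v)) = 0"
      by (intro toric_hom_hpart) (auto simp: toric_ideal_def)
    moreover have "hpart t (p - ?eps v) = p - ?eps (vpart (degs 0) t v)"
    proof -
      have "hpart t p = p" using p(1) hpart_homogeneous[of t p t] by (simp add: hpolys_iff)
      moreover have "hpart t (p - ?eps v) = hpart t p - hpart t (?eps v)"
        by (rule poly_mapping_eqI) (simp add: lookup_hpart lookup_minus)
      ultimately show ?thesis using hpart_eps[of "degs 0" aug t v] A1(2) by simp
    qed
    ultimately have "faug (?r 0) a aug (vpart (degs 0) t v) = q"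
      using p(2) by (simp add: faug_def toric_hom_diff)
    then show "q \<in> faug (?r 0) a aug ` FM n (degs 0) t" using vpart_in_FM[OF v(1)] by blast
  qed
  have 2: "{v \<in> FM n (degs 0) t. faug (?r 0) a aug v = 0} = ?d 0 ` FM n (degs 1) t" for t
  proof (intro equalityI subsetI)
    fix v assume "v \<in> {v \<in> FM n (degs 0) t. faug (?r 0) a aug v = 0}"
    then have v: "v \<in> FM n (degs 0) t" and v0: "faug (?r 0) a aug v = 0" by auto
    have v': "?eps v \<in> toric_ideal n a" using ker[OF FM_free_module[OF v]] v0 by simp
    then obtain w where w: "w \<in> free_module n (?r 1)" "v = ?d 0 w" using A4 FM_free_module[OF v] by blast
    have "v = ?d 0 (vpart (degs 1) t w)" using dv[of 0 t w] vpart_FM[OF v] w(2) by simp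
    then show "v \<in> ?d 0 ` FM n (degs 1) t" using vpart_in_FM[OF w(1)] by blast
  next
    fix v assume "v \<in> ?d 0 ` FM n (degs 1) t"
    then obtain w where w: "w \<in> FM n (degs 1) t" "v = ?d 0 w" by auto
    have v: "v \<in> free_module n (?r 0)" "?eps v \<in> toric_ideal n a" using A4 w FM_free_module by blast+
    have "v = vpart (degs 0) t v" using dv[of 0 t w] vpart_FM[OF w(1)] w(2) by simp
    then have "v \<in> FM n (degs 0) t" using vpart_in_FM[OF v(1), of t] by simp
    then show "v \<in> {v \<in> FM n (degs 0) t. faug (?r 0) a aug v = 0}"
      using ker[OF v(1)] v(2) by simp
  qed
  have 3: "{v \<in> FM n (degs (Suc i)) t. ?d i v = 0} = ?d (Suc i) ` FM n (degs (Suc (Suc i))) t" for i t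
  proof (intro equalityI subsetI)
    fix v assume "v \<in> {v \<in> FM n (degs (Suc i)) t. ?d i v = 0}"
    then have v: "v \<in> FM n (degs (Suc i)) t" "?d i v = (\<lambda>_. 0)" by (auto simp: zero_fun_def)
    then obtain w where w: "w \<in> free_module n (?r (Suc (Suc i)))" "v = ?d (Suc i) w"
      using A5[of i] FM_free_module by blast
    have "v = ?d (Suc i) (vpart (degs (Suc (Suc i))) t w)" using dv[of "Suc i" t w] vpart_FM[OF v(1)] w(2) by simp
    then show "v \<in> ?d (Suc i) ` FM n (degs (Suc (Suc i))) t" using vpart_in_FM[OF w(1)] by blast
  next
    fix v assume "v \<in> ?d (Suc i) ` FM n (degs (Suc (Suc i))) t"
    then obtain w where w: "w \<in> FM n (degs (Suc (Suc i))) t" "v = ?d (Suc i) w" by auto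
    have "v \<in> free_module n (?r (Suc i))" "?d i v = (\<lambda>_. 0)" using A5[of i] w FM_free_module by blast+
    moreover have "v = vpart (degs (Suc i)) t v" using dv[of "Suc i" t w] vpart_FM[OF w(1)] w(2) by simp
    ultimately show "v \<in> {v \<in> FM n (degs (Suc i)) t. ?d i v = 0}"
      using vpart_in_FM[of v n "degs (Suc i)" t] by (simp add: zero_fun_def)
  qed
  show ?thesis
    unfolding graded_resolution_def One_nat_def using 1 2[unfolded One_nat_def] 3 A6 by blast
qed

text \<open>A vector is the finite sum of its components, and preimages found in single degrees add
  up to a preimage.\<close>

lemma minimal_if_graded_resolution:
  fixes aug :: "nat \<Rightarrow> 'k::field mpoly"
  assumes res: "graded_resolution n D a degs aug phi"
    and A0: "\<exists>p. \<forall>i>p. degs i = []"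
    and A1: "\<And>k. k < length (degs 0) \<Longrightarrow> aug k \<in> polys n \<and> homogeneous (degs 0 ! k) (aug k)"
    and A2: "\<And>i k l. k < length (degs i) \<Longrightarrow> l < length (degs (Suc i)) \<Longrightarrow>
      phi i k l \<in> polys n \<and> homogeneous (degs (Suc i) ! l - degs i ! k) (phi i k l)"
  shows "minimal_graded_free_resolution n (toric_ideal n a) degs aug phi"
proof -
  let ?r = "\<lambda>i. length (degs i)"
  let ?eps = "\<lambda>v. \<Sum>k<?r 0. v k * aug k"
  let ?d = "\<lambda>i. mat_apply (?r i) (?r (Suc i)) (phi i)"
  have R1: "\<And>t. faug (?r 0) a aug ` FM n (degs 0) t = tmod n D a t"
    and R2: "\<And>t. {v \<in> FM n (degs 0) t. faug (?r 0) a aug v = 0} = ?d 0 ` FM n (degs 1) t"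
    and R3: "\<And>i t. {v \<in> FM n (degs (Suc i)) t. ?d i v = 0} = ?d (Suc i) ` FM n (degs (Suc (Suc i))) t"
    and R4: "\<forall>i. \<forall>k<?r i. \<forall>l<?r (Suc i). lookup (phi i k l) 0 = 0"
    using res unfolding graded_resolution_def by auto
  note d_add = additive_mat_apply
  have dv: "?d i (vpart (degs (Suc i)) t v) = vpart (degs i) t (?d i v)" for i t v
    by (rule mat_apply_vpart) (use A2 in blast)
  have d_free: "v \<in> free_module n (?r (Suc i)) \<Longrightarrow> ?d i v \<in> free_module n (?r i)" for i v
    by (rule mat_apply_free_module) (use A2 in blast)
  have ker: "faug (?r 0) a aug v = 0 \<longleftrightarrow> ?eps v \<in> toric_ideal n a" if "v \<in> free_module n (?r 0)" for v
    using eps_polys[OF that, of aug] A1 by (simp add: faug_def toric_ideal_def)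
  have faug_vpart: "faug (?r 0) a aug (vpart (degs 0) t v) = 0"
    if "v \<in> free_module n (?r 0)" "faug (?r 0) a aug v = 0" for v t
    using toric_hom_hpart[OF eps_polys[OF that(1), of aug], of t] hpart_eps[of "degs 0" aug t v] A1 that(2)
    by (simp add: faug_def)
  have lift: "\<exists>w\<in>free_module n (?r (Suc i)). ?d i w = v"
    if v: "v \<in> free_module n (?r i)" and vt: "\<And>t. vpart (degs i) t v \<in> ?d i ` FM n (degs (Suc i)) t" for i v
  proof -
    have "\<exists>w. w \<in> FM n (degs (Suc i)) t \<and> ?d i w = vpart (degs i) t v" for t
      using vt[of t] by auto
    then obtain w where w: "\<And>t. w t \<in> FM n (degs (Suc i)) t \<and> ?d i (w t) = vpart (degs i) t v"
      by metis
    obtain T where T: "finite T" "(\<Sum>t\<in>T. vpart (degs i) t v) = v" using sum_vpart[OF v] by auto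
    have "?d i (\<Sum>t\<in>T. w t) = v"
      using w T(2) by (simp add: Modules.additive.sum[OF d_add])
    moreover have "(\<Sum>t\<in>T. w t) \<in> free_module n (?r (Suc i))"
      by (rule free_module_sum) (use w FM_free_module in blast)
    ultimately show ?thesis by blast
  qed
  have 3: "\<exists>v\<in>free_module n (?r 0). p - ?eps v \<in> toric_ideal n a" if p: "p \<in> polys n" for p
  proof -
    have "\<exists>v. v \<in> FM n (degs 0) t \<and> faug (?r 0) a aug v = toric_hom a (hpart t p)" for t
    proof -
      have "toric_hom a (hpart t p) \<in> faug (?r 0) a aug ` FM n (degs 0) t"
        unfolding R1 by (rule toric_hom_tmod[OF hpart_in_hpolys[OF p]])
      then show ?thesis by auto
    qed
    then obtain v where v: "\<And>t. v t \<in> FM n (degs 0) t \<and> faug (?r 0) a aug (v t) = toric_hom a (hpart t p)"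
      by metis
    have T: "finite (degrees p)" by (simp add: degrees_def)
    let ?v = "\<Sum>t\<in>degrees p. v t"
    have fm: "?v \<in> free_module n (?r 0)"
      by (rule free_module_sum) (use v FM_free_module in blast)
    have "faug (?r 0) a aug ?v = toric_hom a p"
      using v sum_hpart[OF T order_refl]
      by (simp add: Modules.additive.sum[OF additive_faug] flip: toric_hom_sum)
    then have "toric_hom a (p - ?eps ?v) = 0"
      unfolding faug_def toric_hom_diff by simp
    moreover have "p - ?eps ?v \<in> polys n"
      using eps_polys[OF fm, of aug] A1 p by (intro polys_minus) auto
    ultimately show ?thesis using fm by (auto simp: toric_ideal_def)
  qed
  have 4: "{v \<in> free_module n (?r 0). ?eps v \<in> toric_ideal n a} = ?d 0 ` free_module n (?r 1)"
  proof (intro equalityI subsetI)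
    fix v assume "v \<in> {v \<in> free_module n (?r 0). ?eps v \<in> toric_ideal n a}"
    then have v: "v \<in> free_module n (?r 0)" "faug (?r 0) a aug v = 0" using ker by auto
    have "vpart (degs 0) t v \<in> ?d 0 ` FM n (degs (Suc 0)) t" for t
      using R2[of t] faug_vpart[OF v] vpart_in_FM[OF v(1)] by auto
    then show "v \<in> ?d 0 ` free_module n (?r 1)" using lift[of v 0] v(1) by auto
  next
    fix v assume "v \<in> ?d 0 ` free_module n (?r 1)"
    then obtain w where w: "w \<in> free_module n (?r 1)" "v = ?d 0 w" by auto
    obtain T where T: "finite T" "(\<Sum>t\<in>T. vpart (degs 1) t w) = w" using sum_vpart[OF w(1)] by auto
    have "faug (?r 0) a aug (?d 0 (vpart (degs 1) t w)) = 0" for t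
      using R2[of t] vpart_in_FM[OF w(1), of t] by blast
    then have "faug (?r 0) a aug (\<Sum>t\<in>T. ?d 0 (vpart (degs 1) t w)) = 0"
      by (simp only: Modules.additive.sum[OF additive_faug] sum.neutral_const)
    moreover have "(\<Sum>t\<in>T. ?d 0 (vpart (degs 1) t w)) = v"
      using T(2) w(2) by (metis One_nat_def Modules.additive.sum[OF d_add])
    ultimately show "v \<in> {v \<in> free_module n (?r 0). ?eps v \<in> toric_ideal n a}"
      using ker d_free[of w 0] w by auto
  qed
  have 5: "{v \<in> free_module n (?r (Suc i)). ?d i v = (\<lambda>_. 0)} = ?d (Suc i) ` free_module n (?r (Suc (Suc i)))" for i
  proof (intro equalityI subsetI)
    fix v assume "v \<in> {v \<in> free_module n (?r (Suc i)). ?d i v = (\<lambda>_. 0)}"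
    then have v: "v \<in> free_module n (?r (Suc i))" "?d i v = (\<lambda>_. 0)" by auto
    have "vpart (degs (Suc i)) t v \<in> ?d (Suc i) ` FM n (degs (Suc (Suc i))) t" for t
      using R3[of i t] vpart_in_FM[OF v(1), of t] dv[of i t v] vpart_zero[of "degs i" t] v(2)
      by (auto simp: zero_fun_def)
    then show "v \<in> ?d (Suc i) ` free_module n (?r (Suc (Suc i)))" using lift[of v "Suc i"] v(1) by auto
  next
    fix v assume "v \<in> ?d (Suc i) ` free_module n (?r (Suc (Suc i)))"
    then obtain w where w: "w \<in> free_module n (?r (Suc (Suc i)))" "v = ?d (Suc i) w" by auto
    obtain T where T: "finite T" "(\<Sum>t\<in>T. vpart (degs (Suc (Suc i))) t w) = w" using sum_vpart[OF w(1)] by auto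
    have "?d i (?d (Suc i) (vpart (degs (Suc (Suc i))) t w)) = 0" for t
      using R3[of i t] vpart_in_FM[OF w(1), of t] by blast
    then have "?d i (\<Sum>t\<in>T. ?d (Suc i) (vpart (degs (Suc (Suc i))) t w)) = 0"
      by (simp only: Modules.additive.sum[OF d_add] sum.neutral_const)
    moreover have "(\<Sum>t\<in>T. ?d (Suc i) (vpart (degs (Suc (Suc i))) t w)) = v"
      using T(2) w(2) by (metis Modules.additive.sum[OF d_add])
    ultimately show "v \<in> {v \<in> free_module n (?r (Suc i)). ?d i v = (\<lambda>_. 0)}"
      using d_free[of w "Suc i"] w by (simp add: zero_fun_def)
  qed
  show ?thesis
    unfolding minimal_graded_free_resolution_def Let_def
    using A0 A1 A2 3 4 5 R4 by blast
qed

text \<open>The images \<open>Z i\<close> are the successive syzygy modules of k[S]. Each cover by a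
  free module lowers the homological degree by one, so homology of k[S] in degree
  \<open>i + 1\<close> is that of \<open>Z i\<close> in degree 0. This counts minimal generators of
  \<open>Z i\<close>, which correspond to the basis of the free module mapping onto it.\<close>

theorem degrees_resolution_iff:
  fixes aug :: "nat \<Rightarrow> 'k::field mpoly"
  assumes res: "graded_resolution n D a degs aug phi"
  shows "j \<in> set (degs i) \<longleftrightarrow>
    \<not> kexact (tops n a) (tmod n D a :: int \<Rightarrow> (nat^3 \<Rightarrow>\<^sub>0 'k) set) i (j - int i)"
proof -
  let ?r = "\<lambda>i. length (degs i)"
  let ?d = "\<lambda>i. mat_apply (?r i) (?r (Suc i)) (phi i)"
  let ?M = "tmod n D a :: int \<Rightarrow> (nat^3 \<Rightarrow>\<^sub>0 'k) set"
  have R1: "\<And>t. faug (?r 0) a aug ` FM n (degs 0) t = tmod n D a t"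
    and R2: "\<And>t. {v \<in> FM n (degs 0) t. faug (?r 0) a aug v = 0} = ?d 0 ` FM n (degs 1) t"
    and R3: "\<And>i t. {v \<in> FM n (degs (Suc i)) t. ?d i v = 0} = ?d (Suc i) ` FM n (degs (Suc (Suc i))) t"
    and R4: "\<And>i k l. k < ?r i \<Longrightarrow> l < ?r (Suc i) \<Longrightarrow> lookup (phi i k l) 0 = 0"
    using res unfolding graded_resolution_def by auto
  define Z where "Z = (\<lambda>i t. ?d i ` FM n (degs (Suc i)) t)"
  have Z0: "Z 0 t = {v \<in> FM n (degs 0) t. faug (?r 0) a aug v = 0}" for t
    using R2[of t] by (simp add: Z_def)
  have ZS: "Z (Suc i) t = {v \<in> FM n (degs (Suc i)) t. ?d i v = 0}" for i t
    using R3[of i t] by (simp add: Z_def)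
  have Z_FM: "Z i t \<subseteq> FM n (degs i) t" for i t
    by (cases i) (auto simp: Z0 ZS)
  \<comment> \<open>Matrix entries without constant term put the image into the multiples of the
    variables, which is the minimality asked for by the cover lemmas.\<close>
  have Z_min: "Z i t \<subseteq> opspan (fops n) (FM n (degs i)) (t - 1)" for i t
  proof
    fix v assume v: "v \<in> Z i t"
    then obtain w where "v = ?d i w" by (auto simp: Z_def)
    then have "lookup (v k) 0 = 0" for k
      by (auto simp: mat_apply_def lookup_sum intro!: sum.neutral lookup_mult_0 R4)
    then show "v \<in> opspan (fops n) (FM n (degs i)) (t - 1)"
      using Z_FM v by (intro in_opspan_fops) auto
  qed
  interpret c0: graded_cover "faug (?r 0) a aug" "fops n" "tops n a" "FM n (degs 0)" ?M
    by (rule graded_cover.intro) (simp_all add: additive_faug faug_ops commuting_fops commuting_tops graded_FM graded_tmod R1)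
  have syz0: "c0.syz = Z 0" by (auto simp: c0.syz_def Z0 fun_eq_iff)
  have cov: "graded_cover (?d i) (fops n) (fops n) (FM n (degs (Suc i))) (Z i)"
    if "graded_submodule (fops n) (Z i)" for i
    using that by (intro graded_cover.intro)
      (simp_all add: additive_mat_apply mat_apply_fops commuting_fops graded_FM Z_def)
  have syzS: "graded_cover.syz (?d i) (FM n (degs (Suc i))) = Z (Suc i)"
    if "graded_submodule (fops n) (Z i)" for i
    using graded_cover.syz_def[OF cov[OF that]] by (auto simp: ZS fun_eq_iff)
  \<comment> \<open>Each \<open>Z i\<close> is graded as the kernel of the preceding cover, and this
    in turn allows it to be the target of the next one.\<close>
  have sub: "graded_submodule (fops n) (Z i)" for i
  proof (induction i)
    case 0
    then show ?case using c0.subZ syz0 by simp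
  next
    case (Suc i)
    then show ?case using graded_cover.subZ[OF cov[OF Suc]] syzS[OF Suc] by simp
  qed
  have FM_ex: "kexact (fops n) (FM n ds :: int \<Rightarrow> (nat \<Rightarrow> 'k mpoly) set) (Suc i) t" for ds i t
    by (simp add: kexact_FM)
  have shift: "kexact (tops n a) ?M (Suc (i + j)) t \<longleftrightarrow> kexact (fops n) (Z i) j (t + 1 + int i)" for i j t
  proof (induction i arbitrary: j)
    case 0
    then show ?case using c0.kexact_cover_iff[OF FM_ex, of j t] Z_min[of 0] by (simp add: syz0)
  next
    case (Suc i)
    have "kexact (fops n) (Z i) (Suc j) (t + 1 + int i) \<longleftrightarrow> kexact (fops n) (Z (Suc i)) j (t + 1 + int i + 1)"
      using graded_cover.kexact_cover_iff[OF cov[OF sub[of i]] FM_ex, of j "t + 1 + int i"] Z_min[of "Suc i"]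
      by (simp add: syzS[OF sub])
    then show ?case using Suc[of "Suc j"] by (simp add: algebra_simps)
  qed
  show ?thesis
  proof (cases i)
    case 0
    have "kexact (tops n a) ?M 0 j \<longleftrightarrow> kexact (fops n) (FM n (degs 0) :: int \<Rightarrow> (nat \<Rightarrow> 'k mpoly) set) 0 j"
      by (rule c0.kexact_cover_0_iff) (use Z_min[of 0] in \<open>simp add: syz0\<close>)
    then show ?thesis using 0 by (simp add: kexact_FM)
  next
    case (Suc i')
    have "kexact (fops n) (Z i') 0 j \<longleftrightarrow>
        kexact (fops n) (FM n (degs (Suc i')) :: int \<Rightarrow> (nat \<Rightarrow> 'k mpoly) set) 0 j"
      by (rule graded_cover.kexact_cover_0_iff[OF cov[OF sub]])
        (use Z_min[of "Suc i'"] in \<open>simp add: syzS[OF sub]\<close>)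
    \<comment> \<open>For the value \<open>j - int i\<close> of \<open>t\<close>, the shifted index
      \<open>t + 1 + int i'\<close> is \<open>j\<close>.\<close>
    then show ?thesis using Suc shift[of i' 0 "j - int i"] by (simp add: kexact_FM)
  qed
qed

text \<open>Minimal covers are iterated, starting from the surjection of the polynomial ring onto
  k[S]. The next cover has finitely many generators because their degrees are governed by the Koszul
  homology of k[S]; the invariant \<open>P\<close> therefore carries the dimension shift along with
  the syzygy module, and \<open>Q\<close> records the covering matrix.\<close>

theorem minimal_resolution_exists:
  assumes fin: "\<And>i. finite {t. \<not> kexact (tops n a) (tmod n D a :: int \<Rightarrow> (nat^3 \<Rightarrow>\<^sub>0 'k::field) set) i t}"
  shows "\<exists>degs aug phi. minimal_graded_free_resolution n (toric_ideal n a :: ('k mpoly) set) degs aug phi"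
proof -
  let ?M = "tmod n D a :: int \<Rightarrow> (nat^3 \<Rightarrow>\<^sub>0 'k) set"
  let ?aug = "\<lambda>_ :: nat. 1 :: 'k mpoly"
  let ?f = "faug (Suc 0) a ?aug"
  define P where "P = (\<lambda>(i::nat) (ds, Z :: int \<Rightarrow> (nat \<Rightarrow> 'k mpoly) set).
    graded_submodule (fops n) Z \<and> scalar_closed Z \<and> (\<forall>t. Z t \<subseteq> FM n ds t) \<and>
    (\<forall>t. Z t \<subseteq> opspan (fops n) (FM n ds) (t - 1)) \<and>
    (\<forall>j t. kexact (tops n a) ?M (Suc (i + j)) t \<longleftrightarrow> kexact (fops n) Z j (t + 1 + int i)) \<and>
    (i = 0 \<longrightarrow> ds = [0] \<and> Z = (\<lambda>t. {v \<in> FM n [0] t. ?f v = 0})))"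
  define Q where "Q = (\<lambda>(i::nat) (ds :: int list, Z :: int \<Rightarrow> (nat \<Rightarrow> 'k mpoly) set) (ds', Z').
    \<exists>M. set ds' \<subseteq> {t. \<not> kexact (fops n) Z 0 t} \<and> (\<forall>l<length ds'. (\<lambda>k. M k l) \<in> Z (ds' ! l)) \<and>
      (\<forall>t. mat_apply (length ds) (length ds') M ` FM n ds' t = Z t) \<and>
      Z' = (\<lambda>t. {v \<in> FM n ds' t. mat_apply (length ds) (length ds') M v = 0}))"
  have FM_ex: "kexact (fops n) (FM n ds :: int \<Rightarrow> (nat \<Rightarrow> 'k mpoly) set) (Suc i) t" for ds i t
    by (simp add: kexact_FM)
  have f_eq: "?f v = toric_hom a (v 0)" for v by (simp add: faug_def)
  have f_image: "?f ` FM n [0] t = ?M t" for t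
  proof (intro equalityI subsetI)
    fix q assume "q \<in> ?f ` FM n [0] t"
    then obtain v where v: "v \<in> FM n [0] t" "q = ?f v" by auto
    have "v 0 \<in> hpolys n t" using FM_component[OF v(1), of 0] by simp
    then show "q \<in> ?M t" unfolding v(2) f_eq by (rule toric_hom_tmod)
  next
    fix q assume "q \<in> ?M t"
    then obtain p where p: "p \<in> hpolys n t" "toric_hom a p = q" using toric_hom_surj by blast
    have "(\<lambda>k. if k = 0 then p else 0) \<in> FM n [0] t" using p(1) by (auto simp: FM_def)
    moreover have "?f (\<lambda>k. if k = 0 then p else 0) = q" using p(2) unfolding f_eq by simp
    ultimately show "q \<in> ?f ` FM n [0] t" by blast
  qed
  interpret c0: graded_cover ?f "fops n" "tops n a" "FM n [0]" ?M
    by (rule graded_cover.intro) (simp_all only: additive_faug faug_ops commuting_fops commuting_tops graded_FM graded_tmod f_image)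
  \<comment> \<open>A constant is mapped to the same constant, so the kernel contains no nonzero
    constant and the initial cover is minimal.\<close>
  have min0: "c0.syz t \<subseteq> opspan (fops n) (FM n [0]) (t - 1)" for t
  proof
    fix v assume "v \<in> c0.syz t"
    then have v: "v \<in> FM n [0] t" "toric_hom a (v 0) = 0"
      unfolding c0.syz_def mem_Collect_eq f_eq by blast+
    have v0: "v 0 \<in> hpolys n t" using FM_component[OF v(1), of 0] by simp
    have "lookup (v 0) 0 = 0"
    proof (cases "t = 0")
      case True
      then have "v 0 = single 0 (lookup (v 0) 0)"
        using hpolys_zero_degree v0 by blast
      then have "single (evec_sum a 0) (lookup (v 0) 0) = 0"
        using v(2) toric_hom_single by metis
      then show ?thesis by (metis lookup_single_eq lookup_zero)
    next
      case False
      then have "0 \<notin> keys (v 0)" using v0 by (auto simp: hpolys_def mmod_def)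
      then show ?thesis by (simp add: in_keys_iff)
    qed
    moreover have "v k = 0" if "k \<noteq> 0" for k using v(1) that by (auto simp: FM_def dest: spec[of _ k])
    ultimately have "lookup (v k) 0 = 0" for k by (cases "k = 0") auto
    then show "v \<in> opspan (fops n) (FM n [0]) (t - 1)" by (rule in_opspan_fops[OF v(1)])
  qed
  have FM_scalar: "pscale c v \<in> FM n ds t" if "v \<in> FM n ds t" for c ds t and v :: "nat \<Rightarrow> 'k mpoly"
  proof -
    have "single 0 c * p \<in> hpolys n s" if "p \<in> hpolys n s" for p :: "'k mpoly" and s
      using that keys_mult[of "single 0 c" p]
      by (fastforce simp: hpolys_def mmod_def split: if_splits)
    then show ?thesis using that FM_component[OF that] by (auto simp: FM_def pscale_def)
  qed
  have base: "P 0 ([0], c0.syz)"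
  proof -
    have "scalar_closed c0.syz"
    proof -
      have "?f (pscale c v) = 0" if "?f v = 0" for c v
      proof -
        have "toric_hom a (single 0 c * p) = single 0 c * toric_hom a p" for p :: "'k mpoly"
        proof -
          have "single 0 c * p =
              (\<Sum>u\<in>keys p. single u (c * lookup p u))"
            by (subst keys_sum_singles[of p, symmetric]) (simp add: sum_distrib_left mult_single)
          then show ?thesis
            by (simp add: toric_hom_sum toric_hom_single)
              (simp add: toric_hom_eq sum_distrib_left mult_single)
        qed
        then show ?thesis using that unfolding f_eq pscale_def by simp
      qed
      then show ?thesis using FM_scalar by (auto simp: scalar_closed_def c0.syz_def)
    qed
    moreover have "kexact (tops n a) ?M (Suc (0 + j)) t \<longleftrightarrow> kexact (fops n) c0.syz j (t + 1 + int 0)" for j t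
      using c0.kexact_cover_iff[OF FM_ex min0, of j t] by simp
    moreover have "c0.syz t \<subseteq> FM n [0] t" for t by (auto simp: c0.syz_def)
    ultimately show ?thesis
      unfolding P_def using c0.subZ min0 by (auto simp: c0.syz_def fun_eq_iff)
  qed
  have step: "\<exists>y. P (Suc i) y \<and> Q i x y" if Px: "P i x" for i x
  proof -
    obtain ds Z where x: "x = (ds, Z)" by (cases x)
    have sub: "graded_submodule (fops n) Z" and sc: "scalar_closed Z" and ZF: "\<And>t. Z t \<subseteq> FM n ds t"
      and ex: "\<And>j t. kexact (tops n a) ?M (Suc (i + j)) t \<longleftrightarrow> kexact (fops n) Z j (t + 1 + int i)"
      using Px unfolding P_def x by auto
    \<comment> \<open>A generator of \<open>Z\<close> in degree \<open>t\<close> yields homology of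
      k[S] in homological degree \<open>Suc i\<close> at \<open>t - 1 - int i\<close>, so finiteness
      transfers from k[S].\<close>
    have "{t. \<not> kexact (fops n) Z 0 t} \<subseteq> (\<lambda>t. t + 1 + int i) ` {t. \<not> kexact (tops n a) ?M (Suc i) t}"
    proof
      fix t assume "t \<in> {t. \<not> kexact (fops n) Z 0 t}"
      then have "t - 1 - int i \<in> {t. \<not> kexact (tops n a) ?M (Suc i) t}"
        using ex[of 0 "t - 1 - int i"] by simp
      then show "t \<in> (\<lambda>t. t + 1 + int i) ` {t. \<not> kexact (tops n a) ?M (Suc i) t}"
        by (rule rev_image_eqI) simp
    qed
    then have "finite {t. \<not> kexact (fops n) Z 0 t}" using fin finite_surj by blast
    from minimal_cover_exists[OF sub sc ZF this] obtain ds' M where M: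
      "set ds' \<subseteq> {t. \<not> kexact (fops n) Z 0 t}" "\<And>l. l < length ds' \<Longrightarrow> (\<lambda>k. M k l) \<in> Z (ds' ! l)"
      "\<And>t. mat_apply (length ds) (length ds') M ` FM n ds' t = Z t"
      "\<And>t v. v \<in> FM n ds' t \<Longrightarrow> mat_apply (length ds) (length ds') M v = 0 \<Longrightarrow>
        v \<in> opspan (fops n) (FM n ds') (t - 1)"
      by blast
    let ?d = "mat_apply (length ds) (length ds') M"
    interpret c: graded_cover ?d "fops n" "fops n" "FM n ds'" Z
      by (rule graded_cover.intro) (simp_all only: additive_mat_apply mat_apply_fops commuting_fops graded_FM sub M(3))
    have min: "c.syz t \<subseteq> opspan (fops n) (FM n ds') (t - 1)" for t
      using M(4) by (auto simp: c.syz_def)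
    have "scalar_closed c.syz"
      using FM_scalar mat_apply_smult[of "length ds" "length ds'" M]
      by (auto simp: scalar_closed_def c.syz_def pscale_def fun_eq_iff)
    moreover have "kexact (tops n a) ?M (Suc (Suc i + j)) t \<longleftrightarrow> kexact (fops n) c.syz j (t + 1 + int (Suc i))" for j t
      using c.kexact_cover_iff[OF FM_ex min, of j "t + 1 + int i"] ex[of "Suc j" t] by (simp add: algebra_simps)
    moreover have "c.syz t \<subseteq> FM n ds' t" for t by (auto simp: c.syz_def)
    ultimately have "P (Suc i) (ds', c.syz)"
      unfolding P_def using c.subZ min by auto
    moreover have "Q i x (ds', c.syz)"
      unfolding Q_def x prod.case
    proof (intro exI[of _ M] conjI allI impI)
      show "c.syz = (\<lambda>t. {v \<in> FM n ds' t. ?d v = 0})" by (rule ext) (rule c.syz_def)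
    qed (rule M(1), rule M(2), assumption, rule M(3))
    ultimately show ?thesis by blast
  qed
  \<comment> \<open>Dependent choice, since each cover is a cover of the syzygies of the one
    before.\<close>
  obtain F where F: "\<And>i. P i (F i)" "\<And>i. Q i (F i) (F (Suc i))"
    using dependent_nat_choice[of P Q] base step by metis
  have F0: "F 0 = ([0], \<lambda>t. {v \<in> FM n [0] t. ?f v = 0})"
    using F(1)[of 0] by (cases "F 0") (simp add: P_def)
  define degs where "degs = (\<lambda>i. fst (F i))"
  define Z where "Z = (\<lambda>i. snd (F i))"
  define R where "R = (\<lambda>i M. set (degs (Suc i)) \<subseteq> {t. \<not> kexact (fops n) (Z i) 0 t} \<and>
      (\<forall>l<length (degs (Suc i)). (\<lambda>k. M k l) \<in> Z i (degs (Suc i) ! l)) \<and>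
      (\<forall>t. mat_apply (length (degs i)) (length (degs (Suc i))) M ` FM n (degs (Suc i)) t = Z i t) \<and>
      Z (Suc i) = (\<lambda>t. {v \<in> FM n (degs (Suc i)) t. mat_apply (length (degs i)) (length (degs (Suc i))) M v = 0}))"
  have "\<exists>M. R i M" for i
    using F(2)[of i] unfolding R_def Q_def degs_def Z_def case_prod_beta .
  then obtain phi where "\<And>i. R i (phi i)" by metis
  note R = this[unfolded R_def]
  have phi: "set (degs (Suc i)) \<subseteq> {t. \<not> kexact (fops n) (Z i) 0 t}"
    "l < length (degs (Suc i)) \<Longrightarrow> (\<lambda>k. phi i k l) \<in> Z i (degs (Suc i) ! l)"
    "mat_apply (length (degs i)) (length (degs (Suc i))) (phi i) ` FM n (degs (Suc i)) t = Z i t"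
    "Z (Suc i) = (\<lambda>t. {v \<in> FM n (degs (Suc i)) t. mat_apply (length (degs i)) (length (degs (Suc i))) (phi i) v = 0})"
    for i l t
    using R[of i] by simp_all
  have ZF: "Z i t \<subseteq> FM n (degs i) t" and Zmin: "Z i t \<subseteq> opspan (fops n) (FM n (degs i)) (t - 1)"
    and Zex: "kexact (tops n a) ?M (Suc (i + j)) t \<longleftrightarrow> kexact (fops n) (Z i) j (t + 1 + int i)" for i j t
    using F(1)[of i] unfolding P_def degs_def Z_def by (auto simp: case_prod_beta)
  have degs0: "degs 0 = [0]" and Z0: "Z 0 = (\<lambda>t. {v \<in> FM n [0] t. ?f v = 0})"
    by (simp_all add: degs_def Z_def F0)
  have "minimal_graded_free_resolution n (toric_ideal n a) degs ?aug phi"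
  proof (rule minimal_if_graded_resolution)
    show "graded_resolution n D a degs ?aug phi"
      unfolding graded_resolution_def
    proof (intro conjI allI impI)
      show "faug (length (degs 0)) a ?aug ` FM n (degs 0) t = tmod n D a t" for t
        using f_image by (simp add: degs0)
      show "{v \<in> FM n (degs 0) t. faug (length (degs 0)) a ?aug v = 0} =
          mat_apply (length (degs 0)) (length (degs 1)) (phi 0) ` FM n (degs 1) t" for t
        using phi(3)[of 0 t] by (simp add: Z0 degs0)
      show "{v \<in> FM n (degs (Suc i)) t. mat_apply (length (degs i)) (length (degs (Suc i))) (phi i) v = 0} =
        mat_apply (length (degs (Suc i))) (length (degs (Suc (Suc i)))) (phi (Suc i)) ` FM n (degs (Suc (Suc i))) t" for i t
        using phi(3)[of "Suc i" t] by (simp add: phi(4))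
      fix i k l assume "k < length (degs i)" "l < length (degs (Suc i))"
      then have "(\<lambda>k. phi i k l) \<in> opspan (fops n) (FM n (degs i)) (degs (Suc i) ! l - 1)"
        using phi(2) Zmin by blast
      from lookup_opspan_fops[OF this] show "lookup (phi i k l) 0 = 0" by simp
    qed
    \<comment> \<open>Generators at step \<open>i\<close> amount to Koszul homology in degree
      \<open>i\<close>, which vanishes beyond the number \<open>n\<close> of variables.\<close>
    show "\<exists>p. \<forall>i>p. degs i = []"
    proof (intro exI[of _ n] allI impI)
      fix i assume "i > n"
      then obtain i' where i': "i = Suc i'" by (cases i) auto
      have "kexact (tops n a) ?M (Suc (i' + 0)) t" for t
        by (rule kexact_gt_length) (use \<open>i > n\<close> i' in \<open>simp_all add: graded_tmod commuting_tops\<close>)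
      then have "kexact (fops n) (Z i') 0 t" for t using Zex[of i' 0 "t - 1 - int i'"] by simp
      then show "degs i = []" using phi(1)[of i'] i' by auto
    qed
    show "?aug k \<in> polys n \<and> homogeneous (degs 0 ! k) (?aug k)" if "k < length (degs 0)" for k
      using that by (simp add: degs0 polys_def homogeneous_def)
    fix i k l assume k: "k < length (degs i)" and l: "l < length (degs (Suc i))"
    have "(\<lambda>k. phi i k l) \<in> FM n (degs i) (degs (Suc i) ! l)" using phi(2)[OF l] ZF by blast
    from FM_component[OF this k]
    show "phi i k l \<in> polys n \<and> homogeneous (degs (Suc i) ! l - degs i ! k) (phi i k l)"
      by (simp add: hpolys_iff)
  qed
  then show ?thesis by blast
qed

end

section \<open>Complexes on three vertices\<close>

text \<open>Coordinates of a chain on the subsets of three vertices: the digits of each argument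
  name the face, \<open>x0\<close> belonging to the empty one.\<close>

definition tri :: "'k \<Rightarrow> 'k \<Rightarrow> 'k \<Rightarrow> 'k \<Rightarrow> 'k \<Rightarrow> 'k \<Rightarrow> 'k \<Rightarrow> 'k \<Rightarrow> bool list \<Rightarrow> 'k::zero" where
  "tri x0 x1 x2 x3 x12 x13 x23 x123 = (\<lambda>w.
     if w = [False, False, False] then x0 else if w = [True, False, False] then x1
     else if w = [False, True, False] then x2 else if w = [False, False, True] then x3
     else if w = [True, True, False] then x12 else if w = [True, False, True] then x13
     else if w = [False, True, True] then x23 else if w = [True, True, True] then x123 else 0)"

lemma length_3_cases:
  assumes "length w = 3"
  obtains "w = [False, False, False]" | "w = [True, False, False]" | "w = [False, True, False]"
    | "w = [False, False, True]" | "w = [True, True, False]" | "w = [True, False, True]"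
    | "w = [False, True, True]" | "w = [True, True, True]"
proof -
  obtain x y z where "w = [x, y, z]" using assms by (auto simp: numeral_3_eq_3 length_Suc_conv)
  then show thesis using that by (cases x; cases y; cases z) auto
qed

lemma tri_values:
  assumes "\<And>w. length w \<noteq> 3 \<Longrightarrow> c w = 0"
  shows "c = tri (c [False, False, False]) (c [True, False, False]) (c [False, True, False])
    (c [False, False, True]) (c [True, True, False]) (c [True, False, True]) (c [False, True, True])
    (c [True, True, True])"
proof
  fix w
  show "c w = tri (c [False, False, False]) (c [True, False, False]) (c [False, True, False])
    (c [False, False, True]) (c [True, True, False]) (c [True, False, True]) (c [False, True, True])
    (c [True, True, True]) w"
  proof (cases "length w = 3")
    case True
    then show ?thesis by (cases w rule: length_3_cases) (simp_all add: tri_def)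
  next
    case False
    then have "c w = 0" using assms by blast
    moreover have "tri x0 x1 x2 x3 x12 x13 x23 x123 w = (0 :: 'a)" for x0 x1 x2 x3 x12 x13 x23 x123
      using False by (auto simp: tri_def)
    ultimately show ?thesis by simp
  qed
qed

lemma tri_eq_iff:
  "tri x0 x1 x2 x3 x12 x13 x23 x123 = tri y0 y1 y2 y3 y12 y13 y23 y123 \<longleftrightarrow>
     x0 = y0 \<and> x1 = y1 \<and> x2 = y2 \<and> x3 = y3 \<and> x12 = y12 \<and> x13 = y13 \<and> x23 = y23 \<and> x123 = y123"
proof
  assume *: "tri x0 x1 x2 x3 x12 x13 x23 x123 = tri y0 y1 y2 y3 y12 y13 y23 y123"
  show "x0 = y0 \<and> x1 = y1 \<and> x2 = y2 \<and> x3 = y3 \<and> x12 = y12 \<and> x13 = y13 \<and> x23 = y23 \<and> x123 = y123"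
    using fun_cong[OF *, of "[False, False, False]"] fun_cong[OF *, of "[True, False, False]"]
      fun_cong[OF *, of "[False, True, False]"] fun_cong[OF *, of "[False, False, True]"]
      fun_cong[OF *, of "[True, True, False]"] fun_cong[OF *, of "[True, False, True]"]
      fun_cong[OF *, of "[False, True, True]"] fun_cong[OF *, of "[True, True, True]"]
    by (simp add: tri_def)
qed simp

lemma kdiff_id_length:
  assumes "\<And>w. length w \<noteq> m \<Longrightarrow> c w = 0" "length w \<noteq> m"
  shows "kdiff (replicate m id) c w = 0"
  using assms
proof (induction m arbitrary: c w)
  case 0
  then show ?case by simp
next
  case (Suc m)
  show ?case
  proof (cases w)
    case (Cons b u)
    have *: "kdiff (replicate m id) (\<lambda>v. c (b' # v)) u = 0" for b'
      by (rule Suc.IH) (use Suc.prems Cons in auto)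
    have "c (True # u) = 0" using Suc.prems Cons by auto
    then have "kdiff (id # replicate m id) c (b # u) = 0"
      by (cases b) (simp_all only: kdiff.simps * minus_zero id_apply add_0_right)
    then show ?thesis unfolding Cons replicate_Suc .
  qed simp
qed

lemma kdiff_tri:
  "kdiff (replicate 3 id) (tri x0 x1 x2 x3 x12 x13 x23 x123 :: bool list \<Rightarrow> 'k::field) =
    tri (x1 + x2 + x3) (- (x12 + x13)) (x12 - x23) (x13 + x23) x123 (- x123) x123 0"
proof
  fix w
  let ?c = "tri x0 x1 x2 x3 x12 x13 x23 x123"
  have off: "length w \<noteq> 3 \<Longrightarrow> tri y0 y1 y2 y3 y12 y13 y23 y123 w = (0 :: 'k)"
    for w y0 y1 y2 y3 y12 y13 y23 y123 by (auto simp: tri_def)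
  show "kdiff (replicate 3 id) ?c w =
    tri (x1 + x2 + x3) (- (x12 + x13)) (x12 - x23) (x13 + x23) x123 (- x123) x123 0 w"
  proof (cases "length w = 3")
    case True
    then show ?thesis
      by (cases w rule: length_3_cases) (simp_all add: numeral_3_eq_3 tri_def)
  next
    case False
    then show ?thesis using kdiff_id_length[of 3 ?c w] off by simp
  qed
qed

lemma chain_on_tri:
  "chain_on 3 \<Delta> i (tri x0 x1 x2 x3 x12 x13 x23 x123) \<longleftrightarrow>
    (x0 \<noteq> 0 \<longrightarrow> i = 0 \<and> \<Delta> [False, False, False]) \<and> (x1 \<noteq> 0 \<longrightarrow> i = 1 \<and> \<Delta> [True, False, False]) \<and>
    (x2 \<noteq> 0 \<longrightarrow> i = 1 \<and> \<Delta> [False, True, False]) \<and> (x3 \<noteq> 0 \<longrightarrow> i = 1 \<and> \<Delta> [False, False, True]) \<and>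
    (x12 \<noteq> 0 \<longrightarrow> i = 2 \<and> \<Delta> [True, True, False]) \<and> (x13 \<noteq> 0 \<longrightarrow> i = 2 \<and> \<Delta> [True, False, True]) \<and>
    (x23 \<noteq> 0 \<longrightarrow> i = 2 \<and> \<Delta> [False, True, True]) \<and> (x123 \<noteq> 0 \<longrightarrow> i = 3 \<and> \<Delta> [True, True, True])"
  (is "_ \<longleftrightarrow> ?R")
proof
  assume *: "chain_on 3 \<Delta> i (tri x0 x1 x2 x3 x12 x13 x23 x123)"
  show ?R
    using *[unfolded chain_on_def, rule_format, of "[False, False, False]"]
      *[unfolded chain_on_def, rule_format, of "[True, False, False]"]
      *[unfolded chain_on_def, rule_format, of "[False, True, False]"]
      *[unfolded chain_on_def, rule_format, of "[False, False, True]"]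
      *[unfolded chain_on_def, rule_format, of "[True, True, False]"]
      *[unfolded chain_on_def, rule_format, of "[True, False, True]"]
      *[unfolded chain_on_def, rule_format, of "[False, True, True]"]
      *[unfolded chain_on_def, rule_format, of "[True, True, True]"]
    by (simp add: tri_def numeral_3_eq_3 numeral_2_eq_2)
next
  assume R: ?R
  show "chain_on 3 \<Delta> i (tri x0 x1 x2 x3 x12 x13 x23 x123)"
    unfolding chain_on_def
  proof (intro allI impI)
    fix w assume nz: "tri x0 x1 x2 x3 x12 x13 x23 x123 w \<noteq> 0"
    then have "length w = 3" by (auto simp: tri_def split: if_splits)
    then show "length w = 3 \<and> trues w = i \<and> \<Delta> w"
      using R nz by (cases w rule: length_3_cases) (simp_all add: tri_def)
  qed
qed

lemma tri_zero: "tri 0 0 0 0 0 0 0 0 = 0"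
  by (auto simp: tri_def fun_eq_iff)

text \<open>The conditions to be a cycle and to have a filling become linear equations through
  \<open>kdiff_tri\<close>. In each degree a small linear system with support conditions
  remains.\<close>

lemma cexact_3_iff:
  "cexact TYPE('k::field) 3 \<Delta> i \<longleftrightarrow> (\<forall>x0 x1 x2 x3 x12 x13 x23 x123 :: 'k.
     chain_on 3 \<Delta> i (tri x0 x1 x2 x3 x12 x13 x23 x123) \<longrightarrow>
     x1 + x2 + x3 = 0 \<longrightarrow> x12 + x13 = 0 \<longrightarrow> x12 - x23 = 0 \<longrightarrow> x13 + x23 = 0 \<longrightarrow> x123 = 0 \<longrightarrow>
     (\<exists>y0 y1 y2 y3 y12 y13 y23 y123. chain_on 3 \<Delta> (Suc i) (tri y0 y1 y2 y3 y12 y13 y23 y123) \<and>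
        x0 = y1 + y2 + y3 \<and> x1 = - (y12 + y13) \<and> x2 = y12 - y23 \<and> x3 = y13 + y23 \<and>
        x12 = y123 \<and> x13 = - y123 \<and> x23 = y123 \<and> x123 = 0))"
  (is "_ \<longleftrightarrow> ?R")
proof
  assume ex: "cexact TYPE('k::field) 3 \<Delta> i"
  show ?R
  proof (intro allI impI)
    fix x0 x1 x2 x3 x12 x13 x23 x123 :: 'k
    assume ch: "chain_on 3 \<Delta> i (tri x0 x1 x2 x3 x12 x13 x23 x123)"
      and z: "x1 + x2 + x3 = 0" "x12 + x13 = 0" "x12 - x23 = 0" "x13 + x23 = 0" "x123 = 0"
    have "kdiff (replicate 3 id) (tri x0 x1 x2 x3 x12 x13 x23 x123) = 0"
      unfolding kdiff_tri z tri_zero[symmetric] by (simp add: tri_eq_iff)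
    then obtain b :: "bool list \<Rightarrow> 'k" where b: "chain_on 3 \<Delta> (Suc i) b"
      "kdiff (replicate 3 id) b = tri x0 x1 x2 x3 x12 x13 x23 x123"
      using ex ch unfolding cexact_def by blast
    have "\<exists>y0 y1 y2 y3 y12 y13 y23 y123. b = tri y0 y1 y2 y3 y12 y13 y23 y123"
      using tri_values[of b] b(1) unfolding chain_on_def by blast
    then obtain y0 y1 y2 y3 y12 y13 y23 y123 where y: "b = tri y0 y1 y2 y3 y12 y13 y23 y123" by blast
    have "x0 = y1 + y2 + y3 \<and> x1 = - (y12 + y13) \<and> x2 = y12 - y23 \<and> x3 = y13 + y23 \<and>
        x12 = y123 \<and> x13 = - y123 \<and> x23 = y123 \<and> x123 = 0"
      using b(2) unfolding y kdiff_tri tri_eq_iff by auto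
    then show "\<exists>y0 y1 y2 y3 y12 y13 y23 y123. chain_on 3 \<Delta> (Suc i) (tri y0 y1 y2 y3 y12 y13 y23 y123) \<and>
        x0 = y1 + y2 + y3 \<and> x1 = - (y12 + y13) \<and> x2 = y12 - y23 \<and> x3 = y13 + y23 \<and>
        x12 = y123 \<and> x13 = - y123 \<and> x23 = y123 \<and> x123 = 0"
      using b(1) unfolding y by blast
  qed
next
  assume R: ?R
  show "cexact TYPE('k::field) 3 \<Delta> i"
    unfolding cexact_def
  proof (intro allI impI)
    fix c :: "bool list \<Rightarrow> 'k"
    assume ch: "chain_on 3 \<Delta> i c" and dc: "kdiff (replicate 3 id) c = 0"
    have "\<exists>x0 x1 x2 x3 x12 x13 x23 x123. c = tri x0 x1 x2 x3 x12 x13 x23 x123"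
      using tri_values[of c] ch unfolding chain_on_def by blast
    then obtain x0 x1 x2 x3 x12 x13 x23 x123 where x: "c = tri x0 x1 x2 x3 x12 x13 x23 x123" by blast
    have z: "x1 + x2 + x3 = 0 \<and> x12 + x13 = 0 \<and> x12 - x23 = 0 \<and> x13 + x23 = 0 \<and> x123 = 0"
      using dc unfolding x kdiff_tri tri_zero[symmetric] tri_eq_iff by (auto simp: neg_eq_iff_add_eq_0)
    then obtain y0 y1 y2 y3 y12 y13 y23 y123 where "chain_on 3 \<Delta> (Suc i) (tri y0 y1 y2 y3 y12 y13 y23 y123)"
        "x0 = y1 + y2 + y3 \<and> x1 = - (y12 + y13) \<and> x2 = y12 - y23 \<and> x3 = y13 + y23 \<and>
        x12 = y123 \<and> x13 = - y123 \<and> x23 = y123 \<and> x123 = 0"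
      using R[rule_format, OF ch[unfolded x]] z by blast
    then show "\<exists>b. chain_on 3 \<Delta> (Suc i) b \<and> kdiff (replicate 3 id) b = c"
      unfolding x by (intro exI[of _ "tri y0 y1 y2 y3 y12 y13 y23 y123"]) (simp add: kdiff_tri tri_eq_iff)
  qed
qed

text \<open>The propositions \<open>q1\<close>, \<open>q2\<close>, \<open>q3\<close> stand for
  nonzero coefficients at the vertices of a cycle; as the coefficients sum to zero, exactly one
  nonzero coefficient is excluded. The conclusion offers three shapes of a filling, using the edges
  at vertex 1, at vertex 2 or at vertex 3.\<close>

lemma edge_choice:
  assumes "q1 \<longrightarrow> p1" "q2 \<longrightarrow> p2" "q3 \<longrightarrow> p3"
    and "\<not> q1 \<longrightarrow> \<not> q2 \<longrightarrow> \<not> q3" "\<not> q1 \<longrightarrow> \<not> q3 \<longrightarrow> \<not> q2" "\<not> q2 \<longrightarrow> \<not> q3 \<longrightarrow> \<not> q1"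
    and "p1 \<and> p2 \<longrightarrow> p12 \<or> (p13 \<and> p23)" "p1 \<and> p3 \<longrightarrow> p13 \<or> (p12 \<and> p23)" "p2 \<and> p3 \<longrightarrow> p23 \<or> (p12 \<and> p13)"
  shows "(q2 \<longrightarrow> p12) \<and> (q3 \<longrightarrow> p13) \<or> (q1 \<longrightarrow> p12) \<and> (q3 \<longrightarrow> p23) \<or> (q1 \<longrightarrow> p13) \<and> (q2 \<longrightarrow> p23)"
  using assms by argo

context
  fixes \<Delta> :: "bool list \<Rightarrow> bool" and p0 p1 p2 p3 p12 p13 p23 p123
  assumes p: "\<Delta> [False, False, False] \<longleftrightarrow> p0" "\<Delta> [True, False, False] \<longleftrightarrow> p1"
    "\<Delta> [False, True, False] \<longleftrightarrow> p2" "\<Delta> [False, False, True] \<longleftrightarrow> p3" "\<Delta> [True, True, False] \<longleftrightarrow> p12"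
    "\<Delta> [True, False, True] \<longleftrightarrow> p13" "\<Delta> [False, True, True] \<longleftrightarrow> p23" "\<Delta> [True, True, True] \<longleftrightarrow> p123"
begin

text \<open>Reduced homology in dimension -1 detects an empty face without any vertex.\<close>

lemma cexact_3_0: "cexact TYPE('k::field) 3 \<Delta> 0 \<longleftrightarrow> (p0 \<longrightarrow> p1 \<or> p2 \<or> p3)"
proof -
  have "cexact TYPE('k) 3 \<Delta> 0 \<longleftrightarrow> (\<forall>x0 :: 'k. (x0 \<noteq> 0 \<longrightarrow> p0) \<longrightarrow>
      (\<exists>y1 y2 y3. (y1 \<noteq> 0 \<longrightarrow> p1) \<and> (y2 \<noteq> 0 \<longrightarrow> p2) \<and> (y3 \<noteq> 0 \<longrightarrow> p3) \<and> x0 = y1 + y2 + y3))"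
    unfolding cexact_3_iff chain_on_tri p by auto
  also have "\<dots> \<longleftrightarrow> (p0 \<longrightarrow> p1 \<or> p2 \<or> p3)"
  proof
    assume *: "\<forall>x0 :: 'k. (x0 \<noteq> 0 \<longrightarrow> p0) \<longrightarrow>
      (\<exists>y1 y2 y3. (y1 \<noteq> 0 \<longrightarrow> p1) \<and> (y2 \<noteq> 0 \<longrightarrow> p2) \<and> (y3 \<noteq> 0 \<longrightarrow> p3) \<and> x0 = y1 + y2 + y3)"
    show "p0 \<longrightarrow> p1 \<or> p2 \<or> p3"
      using *[rule_format, of 1] by auto
  next
    assume *: "p0 \<longrightarrow> p1 \<or> p2 \<or> p3"
    show "\<forall>x0 :: 'k. (x0 \<noteq> 0 \<longrightarrow> p0) \<longrightarrow>
      (\<exists>y1 y2 y3. (y1 \<noteq> 0 \<longrightarrow> p1) \<and> (y2 \<noteq> 0 \<longrightarrow> p2) \<and> (y3 \<noteq> 0 \<longrightarrow> p3) \<and> x0 = y1 + y2 + y3)"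
    proof (intro allI impI)
      fix x0 :: 'k assume "x0 \<noteq> 0 \<longrightarrow> p0"
      then consider "x0 = 0" | "p1" | "p2" | "p3" using * by blast
      then show "\<exists>y1 y2 y3. (y1 \<noteq> 0 \<longrightarrow> p1) \<and> (y2 \<noteq> 0 \<longrightarrow> p2) \<and> (y3 \<noteq> 0 \<longrightarrow> p3) \<and> x0 = y1 + y2 + y3"
      proof cases
        case 1 then show ?thesis by (intro exI[of _ 0]) auto
      next
        case 2 then show ?thesis by (intro exI[of _ x0] exI[of _ 0]) auto
      next
        case 3 then show ?thesis by (intro exI[of _ 0] exI[of _ x0] exI[of _ 0]) auto
      next
        case 4 then show ?thesis by (intro exI[of _ 0] exI[of _ x0]) auto
      qed
    qed
  qed
  finally show ?thesis .
qed

text \<open>Reduced homology in dimension 0 measures connectedness: two vertices present must be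
  joined by their edge or by the path through the third.\<close>

lemma cexact_3_1:
  "cexact TYPE('k::field) 3 \<Delta> 1 \<longleftrightarrow>
    (p1 \<and> p2 \<longrightarrow> p12 \<or> (p13 \<and> p23)) \<and> (p1 \<and> p3 \<longrightarrow> p13 \<or> (p12 \<and> p23)) \<and> (p2 \<and> p3 \<longrightarrow> p23 \<or> (p12 \<and> p13))"
proof -
  have "cexact TYPE('k) 3 \<Delta> 1 \<longleftrightarrow> (\<forall>x1 x2 x3 :: 'k. (x1 \<noteq> 0 \<longrightarrow> p1) \<longrightarrow> (x2 \<noteq> 0 \<longrightarrow> p2) \<longrightarrow> (x3 \<noteq> 0 \<longrightarrow> p3) \<longrightarrow>
      x1 + x2 + x3 = 0 \<longrightarrow>
      (\<exists>y12 y13 y23. (y12 \<noteq> 0 \<longrightarrow> p12) \<and> (y13 \<noteq> 0 \<longrightarrow> p13) \<and> (y23 \<noteq> 0 \<longrightarrow> p23) \<and>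
        x1 = - (y12 + y13) \<and> x2 = y12 - y23 \<and> x3 = y13 + y23))" (is "_ \<longleftrightarrow> ?R")
    unfolding cexact_3_iff chain_on_tri p by (simp add: numeral_2_eq_2 numeral_3_eq_3 imp_conjL)
  also have "?R \<longleftrightarrow>
    (p1 \<and> p2 \<longrightarrow> p12 \<or> (p13 \<and> p23)) \<and> (p1 \<and> p3 \<longrightarrow> p13 \<or> (p12 \<and> p23)) \<and> (p2 \<and> p3 \<longrightarrow> p23 \<or> (p12 \<and> p13))"
    (is "_ \<longleftrightarrow> ?C")
  proof
    assume R: ?R
    have "p12 \<or> (p13 \<and> p23)" if h: "p1" "p2"
    proof -
      \<comment> \<open>The difference of vertices 1 and 2 is a cycle, and its filling must use the
        direct edge or both other edges. The remaining two pairs are treated alike.\<close>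
      obtain y12 y13 y23 :: 'k where "y12 \<noteq> 0 \<longrightarrow> p12" "y13 \<noteq> 0 \<longrightarrow> p13" "y23 \<noteq> 0 \<longrightarrow> p23"
        "1 = - (y12 + y13)" "-1 = y12 - y23" "0 = y13 + y23"
        using R[rule_format, of 1 "-1" 0] h by auto
      then show ?thesis by (cases "y12 = 0"; cases "y13 = 0"; cases "y23 = 0") auto
    qed
    moreover have "p13 \<or> (p12 \<and> p23)" if h: "p1" "p3"
    proof -
      obtain y12 y13 y23 :: 'k where "y12 \<noteq> 0 \<longrightarrow> p12" "y13 \<noteq> 0 \<longrightarrow> p13" "y23 \<noteq> 0 \<longrightarrow> p23"
        "1 = - (y12 + y13)" "0 = y12 - y23" "-1 = y13 + y23"
        using R[rule_format, of 1 0 "-1"] h by auto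
      then show ?thesis by (cases "y12 = 0"; cases "y13 = 0"; cases "y23 = 0") auto
    qed
    moreover have "p23 \<or> (p12 \<and> p13)" if h: "p2" "p3"
    proof -
      obtain y12 y13 y23 :: 'k where "y12 \<noteq> 0 \<longrightarrow> p12" "y13 \<noteq> 0 \<longrightarrow> p13" "y23 \<noteq> 0 \<longrightarrow> p23"
        "0 = - (y12 + y13)" "1 = y12 - y23" "-1 = y13 + y23"
        using R[rule_format, of 0 1 "-1"] h by auto
      then show ?thesis by (cases "y12 = 0"; cases "y13 = 0"; cases "y23 = 0") auto
    qed
    ultimately show ?C by blast
  next
    assume C: ?C
    show ?R
    proof (intro allI impI)
      fix x1 x2 x3 :: 'k
      assume x: "x1 \<noteq> 0 \<longrightarrow> p1" "x2 \<noteq> 0 \<longrightarrow> p2" "x3 \<noteq> 0 \<longrightarrow> p3" and s: "x1 + x2 + x3 = 0"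
      have s1: "x1 = - (x2 + x3)" and s2: "x2 = - x1 - x3" and s3: "x3 = - x1 - x2"
      proof -
        show "x1 = - (x2 + x3)" using s by (simp only: eq_neg_iff_add_eq_0 add.assoc)
        then show "x2 = - x1 - x3" "x3 = - x1 - x2" by simp_all
      qed
      let ?G = "\<lambda>y12 y13 y23. (y12 \<noteq> 0 \<longrightarrow> p12) \<and> (y13 \<noteq> 0 \<longrightarrow> p13) \<and> (y23 \<noteq> 0 \<longrightarrow> p23) \<and>
        x1 = - (y12 + y13) \<and> x2 = y12 - y23 \<and> x3 = y13 + y23"
      \<comment> \<open>Fillings with one edge left out: the equations then determine the other two
        coefficients.\<close>
      have a: "?G x2 x3 0" if "x2 \<noteq> 0 \<longrightarrow> p12" "x3 \<noteq> 0 \<longrightarrow> p13" using that s1 by simp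
      have b: "?G (- x1) 0 x3" if "x1 \<noteq> 0 \<longrightarrow> p12" "x3 \<noteq> 0 \<longrightarrow> p23" using that s2 by simp
      have c: "?G 0 (- x1) (- x2)" if "x1 \<noteq> 0 \<longrightarrow> p13" "x2 \<noteq> 0 \<longrightarrow> p23" using that s3 by simp
      have z: "\<not> x1 \<noteq> 0 \<longrightarrow> \<not> x2 \<noteq> 0 \<longrightarrow> \<not> x3 \<noteq> 0" "\<not> x1 \<noteq> 0 \<longrightarrow> \<not> x3 \<noteq> 0 \<longrightarrow> \<not> x2 \<noteq> 0"
          "\<not> x2 \<noteq> 0 \<longrightarrow> \<not> x3 \<noteq> 0 \<longrightarrow> \<not> x1 \<noteq> 0"
        using s by auto
      have "(x2 \<noteq> 0 \<longrightarrow> p12) \<and> (x3 \<noteq> 0 \<longrightarrow> p13) \<or> (x1 \<noteq> 0 \<longrightarrow> p12) \<and> (x3 \<noteq> 0 \<longrightarrow> p23) \<or>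
        (x1 \<noteq> 0 \<longrightarrow> p13) \<and> (x2 \<noteq> 0 \<longrightarrow> p23)"
        by (rule edge_choice[OF x z C[THEN conjunct1] C[THEN conjunct2, THEN conjunct1] C[THEN conjunct2, THEN conjunct2]])
      then show "\<exists>y12 y13 y23. ?G y12 y13 y23"
      proof (elim disjE conjE)
        assume "x2 \<noteq> 0 \<longrightarrow> p12" "x3 \<noteq> 0 \<longrightarrow> p13"
        then show ?thesis by (intro exI) (rule a)
      next
        assume "x1 \<noteq> 0 \<longrightarrow> p12" "x3 \<noteq> 0 \<longrightarrow> p23"
        then show ?thesis by (intro exI) (rule b)
      next
        assume "x1 \<noteq> 0 \<longrightarrow> p13" "x2 \<noteq> 0 \<longrightarrow> p23"
        then show ?thesis by (intro exI) (rule c)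
      qed
    qed
  qed
  finally show ?thesis .
qed

text \<open>A cycle on the edges of three vertices is a multiple of the boundary of the triangle,
  with coefficients 1, -1, 1 on the edges 12, 13, 23. It can be filled by the full triangle
  alone.\<close>

lemma cexact_3_2: "cexact TYPE('k::field) 3 \<Delta> 2 \<longleftrightarrow> (p12 \<and> p13 \<and> p23 \<longrightarrow> p123)"
proof -
  have "cexact TYPE('k) 3 \<Delta> 2 \<longleftrightarrow> (\<forall>x12 x13 x23 :: 'k. (x12 \<noteq> 0 \<longrightarrow> p12) \<longrightarrow> (x13 \<noteq> 0 \<longrightarrow> p13) \<longrightarrow> (x23 \<noteq> 0 \<longrightarrow> p23) \<longrightarrow>
      x12 + x13 = 0 \<longrightarrow> x12 - x23 = 0 \<longrightarrow> x13 + x23 = 0 \<longrightarrow>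
      (\<exists>y123. (y123 \<noteq> 0 \<longrightarrow> p123) \<and> x12 = y123 \<and> x13 = - y123 \<and> x23 = y123))" (is "_ \<longleftrightarrow> ?R")
    unfolding cexact_3_iff chain_on_tri p by (simp add: numeral_2_eq_2 numeral_3_eq_3 imp_conjL)
  also have "?R \<longleftrightarrow> (p12 \<and> p13 \<and> p23 \<longrightarrow> p123)"
  proof
    assume R: ?R
    show "p12 \<and> p13 \<and> p23 \<longrightarrow> p123"
      using R[rule_format, of 1 "-1" 1] by auto
  next
    assume C: "p12 \<and> p13 \<and> p23 \<longrightarrow> p123"
    show ?R
    proof (intro allI impI)
      fix x12 x13 x23 :: 'k
      assume x: "x12 \<noteq> 0 \<longrightarrow> p12" "x13 \<noteq> 0 \<longrightarrow> p13" "x23 \<noteq> 0 \<longrightarrow> p23"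
        and s: "x12 + x13 = 0" "x12 - x23 = 0" "x13 + x23 = 0"
      have e: "x23 = x12" "x13 = - x12" using s by (auto simp: eq_neg_iff_add_eq_0 add.commute)
      show "\<exists>y123. (y123 \<noteq> 0 \<longrightarrow> p123) \<and> x12 = y123 \<and> x13 = - y123 \<and> x23 = y123"
        using x C unfolding e by (intro exI[of _ x12]) auto
    qed
  qed
  finally show ?thesis .
qed

text \<open>In degree 3 a nonzero multiple of the triangle is not a cycle, and higher degrees have
  no faces.\<close>

lemma cexact_3_ge: "i \<ge> 3 \<Longrightarrow> cexact TYPE('k::field) 3 \<Delta> i"
  unfolding cexact_3_iff chain_on_tri p by (intro allI impI exI[of _ 0]) auto

end

section \<open>Apery and exceptional sets\<close>

lemma three_neq: "(1::3) \<noteq> 2" "(1::3) \<noteq> 3" "(2::3) \<noteq> 3" "(2::3) \<noteq> 1" "(3::3) \<noteq> 1" "(3::3) \<noteq> 2"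
  by simp_all

lemma ex_3: "(\<exists>i::3. P i) \<longleftrightarrow> P 1 \<or> P 2 \<or> P 3"
  using forall_3[of "\<lambda>i. \<not> P i"] by auto

lemma vsize_axis: "vsize (axis i D) = D"
  by (simp add: vsize_def axis_def)

lemma vsize_3: "vsize v = v $ 1 + v $ 2 + v $ 3"
  by (simp add: vsize_def sum_3)

lemma component_le_vsize: "v $ i \<le> vsize v"
  by (simp add: vsize_def member_le_sum)

locale toric_surface = toric +
  assumes n3: "n \<ge> 3" and a1: "a (n - 2) = axis 1 D" and a2: "a (n - 1) = axis 2 D" and a3: "a n = axis 3 D"
begin

definition S :: "(nat^3) set" where "S = spanned_monoid n a"

lemma axis_S: "axis i D \<in> S"
proof -
  have "axis 1 D \<in> S" "axis 2 D \<in> S" "axis 3 D \<in> S"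
    unfolding S_def a1[symmetric] a2[symmetric] a3[symmetric] using n3 by (auto intro!: a_mem)
  then show ?thesis using forall_3[of "\<lambda>i. axis i D \<in> S"] by blast
qed

lemma zero_S: "0 \<in> S"
  unfolding S_def spanned_monoid_eq by (rule image_eqI[of _ _ 0]) (simp_all add: evec_sum_def mons_def)

lemma add_S: "x \<in> S \<Longrightarrow> y \<in> S \<Longrightarrow> x + y \<in> S"
  unfolding S_def by (rule S_add)

lemma scaled_S: "D *s x \<in> S"
proof -
  have m: "m *s y \<in> S" if "y \<in> S" for m :: nat and y
  proof (induction m)
    case 0
    have "0 *s y = 0" by (simp add: vec_eq_iff)
    then show ?case by (simp add: zero_S)
  next
    case (Suc m)
    have "Suc m *s y = y + m *s y" by (simp add: vec_eq_iff)
    then show ?case using Suc that add_S by simp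
  qed
  have "D *s x = x $ 1 *s axis 1 D + x $ 2 *s axis 2 D + x $ 3 *s axis 3 D"
    by (simp add: vec_eq_iff forall_3 axis_def)
  then show ?thesis using m axis_S add_S by simp
qed

text \<open>An element in which each of the \<open>n\<close> generators, all of size
  \<open>D\<close>, occurs fewer than \<open>D\<close> times has at most this size.\<close>

definition bound :: nat where "bound = n * D * D"

text \<open>Since \<^term>\<open>D\<close> copies of any generator form a combination of the \<open>axis i D\<close>, every element
  of the monoid is congruent to a bounded one modulo the \<open>axis i D\<close>.\<close>

lemma decompose: "s \<in> S \<Longrightarrow> \<exists>r\<in>S. \<exists>x. vsize r \<le> bound \<and> s = r + D *s x"
proof (induction "vsize s" arbitrary: s rule: less_induct)
  case less
  obtain u where u: "u \<in> mons n" "s = evec_sum a u" using less.prems by (auto simp: S_def spanned_monoid_eq)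
  show ?case
  proof (cases "\<exists>k\<in>{1..n}. lookup u k \<ge> D")
    case True
    then obtain k where k: "k \<in> {1..n}" "lookup u k \<ge> D" by blast
    define u' where "u' = u - single k D"
    have uu: "u = u' + single k D"
      by (rule poly_mapping_eqI) (use k in \<open>auto simp: u'_def lookup_add lookup_minus lookup_single when_def\<close>)
    have u': "u' \<in> mons n" using u(1) by (auto simp: mons_def u'_def in_keys_iff lookup_minus)
    have "evec_sum a (single k D) = D *s a k" using D_pos by (simp add: evec_sum_def)
    then have s: "s = evec_sum a u' + D *s a k" using u(2) uu evec_sum_add by metis
    have "vsize (a k) = D" using a_size k by auto
    then have "vsize (evec_sum a u') < vsize s" using D_pos by (simp add: s vsize_add vsize_smult)
    moreover have "evec_sum a u' \<in> S" using u' by (auto simp: S_def spanned_monoid_eq)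
    ultimately obtain r x where "r \<in> S" "vsize r \<le> bound" "evec_sum a u' = r + D *s x"
      using less.hyps by blast
    moreover have "r + D *s x + D *s a k = r + D *s (x + a k)" for r x
      by (simp add: vec_eq_iff algebra_simps)
    ultimately show ?thesis using s by metis
  next
    case False
    have "mon_degree u = (\<Sum>k\<in>{1..n}. lookup u k)"
      using u(1) by (intro mon_degree_eq_sum) (auto simp: mons_def)
    also have "\<dots> \<le> (\<Sum>k\<in>{1..n}. D)" using False by (intro sum_mono) (auto simp: not_le intro: less_imp_le)
    finally have "vsize s \<le> bound" unfolding u(2) vsize_evec_sum[OF u(1)] bound_def by simp
    moreover have "s = s + D *s 0" by (simp add: vec_eq_iff)
    ultimately show ?thesis using less.prems by blast
  qed
qed

text \<open>The bounded remainder of \<open>s\<close> contributes at most \<open>bound\<close> to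
  coordinate \<open>i\<close>. The excess comes from the part divisible by \<open>D\<close>, from
  which one \<open>axis i D\<close> can be taken away.\<close>

lemma subtract_axis:
  assumes "s \<in> S" "s $ i > bound"
  shows "\<exists>u\<in>S. s = u + axis i D"
proof -
  obtain r x where r: "r \<in> S" "vsize r \<le> bound" "s = r + D *s x" using decompose[OF assms(1)] by blast
  have "r $ i \<le> bound" using component_le_vsize[of r i] r(2) by simp
  moreover have "s $ i = r $ i + D * x $ i" by (simp add: r(3))
  ultimately have "D * x $ i \<noteq> 0" using assms(2) by linarith
  then have xi: "x $ i > 0" by simp
  define y where "y = (\<chi> j. if j = i then x $ i - 1 else x $ j)"
  have "D *s x = D *s y + axis i D"
    using xi by (auto simp: vec_eq_iff y_def axis_def algebra_simps)
  then have "s = (r + D *s y) + axis i D" using r(3) by (simp add: add.assoc)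
  then show ?thesis using add_S[OF r(1) scaled_S] by blast
qed

section \<open>Divisor complexes of the three axes\<close>

abbreviation E3 :: "(nat^3) list" where
  "E3 \<equiv> [axis 1 D, axis 2 D, axis 3 D]"

sublocale E: monomial_module E3 S "\<lambda>v. int (vsize v div D)"
proof
  fix g x assume g: "g \<in> set E3"
  show "x \<in> S \<Longrightarrow> g + x \<in> S" using g axis_S add_S by auto
  show "int (vsize (g + x) div D) = 1 + int (vsize x div D)"
    using g D_pos by (auto simp: vsize_add vsize_axis)
qed

abbreviation dm :: "nat^3 \<Rightarrow> nat^3 \<Rightarrow> bool" where
  "dm s v \<equiv> diff_mem s v S"

lemma faces_eq:
  "E.faces s [False, False, False] \<longleftrightarrow> s \<in> S"
  "E.faces s [True, False, False] \<longleftrightarrow> dm s (axis 1 D)"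
  "E.faces s [False, True, False] \<longleftrightarrow> dm s (axis 2 D)"
  "E.faces s [False, False, True] \<longleftrightarrow> dm s (axis 3 D)"
  "E.faces s [True, True, False] \<longleftrightarrow> dm s (axis 1 D + axis 2 D)"
  "E.faces s [True, False, True] \<longleftrightarrow> dm s (axis 1 D + axis 3 D)"
  "E.faces s [False, True, True] \<longleftrightarrow> dm s (axis 2 D + axis 3 D)"
  "E.faces s [True, True, True] \<longleftrightarrow> dm s (axis 1 D + axis 2 D + axis 3 D)"
  by (auto simp: E.faces_def diff_mem_def algebra_simps)

lemma dm_subset: "dm s (v + axis i D) \<Longrightarrow> dm s v"
  unfolding diff_mem_def using add_S axis_S by (metis add.assoc add.commute)

lemma dm_zero: "dm s 0 \<longleftrightarrow> s \<in> S"
  by (simp add: diff_mem_def)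

lemma dm_S: "dm s (axis i D) \<Longrightarrow> s \<in> S"
  using dm_subset[of s 0 i] by (simp add: dm_zero)

lemma dm_pair: "dm s (axis i D + axis j D) \<Longrightarrow> dm s (axis i D)" "dm s (axis i D + axis j D) \<Longrightarrow> dm s (axis j D)"
  using dm_subset[of s "axis i D" j] dm_subset[of s "axis j D" i] by (simp_all add: add.commute)

text \<open>The constant \<open>2 * D\<close> is the size of a face with two vertices: after
  subtracting \<open>v\<close>, coordinate \<open>i\<close> still exceeds
  \<open>bound\<close>.\<close>

lemma dm_extend:
  assumes "dm s v" "vsize v \<le> 2 * D" "s $ i > bound + 2 * D"
  shows "dm s (v + axis i D)"
proof -
  obtain u where u: "u \<in> S" "s = u + v" using assms(1) by (auto simp: diff_mem_def)
  have "u $ i > bound" using assms(3) component_le_vsize[of v i] assms(2) u(2) by simp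
  then obtain u' where "u' \<in> S" "u = u' + axis i D" using subtract_axis[OF u(1)] by blast
  then show ?thesis using u(2) by (auto simp: diff_mem_def algebra_simps)
qed

text \<open>Dictionary of complexes on three vertices. The Apery set gives the empty face alone;
  \<open>exc20\<close> is two points, \<open>exc30\<close> three points and \<open>exc31\<close> an
  edge with an isolated point, which are all the disconnected complexes; \<open>exc33\<close> is the
  hollow triangle. For \<open>s\<close> outside \<open>S\<close> there is no face at all and hence
  no homology.\<close>

lemma cexact_faces:
  "cexact TYPE('k::field) 3 (E.faces s) 0 \<longleftrightarrow> s \<notin> apery D S"
  "cexact TYPE('k::field) 3 (E.faces s) 1 \<longleftrightarrow> s \<notin> exc31 D S \<union> exc20 D S \<union> exc30 D S"
  "cexact TYPE('k::field) 3 (E.faces s) 2 \<longleftrightarrow> s \<notin> exc33 D S"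
  "i \<ge> 3 \<Longrightarrow> cexact TYPE('k::field) 3 (E.faces s) i"
proof -
  note sym = add.commute[of "axis 2 D" "axis 1 D"] add.commute[of "axis 3 D" "axis 1 D"]
    add.commute[of "axis 3 D" "axis 2 D"]
  define p1 p2 p3 p12 p13 p23 p123 where
    p: "p1 = dm s (axis 1 D)" "p2 = dm s (axis 2 D)" "p3 = dm s (axis 3 D)" "p12 = dm s (axis 1 D + axis 2 D)"
       "p13 = dm s (axis 1 D + axis 3 D)" "p23 = dm s (axis 2 D + axis 3 D)"
       "p123 = dm s (axis 1 D + axis 2 D + axis 3 D)"
  \<comment> \<open>Faces are closed under passing to subsets, because the \<open>axis i D\<close>
    lie in \<open>S\<close>. This excludes truth values that no complex realises.\<close>
  have mono: "p1 \<Longrightarrow> s \<in> S" "p2 \<Longrightarrow> s \<in> S" "p3 \<Longrightarrow> s \<in> S" "p12 \<Longrightarrow> p1" "p12 \<Longrightarrow> p2" "p13 \<Longrightarrow> p1" "p13 \<Longrightarrow> p3"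
    "p23 \<Longrightarrow> p2" "p23 \<Longrightarrow> p3"
    unfolding p using dm_S dm_pair by blast+
  note c = cexact_3_0[OF faces_eq, where ?'k = 'k] cexact_3_1[OF faces_eq, where ?'k = 'k]
    cexact_3_2[OF faces_eq, where ?'k = 'k] cexact_3_ge[OF faces_eq, where ?'k = 'k]
  show "cexact TYPE('k::field) 3 (E.faces s) 0 \<longleftrightarrow> s \<notin> apery D S"
    unfolding c(1) apery_def mem_Collect_eq forall_3 by blast
  have e31: "s \<in> exc31 D S \<longleftrightarrow> p1 \<and> p2 \<and> p3 \<and>
    (p12 \<and> \<not> p13 \<and> \<not> p23 \<or> p13 \<and> \<not> p12 \<and> \<not> p23 \<or> p23 \<and> \<not> p12 \<and> \<not> p13)"
    using mono unfolding exc31_def mem_Collect_eq forall_3 ex_3 distinct.simps list.set sym p[symmetric]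
    by (auto simp: three_neq)
  have e20: "s \<in> exc20 D S \<longleftrightarrow> p1 \<and> p2 \<and> \<not> p3 \<and> \<not> p12 \<or> p1 \<and> p3 \<and> \<not> p2 \<and> \<not> p13 \<or> p2 \<and> p3 \<and> \<not> p1 \<and> \<not> p23"
    using mono unfolding exc20_def mem_Collect_eq ex_3 distinct.simps list.set sym p[symmetric]
    by (auto simp: three_neq)
  have e30: "s \<in> exc30 D S \<longleftrightarrow> p1 \<and> p2 \<and> p3 \<and> \<not> p12 \<and> \<not> p13 \<and> \<not> p23"
    using mono unfolding exc30_def mem_Collect_eq forall_3 sym p[symmetric]
    by (auto simp: three_neq)
  have e33: "s \<in> exc33 D S \<longleftrightarrow> p12 \<and> p13 \<and> p23 \<and> \<not> p123"
    using mono unfolding exc33_def mem_Collect_eq forall_3 sym p[symmetric]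
    by (auto simp: three_neq)
  show "cexact TYPE('k::field) 3 (E.faces s) 1 \<longleftrightarrow> s \<notin> exc31 D S \<union> exc20 D S \<union> exc30 D S"
    unfolding c(2) Un_iff e31 e20 e30 p[symmetric] using mono by blast
  show "cexact TYPE('k::field) 3 (E.faces s) 2 \<longleftrightarrow> s \<notin> exc33 D S"
    unfolding c(3) e33 p[symmetric] by blast
  show "i \<ge> 3 \<Longrightarrow> cexact TYPE('k::field) 3 (E.faces s) i" by (rule c(4))
qed

text \<open>A large coordinate \<open>j\<close> lets vertex \<open>j\<close> be joined to every
  face, so the complex is void or a cone with apex \<open>j\<close>.\<close>

lemma cexact_faces_large:
  assumes "s $ j > bound + 2 * D"
  shows "cexact TYPE('k::field) 3 (E.faces s) i"
proof -
  have ext: "dm s v \<Longrightarrow> vsize v \<le> 2 * D \<Longrightarrow> dm s (v + axis j D)" for v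
    using dm_extend assms by blast
  have sz: "vsize (axis k D) \<le> 2 * D" "vsize (axis k D + axis l D) \<le> 2 * D" "vsize 0 \<le> 2 * D" for k l
    by (simp_all add: vsize_axis vsize_add) (simp add: vsize_def)
  note x0 = ext[of 0, unfolded add_0 dm_zero, OF _ sz(3)] and x1 = ext[OF _ sz(1)] and x2 = ext[OF _ sz(2)]
  have j: "j = 1 \<or> j = 2 \<or> j = 3" by (rule exhaust_3)
  have comm: "axis 2 D + axis 1 D = axis 1 D + (axis 2 D :: nat^3)" "axis 3 D + axis 1 D = axis 1 D + (axis 3 D :: nat^3)"
    "axis 3 D + axis 2 D = axis 2 D + (axis 3 D :: nat^3)"
    "axis 2 D + axis 3 D + axis 1 D = axis 1 D + axis 2 D + (axis 3 D :: nat^3)"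
    "axis 1 D + axis 3 D + axis 2 D = axis 1 D + axis 2 D + (axis 3 D :: nat^3)"
    by (simp_all add: algebra_simps)
  note c = cexact_3_0[OF faces_eq, where ?'k = 'k] cexact_3_1[OF faces_eq, where ?'k = 'k]
    cexact_3_2[OF faces_eq, where ?'k = 'k] cexact_3_ge[OF faces_eq, where ?'k = 'k]
  have c0: "cexact TYPE('k) 3 (E.faces s) 0" unfolding c(1) using j x0 by blast
  have c1: "cexact TYPE('k) 3 (E.faces s) 1"
    unfolding c(2) using j x1[of 1] x1[of 2] x1[of 3] by (auto simp: comm)
  have c2: "cexact TYPE('k) 3 (E.faces s) 2"
    unfolding c(3) using j x2[of 1 2] x2[of 1 3] x2[of 2 3] by (auto simp: comm)
  consider "i = 0" | "i = 1" | "i = 2" | "i \<ge> 3" by linarith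
  then show ?thesis using c0 c1 c2 c(4) by cases auto
qed

lemma bad_bounded:
  assumes "\<not> cexact TYPE('k::field) 3 (E.faces s) i"
  shows "vsize s \<le> 3 * (bound + 2 * D)"
proof -
  have "s $ j \<le> bound + 2 * D" for j
    using cexact_faces_large[of s j, where ?'k = 'k] assms by (meson not_le)
  from this[of 1] this[of 2] this[of 3] show ?thesis unfolding vsize_3 by simp
qed

section \<open>Values of \<open>t\<close> with nonvanishing homology\<close>

definition level_of :: "nat^3 \<Rightarrow> int" where
  "level_of s = int (vsize s div D)"

text \<open>The level of \<open>s\<close> is the internal degree of its strand, and the subtracted
  number is the homological degree in which its complex has homology. No field enters this
  description.\<close>

definition bad_slopes :: "int set" where
  "bad_slopes = level_of ` apery D S \<union> (\<lambda>s. level_of s - 1) ` (exc31 D S \<union> exc20 D S \<union> exc30 D S) \<union>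
     (\<lambda>s. level_of s - 2) ` exc33 D S"

lemma bad_slopes_iff:
  "t \<notin> bad_slopes \<longleftrightarrow> (\<forall>i. kexact (mops E3) (tmod n D a :: int \<Rightarrow> (nat^3 \<Rightarrow>\<^sub>0 'k::field) set) i t)"
proof -
  have k: "kexact (mops E3) (tmod n D a :: int \<Rightarrow> (nat^3 \<Rightarrow>\<^sub>0 'k::field) set) i t \<longleftrightarrow>
      (\<forall>s. level_of s = t + int i \<longrightarrow> cexact TYPE('k) 3 (E.faces s) i)" for i
    using E.kexact_mmod_iff[where ?'k = 'k, of i t]
    by (simp add: tmod_def S_def level_of_def numeral_3_eq_3)
  have "(\<forall>i. kexact (mops E3) (tmod n D a :: int \<Rightarrow> (nat^3 \<Rightarrow>\<^sub>0 'k::field) set) i t) \<longleftrightarrow>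
    kexact (mops E3) (tmod n D a :: int \<Rightarrow> (nat^3 \<Rightarrow>\<^sub>0 'k::field) set) 0 t \<and>
    kexact (mops E3) (tmod n D a :: int \<Rightarrow> (nat^3 \<Rightarrow>\<^sub>0 'k::field) set) 1 t \<and>
    kexact (mops E3) (tmod n D a :: int \<Rightarrow> (nat^3 \<Rightarrow>\<^sub>0 'k::field) set) 2 t"
  proof -
    have "kexact (mops E3) (tmod n D a :: int \<Rightarrow> (nat^3 \<Rightarrow>\<^sub>0 'k::field) set) i t" if "i \<ge> 3" for i
      unfolding k using cexact_faces(4)[OF that] by blast
    moreover have "i = 0 \<or> i = 1 \<or> i = 2 \<or> i \<ge> 3" for i :: nat by linarith
    ultimately show ?thesis by metis
  qed
  also have "\<dots> \<longleftrightarrow> t \<notin> bad_slopes"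
  proof -
    have img: "t \<in> (\<lambda>s. level_of s - c) ` F \<longleftrightarrow> (\<exists>s\<in>F. level_of s = t + c)" for c F by force
    have img0: "t \<in> level_of ` F \<longleftrightarrow> (\<exists>s\<in>F. level_of s = t)" for F by auto
    show ?thesis
      unfolding k cexact_faces bad_slopes_def Un_iff[of t] img img0 of_nat_0 of_nat_1 of_nat_numeral add_0_right
      by blast
  qed
  finally show ?thesis by blast
qed

text \<open>The sets do not refer to a field, so homology over any field can be used to bound them;
  \<open>rat\<close> is taken.\<close>

lemma exceptional_bounded:
  assumes "s \<in> apery D S \<or> s \<in> exc31 D S \<or> s \<in> exc20 D S \<or> s \<in> exc30 D S \<or> s \<in> exc33 D S"
  shows "vsize s \<le> 3 * (bound + 2 * D)"
  using assms cexact_faces(1-3)[where ?'k = rat, of s] bad_bounded[where ?'k = rat, of s] by blast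

lemma vsize_S: "s \<in> S \<Longrightarrow> vsize s = (vsize s div D) * D"
  using vsize_evec_sum D_pos by (auto simp: S_def spanned_monoid_eq)

text \<open>Sizes in \<open>S\<close> are multiples of \<open>D\<close>, so every element of
  \<open>F\<close> lies in exactly one \<open>level\<close>, with index \<open>level_of\<close>. The
  bound \<open>K\<close> leaves finitely many levels, so the maximum is attained.\<close>

lemma max_level_eq:
  assumes "F \<subseteq> S" "\<And>s. s \<in> F \<Longrightarrow> vsize s \<le> K"
  shows "F = {} \<and> max_level D F = -\<infinity> \<or>
    (\<exists>s\<in>F. max_level D F = ereal (real_of_int (level_of s)) \<and> (\<forall>s'\<in>F. level_of s' \<le> level_of s))"
proof (cases "F = {}")
  case True
  then show ?thesis by (simp add: max_level_def)
next
  case False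
  have lev: "{m. F \<inter> level D m \<noteq> {}} = (\<lambda>s. vsize s div D) ` F"
  proof (intro equalityI subsetI)
    fix m assume "m \<in> {m. F \<inter> level D m \<noteq> {}}"
    then obtain s where "s \<in> F" "vsize s = m * D" by (auto simp: level_def)
    then show "m \<in> (\<lambda>s. vsize s div D) ` F" using D_pos by (intro rev_image_eqI[of s]) auto
  next
    fix m assume "m \<in> (\<lambda>s. vsize s div D) ` F"
    then obtain s where s: "s \<in> F" "m = vsize s div D" by auto
    then have "vsize s = m * D" using vsize_S assms(1) by blast
    then show "m \<in> {m. F \<inter> level D m \<noteq> {}}" using s(1) by (auto simp: level_def)
  qed
  have "(\<lambda>s. vsize s div D) ` F \<subseteq> {..K}"
    using assms(2) by (auto intro: order_trans[OF div_le_dividend])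
  then have fin: "finite ((\<lambda>s. vsize s div D) ` F)" by (rule finite_subset) simp
  have "Max ((\<lambda>s. vsize s div D) ` F) \<in> (\<lambda>s. vsize s div D) ` F"
    using fin False by (intro Max_in) auto
  then obtain s where s: "s \<in> F" "Max ((\<lambda>s. vsize s div D) ` F) = vsize s div D" by auto
  have "level_of s' \<le> level_of s" if "s' \<in> F" for s'
    using Max_ge[OF fin, of "vsize s' div D"] that s(2) by (simp add: level_of_def)
  then show ?thesis using s False by (auto simp: max_level_def lev level_of_def)
qed

lemma max_level_bounds:
  assumes "F \<in> {apery D S, exc31 D S, exc20 D S, exc30 D S, exc33 D S}"
  shows "F = {} \<and> max_level D F = -\<infinity> \<or>
    (\<exists>s\<in>F. max_level D F = ereal (real_of_int (level_of s)) \<and> (\<forall>s'\<in>F. level_of s' \<le> level_of s))"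
proof (rule max_level_eq)
  show "F \<subseteq> S" using assms by (auto simp: apery_def exc31_def exc20_def exc30_def exc33_def)
  show "vsize s \<le> 3 * (bound + 2 * D)" if "s \<in> F" for s
    using exceptional_bounded[of s] assms that by auto
qed

lemma max_level_le:
  assumes "F \<in> {apery D S, exc31 D S, exc20 D S, exc30 D S, exc33 D S}" "\<And>s. s \<in> F \<Longrightarrow> level_of s - c \<le> r"
  shows "max_level D F - ereal (real_of_int c) \<le> ereal (real_of_int r)"
proof -
  consider "max_level D F = -\<infinity>" | s where "s \<in> F" "max_level D F = ereal (real_of_int (level_of s))"
    using max_level_bounds[OF assms(1)] by blast
  then show ?thesis
  proof cases
    case 2
    then show ?thesis using assms(2)[OF 2(1)] by simp
  qed simp
qed

lemma max_level_ge:
  assumes "F \<in> {apery D S, exc31 D S, exc20 D S, exc30 D S, exc33 D S}" "s \<in> F"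
  shows "ereal (real_of_int (level_of s - c)) \<le> max_level D F - ereal (real_of_int c)"
proof -
  obtain s' where "max_level D F = ereal (real_of_int (level_of s'))" "level_of s \<le> level_of s'"
    using max_level_bounds[OF assms(1)] assms(2) by blast
  then show ?thesis by simp
qed

lemma bad_slopes_finite: "finite bad_slopes" and bad_slopes_nonempty: "bad_slopes \<noteq> {}"
proof -
  let ?K = "int (3 * (bound + 2 * D))"
  have l: "level_of s \<ge> 0" for s by (simp add: level_of_def)
  have "level_of s \<le> ?K" if "s \<in> apery D S \<or> s \<in> exc31 D S \<or> s \<in> exc20 D S \<or> s \<in> exc30 D S \<or> s \<in> exc33 D S" for s
    unfolding level_of_def of_nat_le_iff
    using exceptional_bounded[OF that] by (rule order_trans[OF div_le_dividend])
  moreover define X where "X = apery D S \<union> exc31 D S \<union> exc20 D S \<union> exc30 D S \<union> exc33 D S"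
  ultimately have "level_of ` X \<subseteq> {0..?K}" using l by auto
  then have fin: "finite (level_of ` X)" by (rule finite_subset) simp
  have "bad_slopes \<subseteq> level_of ` X \<union> (\<lambda>t. t - 1) ` level_of ` X \<union> (\<lambda>t. t - 2) ` level_of ` X"
    unfolding bad_slopes_def X_def by blast
  then show "finite bad_slopes" by (rule finite_subset) (use fin in simp)
  \<comment> \<open>By size, no \<open>axis i D\<close> can be subtracted from 0. Thus 0 is in the
    Apery set and \<open>bad_slopes\<close> has a maximum.\<close>
  have "\<not> dm 0 (axis i D)" for i
  proof
    assume "dm 0 (axis i D)"
    then obtain u where "0 = u + axis i D" by (auto simp: diff_mem_def)
    then have "vsize 0 = vsize u + D" by (metis vsize_add vsize_axis)
    then show False using D_pos by (simp add: vsize_def)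
  qed
  then have "0 \<in> apery D S" by (simp add: apery_def zero_S)
  then show "bad_slopes \<noteq> {}" by (auto simp: bad_slopes_def)
qed

section \<open>The regularity as the largest bad slope\<close>

lemma tops_split: "tops n a = mops (map a (idx (n - 3))) @ (mops E3 :: ((nat^3 \<Rightarrow>\<^sub>0 'k::comm_ring_1) \<Rightarrow> _) list)"
proof -
  define m where "m = n - 3"
  have m: "n = Suc (Suc (Suc m))" using n3 by (simp add: m_def)
  have "map a (idx n) = map a (idx (n - 3)) @ [a (n - 2), a (n - 1), a n]"
    unfolding m idx_def by simp
  then show ?thesis by (simp add: tops_def mops_def a1 a2[simplified] a3)
qed

text \<open>Above the maximum of \<open>bad_slopes\<close> the last three variables are exact; this
  is the bound with which \<open>kexact_append_iff\<close> passes to all \<open>n\<close>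
  variables.\<close>

lemma kexact_tops_iff:
  "(\<forall>t>T. \<forall>i. kexact (tops n a) (tmod n D a :: int \<Rightarrow> (nat^3 \<Rightarrow>\<^sub>0 'k::field) set) i t) \<longleftrightarrow> (\<forall>t>T. t \<notin> bad_slopes)"
proof -
  have "kexact (mops E3) (tmod n D a :: int \<Rightarrow> (nat^3 \<Rightarrow>\<^sub>0 'k::field) set) i t" if "t > Max bad_slopes" for i t
  proof -
    have "t \<notin> bad_slopes" using that Max_ge[OF bad_slopes_finite, of t] by auto
    then show ?thesis using bad_slopes_iff[of t, where ?'k = 'k] by blast
  qed
  then show ?thesis
    unfolding bad_slopes_iff[where ?'k = 'k] tops_split
    by (intro kexact_append_iff) (use commuting_tops[of n a] graded_tmod in \<open>simp_all add: tops_split\<close>)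
qed

lemma kexact_tops_neg:
  assumes "t < 0"
  shows "kexact (tops n a) (tmod n D a :: int \<Rightarrow> (nat^3 \<Rightarrow>\<^sub>0 'k::field) set) i t"
proof -
  have z: "q = 0" if "q \<in> tmod n D a t" for q :: "nat^3 \<Rightarrow>\<^sub>0 'k"
  proof -
    have "s \<notin> keys q" for s using that assms by (auto simp: tmod_def mmod_def)
    then show ?thesis by (intro poly_mapping_eqI) (simp add: in_keys_iff)
  qed
  show ?thesis
    unfolding kexact_def
  proof (intro ballI impI)
    fix c :: "bool list \<Rightarrow> nat^3 \<Rightarrow>\<^sub>0 'k"
    assume c: "c \<in> kspace (length (tops n a :: ((nat^3 \<Rightarrow>\<^sub>0 'k) \<Rightarrow> _) list)) (tmod n D a) i t"
    have "c w = 0" for w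
      using c z[of "c w"] unfolding kspace_def by (cases "length w = n \<and> trues w = i") auto
    then have "c = 0" by auto
    then show "\<exists>b\<in>kspace (length (tops n a :: ((nat^3 \<Rightarrow>\<^sub>0 'k) \<Rightarrow> _) list)) (tmod n D a) (Suc i) (t - 1). kdiff (tops n a) b = c"
      using kspace_group(1)[OF graded_tmod]
        Modules.additive.zero[OF commuting_ops_additive_kdiff[OF commuting_tops]] by blast
  qed
qed

text \<open>What transfers from three operators to \<open>n\<close> are statements about all
  \<open>t\<close> above a threshold. The thresholds \<open>?r\<close> and \<open>?r - 1\<close>
  together locate the largest \<open>t\<close> with homology.\<close>

lemma reg_eq:
  "reg_quotient n (toric_ideal n a :: ('k::field mpoly) set) = ereal (real_of_int (Max bad_slopes))"
proof -
  let ?I = "toric_ideal n a :: ('k::field mpoly) set"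
  let ?ex = "\<lambda>i t. kexact (tops n a) (tmod n D a :: int \<Rightarrow> (nat^3 \<Rightarrow>\<^sub>0 'k::field) set) i t"
  let ?A = "{t. \<exists>i. \<not> ?ex i t}"
  let ?r = "Max bad_slopes"
  have up: "t \<le> ?r" if "t \<in> ?A" for t
  proof (rule ccontr)
    assume "\<not> t \<le> ?r"
    moreover have "\<forall>t>?r. t \<notin> bad_slopes" using Max_ge[OF bad_slopes_finite] by (meson not_le)
    ultimately show False using \<open>t \<in> ?A\<close> kexact_tops_iff[of ?r, where ?'k = 'k] by auto
  qed
  have mem: "?r \<in> ?A"
  proof (rule ccontr)
    assume "?r \<notin> ?A"
    then have "\<forall>t>?r - 1. \<forall>i. ?ex i t" using up by (smt (verit, best) mem_Collect_eq)
    then have "?r \<notin> bad_slopes" using kexact_tops_iff[of "?r - 1", where ?'k = 'k] by auto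
    then show False using Max_in[OF bad_slopes_finite bad_slopes_nonempty] by blast
  qed
  \<comment> \<open>Homology is confined between 0 and \<open>?r\<close>, since k[S] has no elements
    of negative degree. This is the finiteness on which the existence of a resolution rests.\<close>
  have fin: "finite {t. \<not> ?ex i t}" for i
  proof (rule finite_subset)
    show "{t. \<not> ?ex i t} \<subseteq> {0..?r}"
    proof
      fix t assume t: "t \<in> {t. \<not> ?ex i t}"
      then have "t \<le> ?r" using up by blast
      moreover have "t \<ge> 0" using t kexact_tops_neg[of t i, where ?'k = 'k] by force
      ultimately show "t \<in> {0..?r}" by simp
    qed
  qed simp
  obtain degs aug phi where "minimal_graded_free_resolution n ?I degs aug phi"
    using minimal_resolution_exists[OF fin] by blast
  \<comment> \<open>As a minimal resolution exists, the degrees chosen by \<open>SOME\<close> come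
    from one.\<close>
  then have "\<exists>aug phi. minimal_graded_free_resolution n ?I (resolution_degrees n ?I) aug phi"
    unfolding resolution_degrees_def by (intro someI_ex[of "\<lambda>degs. \<exists>aug phi. minimal_graded_free_resolution n ?I degs aug phi"]) blast
  then have "j \<in> set (resolution_degrees n ?I i) \<longleftrightarrow> \<not> ?ex i (j - int i)" for i j
    using degrees_resolution_iff graded_resolution_if_minimal by blast
  then have betti: "graded_betti n ?I i j \<noteq> 0 \<longleftrightarrow> \<not> ?ex i (j - int i)" for i j
    unfolding graded_betti_def count_list_0_iff by simp
  have "(\<lambda>(i, j). ereal (real_of_int (j - int i))) ` {(i, j). graded_betti n ?I i j \<noteq> 0} =
      (\<lambda>t. ereal (real_of_int t)) ` ?A"
  proof (intro equalityI subsetI)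
    fix x assume "x \<in> (\<lambda>(i, j). ereal (real_of_int (j - int i))) ` {(i, j). graded_betti n ?I i j \<noteq> 0}"
    then obtain i j where "x = ereal (real_of_int (j - int i))" "\<not> ?ex i (j - int i)"
      using betti by auto
    then show "x \<in> (\<lambda>t. ereal (real_of_int t)) ` ?A" by blast
  next
    fix x assume "x \<in> (\<lambda>t. ereal (real_of_int t)) ` ?A"
    then obtain t i where t: "x = ereal (real_of_int t)" "\<not> ?ex i t" by auto
    then have "graded_betti n ?I i (t + int i) \<noteq> 0" using betti[of i "t + int i"] by simp
    then show "x \<in> (\<lambda>(i, j). ereal (real_of_int (j - int i))) ` {(i, j). graded_betti n ?I i j \<noteq> 0}"
      using t(1) by (intro rev_image_eqI[of "(i, t + int i)"]) auto
  qed
  then have "reg_quotient n ?I = (SUP t\<in>?A. ereal (real_of_int t))"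
    unfolding reg_quotient_def by simp
  also have "\<dots> = ereal (real_of_int ?r)"
  proof (rule antisym)
    show "(SUP t\<in>?A. ereal (real_of_int t)) \<le> ereal (real_of_int ?r)"
      by (intro SUP_least) (simp only: ereal_less_eq of_int_le_iff up)
    show "ereal (real_of_int ?r) \<le> (SUP t\<in>?A. ereal (real_of_int t))"
      by (rule SUP_upper[OF mem])
  qed
  finally show ?thesis .
qed

text \<open>The largest bad slope is attained by an element of one of the five sets, and each term
  on the left bounds the shifted levels of its set. Empty sets contribute minus infinity and do not
  affect the comparison.\<close>

lemma Max_bad_slopes_eq:
  "Max {max_level D (apery D S), max_level D (exc31 D S) - 1, max_level D (exc20 D S) - 1,
     max_level D (exc30 D S) - 1, max_level D (exc33 D S) - 2} = ereal (real_of_int (Max bad_slopes))"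
  (is "Max ?X = ereal (real_of_int ?r)")
proof (rule antisym)
  have c: "1 = ereal (real_of_int 1)" "2 = ereal (real_of_int 2)" by (simp_all add: one_ereal_def)
  \<comment> \<open>The Apery set enters with shift 0, written as a subtraction so that
    \<open>max_level_le\<close> and \<open>max_level_ge\<close> cover all five terms.\<close>
  have z: "x = x - ereal (real_of_int 0)" for x :: ereal by (cases x) auto
  have bs: "s \<in> apery D S \<Longrightarrow> level_of s \<in> bad_slopes" "s \<in> exc31 D S \<Longrightarrow> level_of s - 1 \<in> bad_slopes"
    "s \<in> exc20 D S \<Longrightarrow> level_of s - 1 \<in> bad_slopes" "s \<in> exc30 D S \<Longrightarrow> level_of s - 1 \<in> bad_slopes"
    "s \<in> exc33 D S \<Longrightarrow> level_of s - 2 \<in> bad_slopes" for s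
    unfolding bad_slopes_def by auto
  have le: "t \<le> ?r" if "t \<in> bad_slopes" for t using that bad_slopes_finite by simp
  have "max_level D (apery D S) \<le> ereal (real_of_int ?r)"
    by (subst z) (rule max_level_le; simp add: le bs)
  moreover have "max_level D (exc31 D S) - 1 \<le> ereal (real_of_int ?r)"
    unfolding c by (rule max_level_le; simp add: le bs)
  moreover have "max_level D (exc20 D S) - 1 \<le> ereal (real_of_int ?r)"
    unfolding c by (rule max_level_le; simp add: le bs)
  moreover have "max_level D (exc30 D S) - 1 \<le> ereal (real_of_int ?r)"
    unfolding c by (rule max_level_le; simp add: le bs)
  moreover have "max_level D (exc33 D S) - 2 \<le> ereal (real_of_int ?r)"
    unfolding c by (rule max_level_le; simp add: le bs)
  ultimately show "Max ?X \<le> ereal (real_of_int ?r)" by (intro Max.boundedI) auto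
  have split: "(\<exists>s\<in>apery D S. t = level_of s - 0) \<or> (\<exists>s\<in>exc31 D S. t = level_of s - 1) \<or>
      (\<exists>s\<in>exc20 D S. t = level_of s - 1) \<or> (\<exists>s\<in>exc30 D S. t = level_of s - 1) \<or>
      (\<exists>s\<in>exc33 D S. t = level_of s - 2)" if "t \<in> bad_slopes" for t
    using that unfolding bad_slopes_def by auto
  consider s where "s \<in> apery D S" "?r = level_of s - 0" | s where "s \<in> exc31 D S" "?r = level_of s - 1"
    | s where "s \<in> exc20 D S" "?r = level_of s - 1" | s where "s \<in> exc30 D S" "?r = level_of s - 1"
    | s where "s \<in> exc33 D S" "?r = level_of s - 2"
    using split[OF Max_in[OF bad_slopes_finite bad_slopes_nonempty]] by blast
  then obtain x where "x \<in> ?X" "ereal (real_of_int ?r) \<le> x"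
  proof cases
    case 1
    show thesis by (rule that[of "max_level D (apery D S)"]) (use 1 max_level_ge[of "apery D S" s 0, folded z] in simp_all)
  next
    case 2
    show thesis by (rule that[of "max_level D (exc31 D S) - 1"]) (use 2 max_level_ge[of "exc31 D S" s 1, folded c] in simp_all)
  next
    case 3
    show thesis by (rule that[of "max_level D (exc20 D S) - 1"]) (use 3 max_level_ge[of "exc20 D S" s 1, folded c] in simp_all)
  next
    case 4
    show thesis by (rule that[of "max_level D (exc30 D S) - 1"]) (use 4 max_level_ge[of "exc30 D S" s 1, folded c] in simp_all)
  next
    case 5
    show thesis by (rule that[of "max_level D (exc33 D S) - 2"]) (use 5 max_level_ge[of "exc33 D S" s 2, folded c] in simp_all)
  qed
  then show "ereal (real_of_int ?r) \<le> Max ?X" by (meson Max_ge finite.emptyI finite_insert order_trans)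
qed

end

theorem theorem2p9:
  fixes n D :: nat and a :: "nat \<Rightarrow> nat^3"
  assumes "D > 0" and "n \<ge> 3"
    and "\<forall>i\<in>{1..n}. vsize (a i) = D"
    and "a (n - 2) = axis 1 D" and "a (n - 1) = axis 2 D" and "a n = axis 3 D"
  defines "S \<equiv> spanned_monoid n a"
  shows "reg_quotient n (toric_ideal n a :: ((nat \<Rightarrow>\<^sub>0 nat) \<Rightarrow>\<^sub>0 'k::field) set) =
     Max {max_level D (apery D S),
          max_level D (exc31 D S) - 1,
          max_level D (exc20 D S) - 1,
          max_level D (exc30 D S) - 1,
          max_level D (exc33 D S) - 2}"
proof -
  interpret T: toric_surface n D a
    by unfold_locales (use assms(1-6) in auto)
  show ?thesis
    unfolding S_def T.S_def[symmetric] T.Max_bad_slopes_eq by (rule T.reg_eq)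
qed

end
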